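(* There exists a local computation algorithm (LCA) for the set cover problem with query complexity $s^{O(\log s)}\, t^{O(\log s\cdot(\log\log s+\log\log t))}$ that produces a set cover whose expected size (over the random tape) is $O(\log s)\cdot \mathrm{OPT}$, where $\mathrm{OPT}$ denotes the value of an optimal fractional set cover of the input instance.
   Context: An instance of set cover consists of a universe $\mathcal{E}$ of $n$ elements and a family $\mathcal{S}\subseteq 2^{\mathcal{E}}$ of $m$ sets whose union is $\mathcal{E}$; a set cover is a subfamily of $\mathcal{S}$ whose union is $\mathcal{E}$. In the LCA setting it is assumed that every set in $\mathcal{S}$ has at most $s$ elements and every element of $\mathcal{E}$ is contained in at most $t$ sets. The instance is accessed only through neighbor queries: "what is the $i$-th element of a given set $S$?" and "what is the $i$-th set containing a given element $e$?". An LCA for set cover is a randomized algorithm with access to neighbor queries, a tape of random bits and local working memory which, given a set $S\in\mathcal{S}$, answers whether $S$ belongs to the set cover; the answer may depend only on $S$, the instance $(\mathcal{S},\mathcal{E})$ and the random tape, and for every fixed random tape the answers given to all sets must be consistent with a single valid set cover. The query complexity is the maximum number of queries the algorithm makes to answer a single query. The expected size of the cover is taken over the random tape. *)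

theory Defs
  imports "HOL-Probability.Probability"
begin

definition is_set_cover :: "'a set \<Rightarrow> 'a set set \<Rightarrow> 'a set set \<Rightarrow> bool" where
  "is_set_cover E F C \<longleftrightarrow> C \<subseteq> F \<and> \<Union>C = E"

definition is_fractional_cover :: "'a set \<Rightarrow> 'a set set \<Rightarrow> ('a set \<Rightarrow> real) \<Rightarrow> bool" where
  "is_fractional_cover E F x \<longleftrightarrow>
     (\<forall>T\<in>F. 0 \<le> x T) \<and> (\<forall>e\<in>E. 1 \<le> (\<Sum>T\<in>{T \<in> F. e \<in> T}. x T))"

definition fractional_opt :: "'a set \<Rightarrow> 'a set set \<Rightarrow> real" where
  "fractional_opt E F = Inf {(\<Sum>T\<in>F. x T) | x. is_fractional_cover E F x}"

text \<open>Algorithms handle elements and sets only through identifiers, the elements being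
  \<open>0, \<dots>, num_elements - 1\<close> and the sets \<open>0, \<dots>, num_sets - 1\<close>.  The two list-valued fields fix
  the (arbitrary) order in which neighbor queries enumerate the elements of a set and the sets
  containing an element.\<close>

record sc_instance =
  num_elements :: nat
  num_sets :: nat
  elements_of :: "nat \<Rightarrow> nat list"
  sets_containing :: "nat \<Rightarrow> nat list"

definition sc_universe :: "sc_instance \<Rightarrow> nat set" where
  "sc_universe I = {..<num_elements I}"

definition sc_set :: "sc_instance \<Rightarrow> nat \<Rightarrow> nat set" where
  "sc_set I j = set (elements_of I j)"

definition sc_family :: "sc_instance \<Rightarrow> nat set set" where
  "sc_family I = sc_set I ` {..<num_sets I}"

text \<open>Injectivity of \<open>sc_set I\<close> expresses that the family is a set, not a multiset, of subsets of
  the universe.\<close>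

definition valid_instance :: "sc_instance \<Rightarrow> bool" where
  "valid_instance I \<longleftrightarrow>
     inj_on (sc_set I) {..<num_sets I} \<and>
     (\<forall>j<num_sets I. distinct (elements_of I j)) \<and>
     \<Union>(sc_family I) = sc_universe I \<and>
     (\<forall>e<num_elements I. distinct (sets_containing I e) \<and>
        set (sets_containing I e) = {j. j < num_sets I \<and> e \<in> sc_set I j})"

definition bounded_instance :: "nat \<Rightarrow> nat \<Rightarrow> sc_instance \<Rightarrow> bool" where
  "bounded_instance s t I \<longleftrightarrow>
     valid_instance I \<and>
     (\<forall>T\<in>sc_family I. card T \<le> s) \<and>
     (\<forall>e\<in>sc_universe I. card {T \<in> sc_family I. e \<in> T} \<le> t)"

text \<open>\<open>Nth_Element j i\<close> asks for the \<open>i\<close>-th element of set \<open>j\<close>, \<open>Nth_Set e i\<close> for the \<open>i\<close>-th set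
  containing element \<open>e\<close>.  Positions count from \<open>0\<close>; a query without an answer yields \<open>None\<close>.\<close>

datatype neighbor_query = Nth_Element nat nat | Nth_Set nat nat

fun reply :: "sc_instance \<Rightarrow> neighbor_query \<Rightarrow> nat option" where
  "reply I (Nth_Element j i) =
     (if j < num_sets I \<and> i < length (elements_of I j) then Some (elements_of I j ! i) else None)"
| "reply I (Nth_Set e i) =
     (if e < num_elements I \<and> i < length (sets_containing I e)
      then Some (sets_containing I e ! i) else None)"

text \<open>The computation of an LCA on one input set: an adaptive, always terminating interaction with
  the instance (\<open>Ask\<close>) and with a random-access tape of random bits (\<open>Read\<close>), ending in the answer
  whether the set belongs to the cover.\<close>

datatype computation =
    Answer bool
  | Ask neighbor_query "nat option \<Rightarrow> computation"
  | Read nat "bool \<Rightarrow> computation"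

type_synonym tape = "nat \<Rightarrow> bool"

primrec answer :: "sc_instance \<Rightarrow> tape \<Rightarrow> computation \<Rightarrow> bool" where
  "answer I \<omega> (Answer b) = b"
| "answer I \<omega> (Ask q k) = answer I \<omega> (k (reply I q))"
| "answer I \<omega> (Read a k) = answer I \<omega> (k (\<omega> a))"

primrec num_queries :: "sc_instance \<Rightarrow> tape \<Rightarrow> computation \<Rightarrow> nat" where
  "num_queries I \<omega> (Answer b) = 0"
| "num_queries I \<omega> (Ask q k) = Suc (num_queries I \<omega> (k (reply I q)))"
| "num_queries I \<omega> (Read a k) = num_queries I \<omega> (k (\<omega> a))"

text \<open>Maps the identifier of the input set to a computation; all computations share one tape.\<close>

type_synonym lca = "nat \<Rightarrow> computation"

definition lca_output :: "lca \<Rightarrow> sc_instance \<Rightarrow> tape \<Rightarrow> nat set set" where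
  "lca_output A I \<omega> = sc_set I ` {j. j < num_sets I \<and> answer I \<omega> (A j)}"

definition set_cover_lca :: "nat \<Rightarrow> nat \<Rightarrow> lca \<Rightarrow> bool" where
  "set_cover_lca s t A \<longleftrightarrow>
     (\<forall>I \<omega>. bounded_instance s t I \<longrightarrow>
        is_set_cover (sc_universe I) (sc_family I) (lca_output A I \<omega>))"

definition query_complexity_le :: "nat \<Rightarrow> nat \<Rightarrow> lca \<Rightarrow> real \<Rightarrow> bool" where
  "query_complexity_le s t A q \<longleftrightarrow>
     (\<forall>I \<omega> j. bounded_instance s t I \<longrightarrow> j < num_sets I \<longrightarrow> real (num_queries I \<omega> (A j)) \<le> q)"

definition random_tape :: "tape measure" where
  "random_tape = (\<Pi>\<^sub>M a\<in>UNIV. measure_pmf (bernoulli_pmf (1/2)))"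

definition expected_size :: "lca \<Rightarrow> sc_instance \<Rightarrow> real" where
  "expected_size A I = (LINT \<omega>|random_tape. real (card (lca_output A I \<omega>)))"

text \<open>The expectation is never a default value of the Bochner integral: every algorithm has an
  integrable output size.\<close>

lemma prob_space_random_tape: "prob_space random_tape"
  unfolding random_tape_def by (intro prob_space_PiM measure_pmf.prob_space_axioms)

lemma measurable_answer: "Measurable.pred random_tape (\<lambda>\<omega>. answer I \<omega> p)"
proof (induction p)
  case (Read a k)
  have [measurable]: "Measurable.pred random_tape (\<lambda>\<omega>. answer I \<omega> (k b))" for b
    by (rule Read.IH) simp
  have "(\<lambda>\<omega>. \<omega> a) \<in> measurable random_tape (measure_pmf (bernoulli_pmf (1/2)))"
    unfolding random_tape_def by (rule measurable_component_singleton) simp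
  then have [measurable]: "Measurable.pred random_tape (\<lambda>\<omega>. \<omega> a)"
    by simp
  have "(\<lambda>\<omega>. answer I \<omega> (Read a k)) =
      (\<lambda>\<omega>. (\<omega> a \<and> answer I \<omega> (k True)) \<or> (\<not> \<omega> a \<and> answer I \<omega> (k False)))"
    by (rule ext) (metis (full_types) answer.simps(3))
  then show ?case
    by (simp only:) measurable
qed simp_all

lemma integrable_output_size:
  "integrable random_tape (\<lambda>\<omega>. real (card (lca_output A I \<omega>)))"
proof -
  interpret prob_space random_tape by (rule prob_space_random_tape)
  define N where "N = {..<num_sets I}"
  have "lca_output A I \<omega> = {T \<in> sc_family I. \<exists>j\<in>N. T = sc_set I j \<and> answer I \<omega> (A j)}" for \<omega>
    unfolding lca_output_def sc_family_def N_def by auto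
  then have "real (card (lca_output A I \<omega>)) =
      (\<Sum>T\<in>sc_family I. if \<exists>j\<in>N. T = sc_set I j \<and> answer I \<omega> (A j) then 1 else 0)" for \<omega>
    by (simp add: sum.If_cases sc_family_def Collect_conj_eq Int_commute)
  moreover have "integrable random_tape
      (\<lambda>\<omega>. \<Sum>T\<in>sc_family I. if \<exists>j\<in>N. T = sc_set I j \<and> answer I \<omega> (A j) then 1 else 0::real)"
  proof (rule Bochner_Integration.integrable_sum, rule integrable_const_bound[where B = 1])
    fix T
    have [measurable]: "Measurable.pred random_tape (\<lambda>\<omega>. answer I \<omega> (A j))" for j
      by (rule measurable_answer)
    have [measurable]: "Measurable.pred random_tape (\<lambda>\<omega>. \<exists>j\<in>N. T = sc_set I j \<and> answer I \<omega> (A j))"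
      unfolding N_def by (rule pred_intros_finite) (auto intro: measurable_answer)
    show "(\<lambda>\<omega>. if \<exists>j\<in>N. T = sc_set I j \<and> answer I \<omega> (A j) then 1 else 0::real)
        \<in> borel_measurable random_tape"
      by measurable
  qed auto
  ultimately show ?thesis by simp
qed

end

theory Submission
  imports Defs
begin

text \<open>Only the average number of queries has to be controlled: an algorithm that selects a set as soon
  as its computation exceeds a budget still outputs a cover, and by Markov's inequality the extra
  sets cost no more than OPT if the budget is the average times a polynomial in \<open>s\<close> and \<open>t\<close>.

  The cover is built in \<open>L = O(log s)\<close> phases.  A phase starts with every set containing fewer than
  \<open>2\<^sup>k\<close> uncovered elements and halves this bound.  It runs through levels \<open>j < R\<close>; in level \<open>j\<close> every
  set \<open>T\<close> performs trials, active with total expectation \<open>\<mu>\<^sub>j = 2\<^sup>j / 2\<^sup>a\<close> where \<open>t \<le> 2\<^sup>a\<close>.  An active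
  trial picks \<open>c\<close> random elements of \<open>T\<close> that were uncovered when the phase started, and \<open>T\<close> joins
  the cover if all of them are still uncovered when the level starts.  Sets that keep at least
  \<open>2\<^sup>k / 2\<close> uncovered elements to the end (which is unlikely) join as well.

  Let \<open>\<rho>\<close> be the fraction of uncovered elements of a set, out of \<open>2\<^sup>k\<close>, and let \<open>g\<close> be the sum of
  \<open>\<rho>\<^sup>c\<^sup>-\<^sup>1\<close> over the sets containing an element \<open>e\<close>.  Level \<open>j\<close> selects \<open>2\<^sup>-\<^sup>k\<close> times the sum of \<open>\<mu>\<^sub>j g\<close> over
  the uncovered elements in expectation, whereas \<open>e\<close> stays uncovered with probability at most about
  \<open>exp (- \<mu>\<^sub>j g / 4)\<close>.  As \<open>\<mu>\<^sub>j\<close> only doubles from level to level, the loads \<open>\<mu>\<^sub>j g\<close> met by \<open>e\<close> while it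
  is uncovered add up to \<open>O(1)\<close>, so a phase selects at most \<open>O(OPT)\<close> sets.

  Whether a trial succeeds is decided by replaying the earlier levels of the phase for its \<open>c\<close>
  elements, in order, until one of them turns out to be covered.  A trial of level \<open>i\<close> is therefore
  replayed only by trials of levels \<open>j > i\<close> whose elements are all uncovered before level \<open>i\<close>.  As the
  latter are fresh randomness, there are about \<open>2\<^sup>j\<^sup>-\<^sup>i c \<mu>\<^sub>i g\<close> of them in expectation, and \<open>\<mu>\<^sub>i g\<close> is
  polylogarithmic up to negligible probability.  Hence, up to factors polynomial in \<open>s\<close> and \<open>t\<close>, the
  expected number of replays per phase is a polylogarithm to the power \<open>R = O(log t + log log s)\<close>, and
  the bounds of the phases multiply.\<close>

section \<open>Programs and the set cover algorithm\<close>

text \<open>Continuation-passing style: it lets subprograms return values of any type although a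
  \<open>computation\<close> itself can only end in a boolean answer.\<close>

type_synonym 'a prog = "('a \<Rightarrow> computation) \<Rightarrow> computation"

definition mret :: "'a \<Rightarrow> 'a prog" where
  "mret v k = k v"

definition mbind :: "'a prog \<Rightarrow> ('a \<Rightarrow> 'b prog) \<Rightarrow> 'b prog" where
  "mbind P f k = P (\<lambda>v. f v k)"

primrec mmap :: "('a \<Rightarrow> 'b prog) \<Rightarrow> 'a list \<Rightarrow> 'b list prog" where
  "mmap f [] = mret []"
| "mmap f (x # xs) = mbind (f x) (\<lambda>v. mbind (mmap f xs) (\<lambda>vs. mret (v # vs)))"

definition mfilter :: "('a \<Rightarrow> bool prog) \<Rightarrow> 'a list \<Rightarrow> 'a list prog" where
  "mfilter f xs = mbind (mmap f xs) (\<lambda>bs. mret (map fst (filter snd (zip xs bs))))"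

text \<open>Quantifying over all continuations makes value and exact query count compositional. Once
  a program is matched with such a pair, the analysis concerns only explicit functions of what the
  trials have drawn.\<close>

definition runs :: "sc_instance \<Rightarrow> tape \<Rightarrow> 'a prog \<Rightarrow> 'a \<Rightarrow> nat \<Rightarrow> bool" where
  "runs I \<omega> P v q \<longleftrightarrow>
     (\<forall>k. answer I \<omega> (P k) = answer I \<omega> (k v) \<and> num_queries I \<omega> (P k) = q + num_queries I \<omega> (k v))"

lemma runs_mret: "runs I \<omega> (mret v) v 0"
  by (simp add: runs_def mret_def)

lemma runs_mbind:
  assumes "runs I \<omega> P v q" "runs I \<omega> (f v) v' q'" "q'' = q + q'"
  shows "runs I \<omega> (mbind P f) v' q''"
  using assms by (simp add: runs_def mbind_def)

lemma runs_Ask: "runs I \<omega> (Ask q) (reply I q) 1"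
  by (simp add: runs_def)

lemma runs_Read: "runs I \<omega> (Read i) (\<omega> i) 0"
  by (simp add: runs_def)

lemma runs_mmap:
  assumes "\<And>x. x \<in> set xs \<Longrightarrow> runs I \<omega> (f x) (g x) (q x)"
  shows "runs I \<omega> (mmap f xs) (map g xs) (\<Sum>x\<leftarrow>xs. q x)"
  using assms
proof (induction xs)
  case Nil
  then show ?case by (simp add: runs_mret)
next
  case (Cons x xs)
  show ?case
    by (auto intro!: runs_mbind[of I \<omega> "f x" "g x" "q x"] runs_mbind[of I \<omega> "mmap f xs" "map g xs"]
          runs_mret Cons)
qed

lemma runs_mfilter:
  assumes "\<And>x. x \<in> set xs \<Longrightarrow> runs I \<omega> (f x) (g x) (q x)"
  shows "runs I \<omega> (mfilter f xs) (filter g xs) (\<Sum>x\<leftarrow>xs. q x)"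
proof -
  have "map fst (filter snd (zip xs (map g xs))) = filter g xs"
    by (induction xs) auto
  then show ?thesis
    unfolding mfilter_def
    by (metis (no_types, lifting) add_0_right assms runs_mbind runs_mmap runs_mret)
qed

text \<open>Giving up once the budget is exhausted is harmless: answering \<^const>\<open>True\<close> only enlarges the
  cover.\<close>

primrec truncate :: "computation \<Rightarrow> nat \<Rightarrow> computation" where
  "truncate (Answer b) = (\<lambda>B. Answer b)"
| "truncate (Ask q k) =
     (\<lambda>B. case B of 0 \<Rightarrow> Answer True | Suc B' \<Rightarrow> Ask q (\<lambda>r. truncate (k r) B'))"
| "truncate (Read i k) = (\<lambda>B. Read i (\<lambda>b. truncate (k b) B))"

lemma num_queries_truncate: "num_queries I \<omega> (truncate P B) \<le> B"
  by (induction P arbitrary: B) (auto split: nat.split)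

lemma answer_truncate:
  "answer I \<omega> (truncate P B) \<longleftrightarrow> answer I \<omega> P \<or> B < num_queries I \<omega> P"
  by (induction P arbitrary: B) (auto split: nat.split)

text \<open>A table of what all trials draw: \<open>None\<close> for an inactive trial, otherwise
  its list of indices. Keys consist of level, set and trial number, preceded in
  \<open>outcome\<close> by the phase. Levels and costs are deterministic functions of such a table,
  so randomness enters later as a product distribution on tables.\<close>

type_synonym phase_outcome = "nat \<times> nat \<times> nat \<Rightarrow> nat list option"
type_synonym outcome = "nat \<times> nat \<times> nat \<times> nat \<Rightarrow> nat list option"

section \<open>One phase as a function of the trial outcomes\<close>

locale phase =
  fixes el st :: "nat \<Rightarrow> nat list" and U :: "nat set"
begin

definition res :: "nat \<Rightarrow> nat list" where
  "res T = filter (\<lambda>e. e \<in> U) (el T)"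

text \<open>Indices are drawn below a power of two that may exceed the length of
  \<open>res T\<close>. A trial with an index beyond the list simply fails, so every residual
  element is hit with the same probability without rejection sampling.\<close>

definition in_range :: "nat list \<Rightarrow> nat \<Rightarrow> bool" where
  "in_range is T \<longleftrightarrow> (\<forall>i\<in>set is. i < length (res T))"

definition pick :: "nat list \<Rightarrow> nat \<Rightarrow> nat list" where
  "pick is T = map (\<lambda>i. res T ! i) is"

definition succeeds :: "nat set \<Rightarrow> nat list option \<Rightarrow> nat \<Rightarrow> bool" where
  "succeeds V z T \<longleftrightarrow> (case z of None \<Rightarrow> False | Some is \<Rightarrow> in_range is T \<and> set (pick is T) \<subseteq> V)"

text \<open>Success in level \<open>j\<close> is judged against \<open>lev y j\<close>, not against
  events of the same level. Given the earlier levels, the trials of one level therefore succeed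
  independently under a product distribution.\<close>

primrec lev :: "phase_outcome \<Rightarrow> nat \<Rightarrow> nat set" where
  "lev y 0 = U"
| "lev y (Suc j) = {e \<in> lev y j. \<forall>T\<in>set (st e). \<forall>n<2^j. \<not> succeeds (lev y j) (y (j, T, n)) T}"

definition trial_cost :: "(nat \<Rightarrow> nat) \<Rightarrow> (nat list \<Rightarrow> nat) \<Rightarrow> nat list option \<Rightarrow> nat \<Rightarrow> nat" where
  "trial_cost w B z T = (case z of None \<Rightarrow> 0 |
     Some is \<Rightarrow> w T + (if in_range is T then B (pick is T) else 0))"

text \<open>The elements of \<open>es\<close> are tested jointly, level by level, and the test stops
  at the first level that covers one of them. The guard \<open>set es \<subseteq> lev y j\<close> is
  what keeps the expected number of replays small.\<close>

primrec block_cost ::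
  "nat \<Rightarrow> (nat \<Rightarrow> nat) \<Rightarrow> phase_outcome \<Rightarrow> nat \<Rightarrow> nat list \<Rightarrow> nat" where
  "block_cost t w y 0 es = 0"
| "block_cost t w y (Suc j) es = block_cost t w y j es +
     (if set es \<subseteq> lev y j
      then \<Sum>e\<leftarrow>es. t + (\<Sum>T\<in>set (st e). \<Sum>n<2^j. trial_cost w (block_cost t w y j) (y (j, T, n)) T)
      else 0)"

lemma lev_subset: "lev y j \<subseteq> U"
  by (induction j) auto

end

section \<open>The query programs\<close>

locale lca_scheme =
  fixes s t a c R L :: nat
begin

definition ask_elements :: "nat \<Rightarrow> nat list prog" where
  "ask_elements T = mbind (mmap (\<lambda>i. Ask (Nth_Element T i)) [0..<s]) (\<lambda>os. mret (List.map_filter id os))"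

definition ask_sets :: "nat \<Rightarrow> nat list prog" where
  "ask_sets e = mbind (mmap (\<lambda>i. Ask (Nth_Set e i)) [0..<t]) (\<lambda>os. mret (List.map_filter id os))"

text \<open>An injective code of trial and bit number, so that different trials own disjoint parts
  of the tape.\<close>

definition address :: "nat \<times> nat \<times> nat \<times> nat \<Rightarrow> nat \<Rightarrow> nat" where
  "address \<kappa> b = to_nat (\<kappa>, b)"

definition trial_bits :: "nat \<times> nat \<times> nat \<times> nat \<Rightarrow> nat \<Rightarrow> bool list prog" where
  "trial_bits \<kappa> r = mmap (\<lambda>b. Read (address \<kappa> (a + r * (L - fst \<kappa>) + b))) [0..<L - fst \<kappa>]"

text \<open>A trial \<open>(p, j, T, n)\<close> is the \<open>n\<close>-th one of set \<open>T\<close> in level \<open>j\<close> of phase \<open>p\<close>.  It owns \<open>a\<close> bits, which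
  activate it if they are all set, followed by \<open>c\<close> indices of \<open>L - p\<close> bits each.\<close>

definition trial :: "tape \<Rightarrow> nat \<times> nat \<times> nat \<times> nat \<Rightarrow> nat list option" where
  "trial \<omega> \<kappa> = (if \<forall>b<a. \<omega> (address \<kappa> b) then
     Some (map (\<lambda>r. horner_sum of_bool 2
       (map (\<lambda>b. \<omega> (address \<kappa> (a + r * (L - fst \<kappa>) + b))) [0..<L - fst \<kappa>])) [0..<c])
     else None)"

definition read_trial :: "nat \<times> nat \<times> nat \<times> nat \<Rightarrow> nat list option prog" where
  "read_trial \<kappa> = mbind (mmap (\<lambda>b. Read (address \<kappa> b)) [0..<a]) (\<lambda>bs.
     if list_all id bs
     then mbind (mmap (trial_bits \<kappa>) [0..<c]) (\<lambda>bss. mret (Some (map (horner_sum of_bool 2) bss)))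
     else mret None)"

definition run_trial ::
  "(nat \<Rightarrow> nat list prog) \<Rightarrow> (nat list \<Rightarrow> bool prog) \<Rightarrow> nat \<times> nat \<times> nat \<times> nat \<Rightarrow> bool prog" where
  "run_trial residual test \<kappa> = mbind (read_trial \<kappa>) (\<lambda>z. case z of None \<Rightarrow> mret False
     | Some is \<Rightarrow> mbind (residual (fst (snd (snd \<kappa>)))) (\<lambda>xs.
         if \<forall>i\<in>set is. i < length xs then test (map (\<lambda>i. xs ! i) is) else mret False))"

primrec run_block :: "(nat \<Rightarrow> nat list prog) \<Rightarrow> nat \<Rightarrow> nat \<Rightarrow> nat list \<Rightarrow> bool prog" where
  "run_block residual p 0 es = mret True"
| "run_block residual p (Suc j) es = mbind (run_block residual p j es) (\<lambda>b. if b then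
     mbind (mmap ask_sets es) (\<lambda>Tss.
     mbind (mfilter (\<lambda>(T, n). run_trial residual (run_block residual p j) (p, j, T, n))
                    (List.product (concat Tss) [0..<2^j]))
       (\<lambda>ws. mret (ws = []))) else mret False)"

definition run_residual :: "(nat \<Rightarrow> bool prog) \<Rightarrow> nat \<Rightarrow> nat list prog" where
  "run_residual test T = mbind (ask_elements T) (mfilter test)"

definition run_cleanup :: "(nat \<Rightarrow> nat list prog) \<Rightarrow> nat \<Rightarrow> nat \<Rightarrow> bool prog" where
  "run_cleanup residual p T = mbind (residual T) (\<lambda>xs.
     mbind (mfilter (\<lambda>e. run_block residual p R [e]) xs) (\<lambda>ys. mret (2 ^ (L - Suc p) \<le> length ys)))"

primrec run_uncovered :: "nat \<Rightarrow> nat \<Rightarrow> bool prog" where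
  "run_uncovered 0 e = mret True"
| "run_uncovered (Suc p) e = mbind (run_uncovered p e) (\<lambda>b. if b then
     mbind (run_block (run_residual (run_uncovered p)) p R [e]) (\<lambda>b. if b then
       mbind (ask_sets e) (\<lambda>Ts.
       mbind (mfilter (run_cleanup (run_residual (run_uncovered p)) p) Ts) (\<lambda>ws. mret (ws = [])))
     else mret False) else mret False)"

definition run_phase :: "nat \<Rightarrow> nat \<Rightarrow> bool prog" where
  "run_phase p T = (let residual = run_residual (run_uncovered p) in
     mbind (mfilter (\<lambda>(j, n). run_trial residual (run_block residual p j) (p, j, T, n))
              (concat (map (\<lambda>j. map (Pair j) [0..<2^j]) [0..<R]))) (\<lambda>ws.
     mbind (run_cleanup residual p T) (\<lambda>b. mret (ws \<noteq> [] \<or> b))))"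

definition run_set :: "nat \<Rightarrow> bool prog" where
  "run_set T = mbind (ask_elements T) (\<lambda>xs. if xs = [] then mret False else
     mbind (mfilter (\<lambda>p. run_phase p T) [0..<L]) (\<lambda>ps. mret (ps \<noteq> [])))"

end

section \<open>Correctness of the programs\<close>

lemma runs_mret': "v = v' \<Longrightarrow> runs I \<omega> (mret v) v' 0"
  by (simp add: runs_mret)

locale lca_instance = lca_scheme +
  fixes I :: sc_instance
  assumes bounded: "bounded_instance s t I"
begin

abbreviation el :: "nat \<Rightarrow> nat list" where "el \<equiv> elements_of I"
abbreviation st :: "nat \<Rightarrow> nat list" where "st \<equiv> sets_containing I"
abbreviation E :: "nat set" where "E \<equiv> {..<num_elements I}"

text \<open>Identifiers of sets, leaving out the one of the empty set if there is one: it lies on no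
  element and would escape the bound of \<open>t\<close> sets per element.\<close>

definition F :: "nat set" where
  "F = {T. T < num_sets I \<and> el T \<noteq> []}"

lemma finite_F [simp]: "finite F"
  by (simp add: F_def)

lemma sc_set_eq: "sc_set I T = set (el T)"
  by (simp add: sc_set_def)

lemma valid: "valid_instance I"
  using bounded unfolding bounded_instance_def by blast

lemma Union_family: "\<Union>(sc_family I) = E"
  using valid unfolding valid_instance_def sc_universe_def by blast

lemma distinct_el: "T < num_sets I \<Longrightarrow> distinct (el T)"
  using valid unfolding valid_instance_def by blast

lemma el_subset:
  assumes "T < num_sets I" shows "set (el T) \<subseteq> E"
proof -
  have "sc_set I T \<in> sc_family I"
    using assms by (simp add: sc_family_def)
  then show ?thesis
    unfolding sc_set_eq Union_family[symmetric] by blast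
qed

lemma distinct_st: "e \<in> E \<Longrightarrow> distinct (st e)"
  using valid unfolding valid_instance_def by blast

lemma set_st:
  assumes "e \<in> E" shows "set (st e) = {T \<in> F. e \<in> set (el T)}"
proof -
  have "\<forall>e<num_elements I. distinct (st e) \<and> set (st e) = {j. j < num_sets I \<and> e \<in> sc_set I j}"
    using valid unfolding valid_instance_def by (elim conjE)
  then have "set (st e) = {T. T < num_sets I \<and> e \<in> sc_set I T}"
    using assms by (simp only: lessThan_iff)
  moreover have "e \<in> set xs \<Longrightarrow> xs \<noteq> []" for xs
    by (cases xs) simp_all
  ultimately show ?thesis
    unfolding sc_set_eq F_def mem_Collect_eq by blast
qed

lemma length_el:
  assumes "T < num_sets I" shows "length (el T) \<le> s"
proof -
  have "sc_set I T \<in> sc_family I"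
    using assms by (simp add: sc_family_def)
  then have "card (set (el T)) \<le> s"
    using bounded unfolding bounded_instance_def sc_set_eq by blast
  then show ?thesis
    using distinct_el[OF assms] by (simp add: distinct_card)
qed

text \<open>The bound \<open>t\<close> counts distinct members of the family; injectivity of
  \<open>sc_set I\<close> turns it into a bound on identifiers.\<close>

lemma length_st:
  assumes "e \<in> E" shows "length (st e) \<le> t"
proof -
  have "inj_on (sc_set I) {..<num_sets I}"
    using valid unfolding valid_instance_def by blast
  then have inj: "inj_on (sc_set I) (set (st e))"
    by (rule inj_on_subset) (auto simp: set_st[OF assms] F_def)
  have "sc_set I ` set (st e) = {T \<in> sc_family I. e \<in> T}"
    unfolding set_st[OF assms] by (auto simp: sc_family_def sc_set_eq F_def)
  moreover have "card {T \<in> sc_family I. e \<in> T} \<le> t"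
    using bounded assms unfolding bounded_instance_def sc_universe_def by blast
  ultimately have "card (set (st e)) \<le> t"
    by (simp add: card_image[OF inj, symmetric])
  then show ?thesis
    using distinct_st[OF assms] by (simp add: distinct_card)
qed

lemma st_nonempty:
  assumes "e \<in> E" shows "set (st e) \<noteq> {}"
proof -
  have "e \<in> \<Union>(sc_family I)"
    using assms by (simp only: Union_family)
  then obtain T where "T < num_sets I" "e \<in> set (el T)"
    by (auto simp: sc_family_def sc_set_def)
  then show ?thesis
    using set_st[OF assms] by (auto simp: F_def)
qed

text \<open>Positions past the end are answered by \<open>None\<close>, so asking for
  \<open>k\<close> positions and dropping \<open>None\<close> recovers the whole list.\<close>

lemma map_filter_reply:
  fixes xs :: "'b list"
  assumes "length xs \<le> k" "\<And>i. f i = (if i < length xs then Some (xs ! i) else None)"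
  shows "List.map_filter id (map f [0..<k]) = xs"
proof -
  have "[0..<k] = [0..<length xs] @ [length xs..<k]"
    using upt_add_eq_append[of 0 "length xs" "k - length xs"] assms(1) by simp
  moreover have "map f [0..<length xs] = map Some xs"
    using assms(2) by (intro nth_equalityI) simp_all
  moreover have "map f [length xs..<k] = map (\<lambda>_. None) [length xs..<k]"
    using assms(2) by simp
  moreover have "List.map_filter id (map Some ys @ map (\<lambda>_. None) zs) = ys" for ys :: "'b list" and zs :: "nat list"
    by (induction ys; induction zs) (auto simp: List.map_filter_def)
  ultimately show ?thesis
    by (simp only: map_append)
qed

lemma runs_ask_elements:
  assumes "T < num_sets I"
  shows "runs I \<omega> (ask_elements T) (el T) s"
  unfolding ask_elements_def
  by (rule runs_mbind[OF runs_mmap[OF runs_Ask] runs_mret'])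
     (use assms length_el in \<open>auto intro!: map_filter_reply simp: sum_list_triv\<close>)

lemma runs_ask_sets:
  assumes "e \<in> E"
  shows "runs I \<omega> (ask_sets e) (st e) t"
  unfolding ask_sets_def
  by (rule runs_mbind[OF runs_mmap[OF runs_Ask] runs_mret'])
     (use assms length_st in \<open>auto intro!: map_filter_reply simp: sum_list_triv\<close>)

lemma runs_read_trial: "runs I \<omega> (read_trial \<kappa>) (trial \<omega> \<kappa>) 0"
proof -
  have *: "list_all id (map (\<lambda>b. \<omega> (address \<kappa> b)) [0..<a]) \<longleftrightarrow> (\<forall>b<a. \<omega> (address \<kappa> b))"
    by (auto simp: list_all_iff)
  have "runs I \<omega> (trial_bits \<kappa> r) (map (\<lambda>b. \<omega> (address \<kappa> (a + r * (L - fst \<kappa>) + b))) [0..<L - fst \<kappa>]) 0"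
    for r
    using runs_mmap[of "[0..<L - fst \<kappa>]" I \<omega> "\<lambda>b. Read (address \<kappa> (a + r * (L - fst \<kappa>) + b))"
        "\<lambda>b. \<omega> (address \<kappa> (a + r * (L - fst \<kappa>) + b))" "\<lambda>_. 0", OF runs_Read]
    by (simp add: trial_bits_def)
  then have "runs I \<omega> (mmap (trial_bits \<kappa>) [0..<c])
      (map (\<lambda>r. map (\<lambda>b. \<omega> (address \<kappa> (a + r * (L - fst \<kappa>) + b))) [0..<L - fst \<kappa>]) [0..<c]) (\<Sum>r\<leftarrow>[0..<c]. 0)"
    by (rule runs_mmap)
  then have bits: "runs I \<omega> (mmap (trial_bits \<kappa>) [0..<c])
      (map (\<lambda>r. map (\<lambda>b. \<omega> (address \<kappa> (a + r * (L - fst \<kappa>) + b))) [0..<L - fst \<kappa>]) [0..<c]) 0"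
    by simp
  have act: "runs I \<omega> (mmap (\<lambda>b. Read (address \<kappa> b)) [0..<a]) (map (\<lambda>b. \<omega> (address \<kappa> b)) [0..<a]) 0"
    using runs_mmap[of "[0..<a]" I \<omega> "\<lambda>b. Read (address \<kappa> b)" "\<lambda>b. \<omega> (address \<kappa> b)" "\<lambda>_. 0", OF runs_Read]
    by simp
  show ?thesis
    unfolding read_trial_def
  proof (rule runs_mbind[OF act], unfold *)
    show "runs I \<omega> (if \<forall>b<a. \<omega> (address \<kappa> b)
       then mbind (mmap (trial_bits \<kappa>) [0..<c]) (\<lambda>bss. mret (Some (map (horner_sum of_bool 2) bss)))
       else mret None) (trial \<omega> \<kappa>) 0"
      unfolding trial_def
      by (auto intro!: runs_mbind[OF bits] runs_mret' simp: comp_def)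
  qed simp
qed

end

context phase begin

definition cleanup_cost ::
  "nat \<Rightarrow> (nat \<Rightarrow> nat) \<Rightarrow> phase_outcome \<Rightarrow> nat \<Rightarrow> nat \<Rightarrow> nat" where
  "cleanup_cost t w y R T = w T + (\<Sum>e\<in>set (res T). block_cost t w y R [e])"

end

definition slice :: "(nat \<times> nat \<times> nat \<times> nat \<Rightarrow> 'a) \<Rightarrow> nat \<Rightarrow> nat \<times> nat \<times> nat \<Rightarrow> 'a" where
  "slice Y p \<kappa> = Y (p, \<kappa>)"

section \<open>The phases in sequence and the exact costs of the programs\<close>

context lca_instance begin

text \<open>Phase \<open>p\<close> starts with fewer than \<open>2 ^ (L - p)\<close> uncovered
  elements in each set; the threshold is half of this bound.\<close>

definition needs_cleanup :: "nat set \<Rightarrow> nat \<Rightarrow> nat \<Rightarrow> bool" where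
  "needs_cleanup V p T \<longleftrightarrow> 2 ^ (L - Suc p) \<le> card (set (el T) \<inter> V)"

primrec uncovered :: "outcome \<Rightarrow> nat \<Rightarrow> nat set" where
  "uncovered Y 0 = E"
| "uncovered Y (Suc p) = {e \<in> phase.lev el st (uncovered Y p) (slice Y p) R.
     \<forall>T\<in>set (st e). \<not> needs_cleanup (phase.lev el st (uncovered Y p) (slice Y p) R) p T}"

abbreviation level :: "outcome \<Rightarrow> nat \<Rightarrow> nat \<Rightarrow> nat set" where
  "level Y p \<equiv> phase.lev el st (uncovered Y p) (slice Y p)"

definition set_cost :: "(nat \<Rightarrow> nat) \<Rightarrow> nat \<Rightarrow> nat" where
  "set_cost u T = s + (\<Sum>e\<in>set (el T). u e)"

primrec cost :: "outcome \<Rightarrow> nat \<Rightarrow> nat \<Rightarrow> nat" where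
  "cost Y 0 e = 0"
| "cost Y (Suc p) e = cost Y p e + (if e \<in> uncovered Y p then
     phase.block_cost el st (uncovered Y p) t (set_cost (cost Y p)) (slice Y p) R [e] +
     (if e \<in> level Y p R
      then t + (\<Sum>T\<in>set (st e). phase.cleanup_cost el st (uncovered Y p) t (set_cost (cost Y p)) (slice Y p) R T)
      else 0) else 0)"

abbreviation the_cleanup_cost where
  "the_cleanup_cost Y p \<equiv> phase.cleanup_cost el st (uncovered Y p) t (set_cost (cost Y p)) (slice Y p) R"

abbreviation the_block_cost where
  "the_block_cost Y p \<equiv> phase.block_cost el st (uncovered Y p) t (set_cost (cost Y p)) (slice Y p)"

abbreviation the_trial_cost where
  "the_trial_cost Y p j T n \<equiv> phase.trial_cost el (uncovered Y p) (set_cost (cost Y p)) (the_block_cost Y p j) (Y (p, j, T, n)) T"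

definition phase_cost where
  "phase_cost Y p T = (\<Sum>j<R. \<Sum>n<2^j. the_trial_cost Y p j T n) + the_cleanup_cost Y p T"

definition wins where
  "wins Y p j T n \<longleftrightarrow> phase.succeeds el (uncovered Y p) (level Y p j) (Y (p, j, T, n)) T"

definition chosen where
  "chosen Y p T \<longleftrightarrow> (\<exists>j<R. \<exists>n<2^j. wins Y p j T n) \<or> needs_cleanup (level Y p R) p T"

lemma uncovered_subset: "uncovered Y p \<subseteq> E"
  by (induction p) (use phase.lev_subset in force)+

lemma F_el: "T \<in> F \<Longrightarrow> T < num_sets I"
  by (simp add: F_def)

lemma sum_list_product:
  "(\<Sum>x\<leftarrow>List.product (concat (map f es)) ns. d x) = (\<Sum>e\<leftarrow>es. \<Sum>T\<leftarrow>f e. \<Sum>n\<leftarrow>ns. (d (T, n) :: nat))"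
proof -
  have "(\<Sum>x\<leftarrow>List.product xs ns. d x) = (\<Sum>T\<leftarrow>xs. \<Sum>n\<leftarrow>ns. d (T, n))" for xs
    by (induction xs) (simp_all add: comp_def)
  then show ?thesis
    by (induction es) simp_all
qed

lemma runs_run_trial:
  assumes T: "T \<in> F" and U: "U \<subseteq> E"
    and res: "runs I \<omega> (residual T) (phase.res el U T) (w T)"
    and test: "\<And>es. set es \<subseteq> U \<Longrightarrow> runs I \<omega> (test es) (set es \<subseteq> V) (B es)"
  shows "runs I \<omega> (run_trial residual test (p, j, T, n)) (phase.succeeds el U V (trial \<omega> (p, j, T, n)) T)
     (phase.trial_cost el U w B (trial \<omega> (p, j, T, n)) T)"
proof -
  interpret phase el st U .
  have pick: "set (pick is T) \<subseteq> U" if "in_range is T" for "is"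
    using that by (force simp: pick_def in_range_def res_def dest!: nth_mem)
  show ?thesis
    unfolding run_trial_def
  proof (rule runs_mbind[OF runs_read_trial])
    show "runs I \<omega> (case trial \<omega> (p, j, T, n) of None \<Rightarrow> mret False
     | Some is \<Rightarrow> mbind (residual (fst (snd (snd (p, j, T, n))))) (\<lambda>xs.
         if \<forall>i\<in>set is. i < length xs then test (map (\<lambda>i. xs ! i) is) else mret False))
      (succeeds V (trial \<omega> (p, j, T, n)) T) (trial_cost w B (trial \<omega> (p, j, T, n)) T)"
    proof (cases "trial \<omega> (p, j, T, n)")
      case None
      then show ?thesis by (simp add: succeeds_def trial_cost_def runs_mret)
    next
      case (Some "is")
      show ?thesis
        unfolding Some option.case fst_conv snd_conv
      proof (rule runs_mbind[OF res])
        show "runs I \<omega> (if \<forall>i\<in>set is. i < length (res T) then test (map ((!) (res T)) is) else mret False)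
          (succeeds V (Some is) T) (if in_range is T then B (pick is T) else 0)"
          using pick[of "is"] test[of "pick is T"]
          by (cases "in_range is T") (auto simp: succeeds_def pick_def in_range_def[symmetric] intro!: runs_mret')
      qed (simp add: trial_cost_def)
    qed
  qed simp
qed

text \<open>Induction on the level: a trial of level \<open>j\<close> is evaluated by the block test
  for the levels below \<open>j\<close>, applied to its picks. These lie in \<open>U\<close> because
  they come from \<open>res T\<close>, so the induction hypothesis covers them.\<close>

lemma runs_run_block:
  assumes U: "U \<subseteq> E"
    and res: "\<And>T. T \<in> F \<Longrightarrow> runs I \<omega> (residual T) (phase.res el U T) (w T)"
  shows "set es \<subseteq> U \<Longrightarrow> runs I \<omega> (run_block residual p j es)
     (set es \<subseteq> phase.lev el st U (slice (trial \<omega>) p) j)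
     (phase.block_cost el st U t w (slice (trial \<omega>) p) j es)"
proof (induction j arbitrary: es)
  case 0
  then show ?case by (simp add: runs_mret phase.lev.simps phase.block_cost.simps)
next
  case (Suc j)
  interpret phase el st U .
  let ?y = "slice (trial \<omega>) p"
  let ?B = "block_cost t w ?y j"
  let ?f = "\<lambda>(T, n). run_trial residual (run_block residual p j) (p, j, T, n)"
  let ?g = "\<lambda>(T, n). succeeds (lev ?y j) (?y (j, T, n)) T"
  let ?q = "\<lambda>(T, n). trial_cost w ?B (?y (j, T, n)) T"
  let ?xs = "List.product (concat (map st es)) [0..<2^j]"
  have esE: "set es \<subseteq> E" using Suc.prems U by simp
  have trial: "runs I \<omega> (?f x) (?g x) (?q x)" if "x \<in> set ?xs" for x
  proof -
    obtain T n where x: "x = (T, n)" by (cases x)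
    have "T \<in> F" using that esE set_st by (auto simp: x)
    then show ?thesis
      unfolding x slice_def prod.case
      by (intro runs_run_trial U res Suc.IH[unfolded slice_def])
  qed
  have sets: "runs I \<omega> (mmap ask_sets es) (map st es) (\<Sum>e\<leftarrow>es. t)"
    using esE by (intro runs_mmap runs_ask_sets) auto
  have filt: "runs I \<omega> (mfilter ?f ?xs) (filter ?g ?xs) (\<Sum>x\<leftarrow>?xs. ?q x)"
    by (rule runs_mfilter[OF trial])
  have "(\<Sum>x\<leftarrow>?xs. ?q x) = (\<Sum>e\<leftarrow>es. \<Sum>T\<in>set (st e). \<Sum>n<2^j. ?q (T, n))"
    unfolding sum_list_product
    using esE by (intro arg_cong[of _ _ sum_list] map_cong refl)
      (auto simp: sum_list_distinct_conv_sum_set distinct_st atLeast0LessThan)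
  then have cost: "(\<Sum>e\<leftarrow>es. t) + (\<Sum>x\<leftarrow>?xs. ?q x) =
      (\<Sum>e\<leftarrow>es. t + (\<Sum>T\<in>set (st e). \<Sum>n<2^j. trial_cost w ?B (?y (j, T, n)) T))"
    by (simp add: sum_list_addf)
  have val: "(filter ?g ?xs = []) = (set es \<subseteq> lev ?y (Suc j))" if "set es \<subseteq> lev ?y j"
  proof -
    have "(filter ?g ?xs = []) = (\<forall>e\<in>set es. \<forall>T\<in>set (st e). \<forall>n<2^j. \<not> succeeds (lev ?y j) (?y (j, T, n)) T)"
      unfolding filter_empty_conv by auto
    then show ?thesis
      using that by (simp only: lev.simps) blast
  qed
  show ?case
    unfolding run_block.simps block_cost.simps
  proof (rule runs_mbind[OF Suc.IH[OF Suc.prems]])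
    show "runs I \<omega> (if set es \<subseteq> lev ?y j then
       mbind (mmap ask_sets es) (\<lambda>Tss. mbind (mfilter ?f (List.product (concat Tss) [0..<2^j]))
         (\<lambda>ws. mret (ws = []))) else mret False)
       (set es \<subseteq> lev ?y (Suc j))
       (if set es \<subseteq> lev ?y j then \<Sum>e\<leftarrow>es. t + (\<Sum>T\<in>set (st e). \<Sum>n<2^j. trial_cost w ?B (?y (j, T, n)) T) else 0)"
    proof (cases "set es \<subseteq> lev ?y j")
      case True
      show ?thesis
        unfolding if_P[OF True] cost[symmetric]
        by (rule runs_mbind[OF sets], rule runs_mbind[OF filt], rule runs_mret'[OF val[OF True]])
          (rule refl, simp)
    next
      case False
      then show ?thesis by (auto simp: runs_mret intro!: runs_mret')
    qed
  qed simp
qed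

lemma runs_residual:
  assumes "T \<in> F" "U \<subseteq> E"
    and "\<And>e. e \<in> E \<Longrightarrow> runs I \<omega> (test e) (e \<in> U) (u e)"
  shows "runs I \<omega> (run_residual test T) (phase.res el U T) (set_cost u T)"
proof -
  have T: "T < num_sets I" using assms(1) by (rule F_el)
  have "runs I \<omega> (mfilter test (el T)) (filter (\<lambda>e. e \<in> U) (el T)) (\<Sum>e\<leftarrow>el T. u e)"
    using el_subset[OF T] by (intro runs_mfilter assms(3)) auto
  then show ?thesis
    unfolding run_residual_def phase.res_def
    by (rule runs_mbind[OF runs_ask_elements[OF T]])
      (simp add: set_cost_def sum_list_distinct_conv_sum_set distinct_el[OF T])
qed

lemma runs_run_cleanup:
  assumes T: "T \<in> F" and U: "U \<subseteq> E"
    and res: "\<And>T. T \<in> F \<Longrightarrow> runs I \<omega> (residual T) (phase.res el U T) (w T)"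
  shows "runs I \<omega> (run_cleanup residual p T)
    (needs_cleanup (phase.lev el st U (slice (trial \<omega>) p) R) p T)
    (phase.cleanup_cost el st U t w (slice (trial \<omega>) p) R T)"
proof -
  interpret phase el st U .
  let ?y = "slice (trial \<omega>) p"
  have d: "distinct (el T)" using T by (intro distinct_el F_el)
  have "runs I \<omega> (mfilter (\<lambda>e. run_block residual p R [e]) (res T))
     (filter (\<lambda>e. set [e] \<subseteq> lev ?y R) (res T)) (\<Sum>e\<leftarrow>res T. block_cost t w ?y R [e])"
    by (intro runs_mfilter runs_run_block[OF U res]) (auto simp: res_def)
  then have filt: "runs I \<omega> (mfilter (\<lambda>e. run_block residual p R [e]) (res T))
     (filter (\<lambda>e. set [e] \<subseteq> lev ?y R) (res T)) (\<Sum>e\<in>set (res T). block_cost t w ?y R [e])"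
    using d by (simp add: sum_list_distinct_conv_sum_set res_def)
  have len: "length (filter (\<lambda>e. set [e] \<subseteq> lev ?y R) (res T)) = card (set (el T) \<inter> lev ?y R)"
  proof -
    have "filter (\<lambda>e. set [e] \<subseteq> lev ?y R) (res T) = filter (\<lambda>e. e \<in> lev ?y R) (el T)"
      using lev_subset[of ?y R] by (auto simp: res_def intro!: filter_cong)
    moreover have "distinct (filter (\<lambda>e. e \<in> lev ?y R) (el T))"
      using d by simp
    ultimately show ?thesis
      by (metis distinct_card inter_set_filter Int_commute inf_commute set_filter Collect_conj_eq Collect_mem_eq)
  qed
  show ?thesis
    unfolding run_cleanup_def cleanup_cost_def needs_cleanup_def
    by (rule runs_mbind[OF res[OF T]], rule runs_mbind[OF filt], rule runs_mret') (simp_all only: len add_0_right)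
qed

text \<open>Induction on the phases: the residual list of a set in phase \<open>p\<close> is found
  by running the test for the start of phase \<open>p\<close> on each of its elements.\<close>

lemma runs_run_uncovered:
  "e \<in> E \<Longrightarrow> runs I \<omega> (run_uncovered p e) (e \<in> uncovered (trial \<omega>) p) (cost (trial \<omega>) p e)"
proof (induction p arbitrary: e)
  case 0
  then show ?case by (simp add: runs_mret)
next
  case (Suc p)
  let ?Y = "trial \<omega>"
  let ?r = "run_residual (run_uncovered p)"
  have res: "runs I \<omega> (?r T) (phase.res el (uncovered ?Y p) T) (set_cost (cost ?Y p) T)" if "T \<in> F" for T
    by (rule runs_residual[OF that uncovered_subset Suc.IH])
  have block: "runs I \<omega> (run_block ?r p R [e]) (e \<in> level ?Y p R) (the_block_cost ?Y p R [e])"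
    if "e \<in> uncovered ?Y p"
  proof -
    have "runs I \<omega> (run_block ?r p R [e]) (set [e] \<subseteq> level ?Y p R) (the_block_cost ?Y p R [e])"
      by (intro runs_run_block uncovered_subset res) (use that in simp_all)
    then show ?thesis by simp
  qed
  have "runs I \<omega> (mfilter (run_cleanup ?r p) (st e))
      (filter (needs_cleanup (level ?Y p R) p) (st e)) (\<Sum>T\<leftarrow>st e. the_cleanup_cost ?Y p T)"
    using set_st[OF Suc.prems]
    by (intro runs_mfilter runs_run_cleanup[OF _ uncovered_subset res]) auto
  then have filt: "runs I \<omega> (mfilter (run_cleanup ?r p) (st e))
      (filter (needs_cleanup (level ?Y p R) p) (st e)) (\<Sum>T\<in>set (st e). the_cleanup_cost ?Y p T)"
    by (simp add: sum_list_distinct_conv_sum_set distinct_st[OF Suc.prems])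
  have sub: "level ?Y p R \<subseteq> uncovered ?Y p"
    by (rule phase.lev_subset)
  show ?case
    unfolding run_uncovered.simps cost.simps
  proof (rule runs_mbind[OF Suc.IH[OF Suc.prems] _ refl])
    show "runs I \<omega> (if e \<in> uncovered ?Y p then mbind (run_block ?r p R [e]) (\<lambda>b. if b then
       mbind (ask_sets e) (\<lambda>Ts. mbind (mfilter (run_cleanup ?r p) Ts) (\<lambda>ws. mret (ws = [])))
        else mret False) else mret False)
      (e \<in> uncovered ?Y (Suc p))
      (if e \<in> uncovered ?Y p then the_block_cost ?Y p R [e] +
         (if e \<in> level ?Y p R then t + (\<Sum>T\<in>set (st e). the_cleanup_cost ?Y p T) else 0) else 0)"
    proof (cases "e \<in> uncovered ?Y p")
      case True
      show ?thesis
        unfolding if_P[OF True]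
      proof (rule runs_mbind[OF block[OF True] _ refl])
        show "runs I \<omega> (if e \<in> level ?Y p R then
          mbind (ask_sets e) (\<lambda>Ts. mbind (mfilter (run_cleanup ?r p) Ts) (\<lambda>ws. mret (ws = [])))
          else mret False) (e \<in> uncovered ?Y (Suc p))
          (if e \<in> level ?Y p R then t + (\<Sum>T\<in>set (st e). the_cleanup_cost ?Y p T) else 0)"
          by (auto intro!: runs_mret' runs_mbind[OF runs_ask_sets[OF Suc.prems]] runs_mbind[OF filt]
               simp: filter_empty_conv)
      qed
    next
      case False
      then show ?thesis using sub by (auto intro!: runs_mret')
    qed
  qed
qed

lemma runs_run_phase:
  assumes T: "T \<in> F"
  shows "runs I \<omega> (run_phase p T) (chosen (trial \<omega>) p T) (phase_cost (trial \<omega>) p T)"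
proof -
  let ?Y = "trial \<omega>"
  let ?r = "run_residual (run_uncovered p)"
  let ?xs = "concat (map (\<lambda>j. map (Pair j) [0..<2^j]) [0..<R])"
  let ?f = "\<lambda>(j, n). run_trial ?r (run_block ?r p j) (p, j, T, n)"
  have res: "runs I \<omega> (?r T) (phase.res el (uncovered ?Y p) T) (set_cost (cost ?Y p) T)" if "T \<in> F" for T
    by (rule runs_residual[OF that uncovered_subset runs_run_uncovered])
  have "runs I \<omega> (?f x) ((\<lambda>(j, n). wins ?Y p j T n) x) ((\<lambda>(j, n). the_trial_cost ?Y p j T n) x)" for x
    unfolding wins_def
    by (cases x) (simp, intro runs_run_trial T uncovered_subset res runs_run_block)
  then have "runs I \<omega> (mfilter ?f ?xs) (filter (\<lambda>(j, n). wins ?Y p j T n) ?xs)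
     (\<Sum>x\<leftarrow>?xs. (\<lambda>(j, n). the_trial_cost ?Y p j T n) x)"
    by (rule runs_mfilter)
  moreover have "(\<Sum>x\<leftarrow>?xs. f x) = (\<Sum>j<R. \<Sum>n<2^j. f (j, n))" for f :: "nat \<times> nat \<Rightarrow> nat"
  proof -
    have "(\<Sum>x\<leftarrow>concat (map h js). f x) = (\<Sum>j\<leftarrow>js. \<Sum>x\<leftarrow>h j. f x)" for h :: "nat \<Rightarrow> (nat \<times> nat) list" and js
      by (induction js) simp_all
    then show ?thesis
      by (simp add: comp_def sum_list_distinct_conv_sum_set atLeast0LessThan)
  qed
  ultimately have filt: "runs I \<omega> (mfilter ?f ?xs) (filter (\<lambda>(j, n). wins ?Y p j T n) ?xs)
     (\<Sum>j<R. \<Sum>n<2^j. the_trial_cost ?Y p j T n)"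
    by simp
  have "(filter (\<lambda>(j, n). wins ?Y p j T n) ?xs \<noteq> []) = (\<exists>j<R. \<exists>n<2^j. wins ?Y p j T n)"
    by (fastforce simp: filter_empty_conv)
  then show ?thesis
    unfolding run_phase_def Let_def phase_cost_def chosen_def
    by (intro runs_mbind[OF filt runs_mbind[OF runs_run_cleanup[OF T uncovered_subset res] runs_mret']])
       simp_all
qed

lemma runs_run_set:
  assumes T: "T < num_sets I"
  shows "runs I \<omega> (run_set T) (T \<in> F \<and> (\<exists>p<L. chosen (trial \<omega>) p T))
     (if T \<in> F then s + (\<Sum>p<L. phase_cost (trial \<omega>) p T) else s)"
  unfolding run_set_def
proof (rule runs_mbind[OF runs_ask_elements[OF T]])
  let ?Y = "trial \<omega>"
  show "runs I \<omega> (if el T = [] then mret False else mbind (mfilter (\<lambda>p. run_phase p T) [0..<L]) (\<lambda>ps. mret (ps \<noteq> [])))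
    (T \<in> F \<and> (\<exists>p<L. chosen ?Y p T)) (if T \<in> F then \<Sum>p<L. phase_cost ?Y p T else 0)"
  proof (cases "el T = []")
    case True
    then show ?thesis by (auto simp: F_def intro!: runs_mret')
  next
    case False
    then have TF: "T \<in> F" using T by (simp add: F_def)
    have "runs I \<omega> (mfilter (\<lambda>p. run_phase p T) [0..<L]) (filter (\<lambda>p. chosen ?Y p T) [0..<L])
       (\<Sum>p\<leftarrow>[0..<L]. phase_cost ?Y p T)"
      by (intro runs_mfilter runs_run_phase TF)
    then have filt: "runs I \<omega> (mfilter (\<lambda>p. run_phase p T) [0..<L]) (filter (\<lambda>p. chosen ?Y p T) [0..<L])
       (\<Sum>p<L. phase_cost ?Y p T)"
      by (simp add: sum_list_distinct_conv_sum_set atLeast0LessThan)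
    have "(filter (\<lambda>p. chosen ?Y p T) [0..<L] \<noteq> []) = (T \<in> F \<and> (\<exists>p<L. chosen ?Y p T))"
      using TF by (auto simp: filter_empty_conv)
    then show ?thesis
      unfolding if_not_P[OF False] using TF
      by (intro runs_mbind[OF filt runs_mret']) simp_all
  qed
qed simp

end

section \<open>Every outcome yields a cover\<close>

context lca_instance begin

text \<open>A set that violates the halved bound joins by cleanup, which covers all its elements;
  any other set satisfies the bound already.\<close>

lemma card_uncovered_less:
  assumes "s < 2 ^ L" "T \<in> F" "p \<le> L"
  shows "card (set (el T) \<inter> uncovered Y p) < 2 ^ (L - p)"
  using assms(3)
proof (induction p)
  case 0
  have "card (set (el T) \<inter> uncovered Y 0) \<le> card (set (el T))"
    by (intro card_mono) auto
  also have "\<dots> \<le> s"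
    using length_el[OF F_el[OF assms(2)]] card_length le_trans by blast
  finally show ?case using assms(1) by simp
next
  case (Suc p)
  let ?V = "level Y p R"
  have sub: "uncovered Y (Suc p) \<subseteq> ?V" unfolding uncovered.simps by blast
  show ?case
  proof (cases "needs_cleanup ?V p T")
    case True
    have "set (el T) \<inter> uncovered Y (Suc p) = {}"
    proof (rule ccontr)
      assume "set (el T) \<inter> uncovered Y (Suc p) \<noteq> {}"
      then obtain e where e: "e \<in> set (el T)" "e \<in> uncovered Y (Suc p)" by blast
      then have "T \<in> set (st e)"
        using set_st[of e] uncovered_subset[of Y "Suc p"] assms(2) by blast
      then show False using e(2) True by simp
    qed
    then show ?thesis by simp
  next
    case False
    have "card (set (el T) \<inter> uncovered Y (Suc p)) \<le> card (set (el T) \<inter> ?V)"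
      by (rule card_mono) (use sub in blast)+
    then show ?thesis using False by (simp add: needs_cleanup_def)
  qed
qed

text \<open>After phase \<open>L\<close> the bound has dropped to \<open>2 ^ 0\<close>, so no set
  has an uncovered element left.\<close>

lemma uncovered_L:
  assumes "s < 2 ^ L" shows "uncovered Y L = {}"
proof (rule ccontr)
  assume "uncovered Y L \<noteq> {}"
  then obtain e where e: "e \<in> uncovered Y L" by (auto simp only: ex_in_conv[symmetric])
  then have "e \<in> E" by (rule subsetD[OF uncovered_subset])
  then obtain T where T: "T \<in> set (st e)"
    using st_nonempty[of e] by (auto simp only: ex_in_conv[symmetric])
  then have T: "T \<in> F" "e \<in> set (el T)"
    unfolding set_st[OF \<open>e \<in> E\<close>] by simp_all
  have "card (set (el T) \<inter> uncovered Y L) < 1"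
    using card_uncovered_less[OF assms T(1), of L Y] by simp
  then have "set (el T) \<inter> uncovered Y L = {}"
    by (metis card_0_eq finite_Int finite_set less_one)
  then show False using T(2) e by blast
qed

lemma lev_Suc_covered:
  assumes "e \<in> U" "e \<notin> phase.lev el st U y j"
  shows "\<exists>i<j. \<exists>T\<in>set (st e). \<exists>n<2^i. phase.succeeds el U (phase.lev el st U y i) (y (i, T, n)) T"
  using assms(2)
proof (induction j)
  case 0
  then show ?case using assms(1) by (simp add: phase.lev.simps)
next
  case (Suc j)
  show ?case
  proof (cases "e \<in> phase.lev el st U y j")
    case True
    then obtain T n where "T \<in> set (st e)" "n < 2^j"
      "phase.succeeds el U (phase.lev el st U y j) (y (j, T, n)) T"
      using Suc.prems unfolding phase.lev.simps by blast
    then show ?thesis by blast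
  next
    case False
    then show ?thesis using Suc.IH less_SucI by blast
  qed
qed

text \<open>There is a phase in which \<open>e\<close> stops being uncovered. If \<open>e\<close>
  survives all its levels, a cleanup covers it; otherwise a trial of a set containing
  \<open>e\<close> wins.\<close>

lemma chosen_covers:
  assumes "s < 2 ^ L" "e \<in> E"
  shows "\<exists>p<L. \<exists>T\<in>F. e \<in> set (el T) \<and> chosen Y p T"
proof -
  have "\<exists>p<j. e \<in> uncovered Y p \<and> e \<notin> uncovered Y (Suc p)" if "e \<notin> uncovered Y j" for j
    using that
  proof (induction j)
    case 0
    then show ?case using assms(2) by simp
  next
    case (Suc j)
    then show ?case by (metis less_Suc_eq)
  qed
  then obtain p where p: "p < L" "e \<in> uncovered Y p" "e \<notin> uncovered Y (Suc p)"
    using uncovered_L[OF assms(1)] by blast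
  show ?thesis
  proof (cases "e \<in> level Y p R")
    case True
    then obtain T where "T \<in> set (st e)" "needs_cleanup (level Y p R) p T"
      using p(3) by auto
    then show ?thesis
      using p(1) set_st[OF assms(2)] unfolding chosen_def by blast
  next
    case False
    then obtain i T n where "i < R" "T \<in> set (st e)" "n < 2^i" "wins Y p i T n"
      using lev_Suc_covered[OF p(2)] unfolding wins_def slice_def by blast
    then show ?thesis
      using p(1) set_st[OF assms(2)] unfolding chosen_def by blast
  qed
qed

end

section \<open>Random trials\<close>

lemma expectation_pair_pmf_finite:
  fixes f :: "_ \<Rightarrow> real"
  assumes "finite (set_pmf p)" "finite (set_pmf q)"
  shows "measure_pmf.expectation (pair_pmf p q) f =
    measure_pmf.expectation p (\<lambda>x. measure_pmf.expectation q (\<lambda>y. f (x, y)))"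
proof -
  have "measure_pmf.expectation (pair_pmf p q) f =
    (\<Sum>z\<in>set_pmf p \<times> set_pmf q. pmf (pair_pmf p q) z * f z)"
    using assms by (subst integral_measure_pmf_real[where A = "set_pmf p \<times> set_pmf q"]) (auto simp: mult.commute)
  also have "\<dots> = (\<Sum>x\<in>set_pmf p. \<Sum>y\<in>set_pmf q. pmf p x * (pmf q y * f (x, y)))"
    by (auto simp: sum.cartesian_product pmf_pair mult.assoc intro!: sum.cong)
  also have "\<dots> = (\<Sum>x\<in>set_pmf p. pmf p x * measure_pmf.expectation q (\<lambda>y. f (x, y)))"
    using assms
    by (subst integral_measure_pmf_real[where A = "set_pmf q"]) (auto simp: mult.commute sum_distrib_left)
  also have "\<dots> = measure_pmf.expectation p (\<lambda>x. measure_pmf.expectation q (\<lambda>y. f (x, y)))"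
    using integral_measure_pmf_real[of "set_pmf p" p "\<lambda>x. measure_pmf.expectation q (\<lambda>y. f (x, y))"] assms
    by (simp add: mult.commute)
  finally show ?thesis .
qed

lemma finite_set_Pi_pmf:
  assumes "finite A" "\<And>x. x \<in> A \<Longrightarrow> finite (set_pmf (p x))"
  shows "finite (set_pmf (Pi_pmf A dflt p))"
  using assms by (simp add: set_Pi_pmf finite_PiE_dflt)

lemma override_on_override_on: "override_on (override_on f g A) h A = override_on f h A"
  by (auto simp: override_on_def fun_eq_iff)

text \<open>The key to conditioning on the history: the coordinates in \<open>A\<close> may be drawn afresh.\<close>

lemma expectation_Pi_pmf_resample:
  fixes f :: "_ \<Rightarrow> real"
  assumes K: "finite K" and A: "A \<subseteq> K" and fin: "\<And>x. x \<in> K \<Longrightarrow> finite (set_pmf (p x))"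
  shows "measure_pmf.expectation (Pi_pmf K dflt p) f =
    measure_pmf.expectation (Pi_pmf K dflt p) (\<lambda>y.
      measure_pmf.expectation (Pi_pmf A dflt p) (\<lambda>z. f (override_on y z A)))"
proof -
  let ?Q = "Pi_pmf (K - A) dflt p" and ?A = "Pi_pmf A dflt p"
  have finA: "finite A" using A K by (rule finite_subset)
  have KA: "K = (K - A) \<union> A" using A by blast
  have fQ: "finite (set_pmf ?Q)" using K fin by (intro finite_set_Pi_pmf) auto
  have fA: "finite (set_pmf ?A)" using finA A fin by (intro finite_set_Pi_pmf) auto
  have split: "measure_pmf.expectation (Pi_pmf K dflt p) h =
     measure_pmf.expectation ?Q (\<lambda>x. measure_pmf.expectation ?A (\<lambda>z. h (override_on x z A)))"
    for h :: "_ \<Rightarrow> real"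
  proof -
    have "Pi_pmf K dflt p = map_pmf (\<lambda>(f, g) x. if x \<in> K - A then f x else g x) (pair_pmf ?Q ?A)"
      using K finA by (subst KA, subst Pi_pmf_union) auto
    then have "measure_pmf.expectation (Pi_pmf K dflt p) h =
        measure_pmf.expectation (pair_pmf ?Q ?A) (\<lambda>(f, g). h (\<lambda>x. if x \<in> K - A then f x else g x))"
      by (simp add: case_prod_unfold)
    also have "\<dots> = measure_pmf.expectation ?Q (\<lambda>f. measure_pmf.expectation ?A
        (\<lambda>g. h (\<lambda>x. if x \<in> K - A then f x else g x)))"
      using fQ fA by (simp add: expectation_pair_pmf_finite)
    also have "\<dots> = measure_pmf.expectation ?Q (\<lambda>f. measure_pmf.expectation ?A (\<lambda>g. h (override_on f g A)))"
    proof (intro integral_cong_AE AE_pmfI)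
      fix f g assume f: "f \<in> set_pmf ?Q" and g: "g \<in> set_pmf ?A"
        have "f x = dflt" if "x \<notin> K - A" for x
          using f set_Pi_pmf_subset[of "K - A" dflt p] K that by auto
        moreover have "g x = dflt" if "x \<notin> A" for x
          using g set_Pi_pmf_subset[of A dflt p] finA that by auto
        ultimately have "(\<lambda>x. if x \<in> K - A then f x else g x) = override_on f g A"
          using A by (auto simp: override_on_def fun_eq_iff)
        then show "h (\<lambda>x. if x \<in> K - A then f x else g x) = h (override_on f g A)" by simp
    qed simp_all
    finally show ?thesis .
  qed
  show ?thesis
    using split[of f] split[of "\<lambda>y. measure_pmf.expectation ?A (\<lambda>z. f (override_on y z A))"]
    by (simp add: override_on_override_on)
qed

section \<open>The distribution of a single trial\<close>

definition index_lists :: "nat \<Rightarrow> nat \<Rightarrow> nat list set" where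
  "index_lists k c = {xs. set xs \<subseteq> {..<2 ^ k} \<and> length xs = c}"

definition trial_pmf :: "nat \<Rightarrow> nat \<Rightarrow> nat \<Rightarrow> nat list option pmf" where
  "trial_pmf a c k = bind_pmf (bernoulli_pmf (1 / 2 ^ a))
     (\<lambda>b. if b then map_pmf Some (pmf_of_set (index_lists k c)) else return_pmf None)"

lemma finite_index_lists [simp]: "finite (index_lists k c)"
  unfolding index_lists_def by (rule finite_lists_length_eq) simp

lemma card_index_lists: "card (index_lists k c) = 2 ^ (k * c)"
  unfolding index_lists_def by (simp add: card_lists_length_eq power_mult)

lemma index_lists_nonempty [simp]: "index_lists k c \<noteq> {}"
proof -
  have "replicate c 0 \<in> index_lists k c" by (auto simp: index_lists_def)
  then show ?thesis by blast
qed

lemma finite_set_trial_pmf [simp]: "finite (set_pmf (trial_pmf a c k))"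
  by (auto simp: trial_pmf_def)

lemma expectation_trial_pmf:
  fixes f :: "_ \<Rightarrow> real"
  assumes "f None = 0"
  shows "measure_pmf.expectation (trial_pmf a c k) f =
    (\<Sum>is\<in>index_lists k c. f (Some is)) / (2 ^ a * 2 ^ (k * c))"
proof -
  have "(1::real) / 2 ^ a \<le> 1" by simp
  then show ?thesis
    unfolding trial_pmf_def
    by (subst pmf_expectation_bind[where A = UNIV])
      (auto simp: UNIV_bool assms integral_pmf_of_set card_index_lists)
qed

text \<open>Each of the \<open>Suc d\<close> positions takes each value in \<open>card X ^ d\<close>
  of the lists.\<close>

lemma sum_lists_sum_list:
  fixes h :: "'a \<Rightarrow> real"
  assumes "finite X"
  shows "(\<Sum>xs\<in>{xs. set xs \<subseteq> X \<and> length xs = Suc d}. \<Sum>x\<leftarrow>xs. h x) =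
    real (Suc d) * real (card X) ^ d * (\<Sum>x\<in>X. h x)"
proof (induction d)
  case 0
  have "{xs. set xs \<subseteq> X \<and> length xs = Suc 0} = (\<lambda>x. [x]) ` X"
    by (auto simp: length_Suc_conv)
  then show ?case by (simp add: sum.reindex inj_on_def)
next
  case (Suc d)
  let ?S = "{xs. set xs \<subseteq> X \<and> length xs = Suc d}"
  have "(\<Sum>xs\<in>{xs. set xs \<subseteq> X \<and> length xs = Suc (Suc d)}. \<Sum>x\<leftarrow>xs. h x) =
      (\<Sum>p\<in>?S \<times> X. h (snd p) + (\<Sum>x\<leftarrow>fst p. h x))"
    unfolding lists_length_Suc_eq[of X "Suc d"]
    by (subst sum.reindex) (auto simp: inj_on_def case_prod_unfold)
  also have "\<dots> = (\<Sum>xs\<in>?S. \<Sum>x\<in>X. h x + (\<Sum>x\<leftarrow>xs. h x))"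
    by (simp add: sum.cartesian_product case_prod_unfold)
  also have "\<dots> = real (card X) ^ Suc d * (\<Sum>x\<in>X. h x) + real (card X) * (\<Sum>xs\<in>?S. \<Sum>x\<leftarrow>xs. h x)"
    using assms by (simp add: sum.distrib card_lists_length_eq sum_distrib_left)
  finally show ?case by (simp add: Suc.IH algebra_simps)
qed

section \<open>The cover size of one phase\<close>

context phase begin

lemma lev_antimono: "i \<le> j \<Longrightarrow> lev y j \<subseteq> lev y i"
  by (induction j) (auto simp: le_Suc_eq)

lemma lev_cong:
  assumes "\<And>\<kappa>. fst \<kappa> < j \<Longrightarrow> y \<kappa> = y' \<kappa>"
  shows "lev y j = lev y' j"
  using assms by (induction j) auto

lemma block_cost_cong:
  assumes "\<And>\<kappa>. fst \<kappa> < j \<Longrightarrow> y \<kappa> = y' \<kappa>"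
  shows "block_cost t w y j = block_cost t w y' j"
  using assms
proof (induction j)
  case 0
  show ?case by (rule ext) simp
next
  case (Suc j)
  have IH: "block_cost t w y j = block_cost t w y' j"
    using Suc by simp
  have lev: "lev y j = lev y' j"
    using Suc.prems by (intro lev_cong) simp
  have y: "y (j, T, n) = y' (j, T, n)" for T n
    using Suc.prems by simp
  show ?case
    by (rule ext) (simp only: block_cost.simps IH lev y)
qed

end

text \<open>Two assumptions calibrate the parameters. By \<open>R_eq\<close> the last level has
  \<open>\<mu>\<close> equal to \<open>2 ^ (Suc d + b)\<close>, so a set with
  \<open>\<rho> \<ge> 1 / 2\<close> survives it with probability at most
  \<open>exp (- (2 ^ b))\<close>. By \<open>R_le\<close> the sets with \<open>\<rho> < 1 / 4\<close>
  add only \<open>4 / R\<close> to the load of an element in a level.\<close>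

locale random_phase = phase el st U for el st :: "nat \<Rightarrow> nat list" and U :: "nat set" +
  fixes F :: "nat set" and t a d b k R :: nat
  assumes finite_F: "finite F" and finite_U: "finite U"
    and distinct_el: "T \<in> F \<Longrightarrow> distinct (el T)"
    and card_el_U: "T \<in> F \<Longrightarrow> card (set (el T) \<inter> U) \<le> 2 ^ k"
    and set_st: "e \<in> U \<Longrightarrow> set (st e) = {T \<in> F. e \<in> set (el T)}"
    and card_st: "e \<in> U \<Longrightarrow> card (set (st e)) \<le> t"
    and t_le: "t \<le> 2 ^ a"
    and R_eq: "R = a + Suc d + 1 + b"
    and R_le: "2 ^ R * R \<le> 4 ^ Suc d"
    and k_pos: "0 < k"
begin

definition keys_at :: "nat \<Rightarrow> (nat \<times> nat \<times> nat) set" where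
  "keys_at j = {j} \<times> F \<times> {..<2 ^ j}"

definition keys :: "(nat \<times> nat \<times> nat) set" where
  "keys = (SIGMA j:{..<R}. F \<times> {..<2 ^ j})"

abbreviation D :: "nat list option pmf" where
  "D \<equiv> trial_pmf a (Suc d) k"

abbreviation P :: "phase_outcome pmf" where
  "P \<equiv> Pi_pmf keys None (\<lambda>_. D)"

abbreviation \<E> :: "(phase_outcome \<Rightarrow> real) \<Rightarrow> real" where
  "\<E> \<equiv> measure_pmf.expectation P"

definition \<rho> :: "nat set \<Rightarrow> nat \<Rightarrow> real" where
  "\<rho> V T = real (card (set (el T) \<inter> V)) / 2 ^ k"

text \<open>If \<open>V\<close> is uncovered before level \<open>j\<close>, then
  \<open>\<mu> j * g V e / 2 ^ k\<close> is the part of the expected number of successful trials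
  that is charged to \<open>e\<close>. With \<open>h\<close> instead of \<open>g\<close>, the
  product \<open>\<mu> j * h V e\<close> is the expected number of successful trials of sets
  containing \<open>e\<close>.\<close>

definition g :: "nat set \<Rightarrow> nat \<Rightarrow> real" where
  "g V e = (\<Sum>T\<in>set (st e). \<rho> V T ^ d)"

definition h :: "nat set \<Rightarrow> nat \<Rightarrow> real" where
  "h V e = (\<Sum>T\<in>set (st e). \<rho> V T ^ Suc d)"

definition \<mu> :: "nat \<Rightarrow> real" where
  "\<mu> j = 2 ^ j / 2 ^ a"

lemma R_pos: "0 < R"
  by (simp add: R_eq)

lemma \<mu>_pos: "0 < \<mu> j"
  by (simp add: \<mu>_def)

lemma \<mu>_Suc: "\<mu> (Suc j) = 2 * \<mu> j"
  by (simp add: \<mu>_def)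

lemma finite_keys: "finite keys"
  by (simp add: keys_def finite_F)

lemma finite_keys_at: "finite (keys_at j)"
  by (simp add: keys_at_def finite_F)

lemma keys_at_subset: "j < R \<Longrightarrow> keys_at j \<subseteq> keys"
  by (auto simp: keys_def keys_at_def)

lemma finite_P [simp]: "finite (set_pmf P)"
  by (intro finite_set_Pi_pmf finite_keys) simp

lemma integrable_P [simp]: "integrable (measure_pmf P) (f :: _ \<Rightarrow> real)"
  by (rule integrable_measure_pmf_finite) simp

lemma expect_mono: "(\<And>y. y \<in> set_pmf P \<Longrightarrow> f y \<le> f' y) \<Longrightarrow> \<E> f \<le> \<E> f'"
  by (intro integral_mono_AE AE_pmfI) simp_all

lemma expect_nonneg: "(\<And>y. 0 \<le> f y) \<Longrightarrow> 0 \<le> \<E> f"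
  by (intro integral_nonneg_AE AE_pmfI) simp

lemma resample_level:
  assumes "j < R"
  shows "\<E> f = \<E> (\<lambda>y. measure_pmf.expectation (Pi_pmf (keys_at j) None (\<lambda>_. D))
     (\<lambda>z. f (override_on y z (keys_at j))))"
  by (rule expectation_Pi_pmf_resample) (simp_all add: finite_keys keys_at_subset assms)

lemma resample_one:
  assumes "\<kappa> \<in> keys"
  shows "\<E> f = \<E> (\<lambda>y. measure_pmf.expectation D (\<lambda>z. f (y(\<kappa> := z))))"
proof -
  have "override_on y (\<lambda>b. if b = \<kappa> then z else None) {\<kappa>} = y(\<kappa> := z)"
    for y :: "nat \<times> nat \<times> nat \<Rightarrow> nat list option" and z
    by (auto simp: override_on_def fun_eq_iff)
  then show ?thesis
    using expectation_Pi_pmf_resample[of keys "{\<kappa>}" "\<lambda>_. D" None f] assms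
    by (simp add: finite_keys Pi_pmf_singleton)
qed

lemma lev_override: "i \<le> j \<Longrightarrow> lev (override_on y z (keys_at j)) i = lev y i"
  by (rule lev_cong) (auto simp: override_on_def keys_at_def)

lemma length_res: "T \<in> F \<Longrightarrow> length (res T) \<le> 2 ^ k"
proof -
  assume T: "T \<in> F"
  have "length (res T) = card (set (res T))"
    using distinct_el[OF T] unfolding res_def by (intro distinct_card[symmetric]) simp
  also have "set (res T) = set (el T) \<inter> U" by (auto simp: res_def)
  finally show ?thesis using card_el_U[OF T] by simp
qed

section \<open>Success probability and picks of a trial\<close>

lemma bij_positions:
  assumes "T \<in> F" "V \<subseteq> U"
  shows "bij_betw ((!) (res T)) {i. i < length (res T) \<and> res T ! i \<in> V} (set (el T) \<inter> V)"
proof -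
  have d: "distinct (res T)" using distinct_el[OF assms(1)] by (simp add: res_def)
  have "set (el T) \<inter> V = set (res T) \<inter> V" using assms(2) by (auto simp: res_def)
  moreover have "inj_on ((!) (res T)) {i. i < length (res T) \<and> res T ! i \<in> V}"
    using d by (auto simp: inj_on_def nth_eq_iff_index_eq)
  moreover have "(!) (res T) ` {i. i < length (res T) \<and> res T ! i \<in> V} = set (res T) \<inter> V"
    by (auto simp: in_set_conv_nth image_iff)
  ultimately show ?thesis by (simp add: bij_betw_def)
qed

lemma valid_index_lists:
  assumes "T \<in> F" "V \<subseteq> U"
  shows "{is \<in> index_lists k (Suc d). in_range is T \<and> set (pick is T) \<subseteq> V} =
    {is. set is \<subseteq> {i. i < length (res T) \<and> res T ! i \<in> V} \<and> length is = Suc d}"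
  using length_res[OF assms(1)] by (fastforce simp: index_lists_def in_range_def pick_def)

lemma card_positions:
  assumes "T \<in> F" "V \<subseteq> U"
  shows "card {i. i < length (res T) \<and> res T ! i \<in> V} = card (set (el T) \<inter> V)"
  using bij_betw_same_card[OF bij_positions[OF assms]] .

text \<open>Of the \<open>2 ^ k\<close> equally likely values of an index exactly
  \<open>card (set (el T) \<inter> V)\<close> point into \<open>V\<close>; there are
  \<open>Suc d\<close> independent indices, and activation contributes
  \<open>1 / 2 ^ a\<close>.\<close>

lemma expectation_succeeds:
  assumes "T \<in> F" "V \<subseteq> U"
  shows "measure_pmf.expectation D (\<lambda>z. of_bool (succeeds V z T)) = \<rho> V T ^ Suc d / 2 ^ a"
proof -
  let ?X = "{i. i < length (res T) \<and> res T ! i \<in> V}"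
  have "(\<Sum>is\<in>index_lists k (Suc d). of_bool (succeeds V (Some is) T)) =
      real (card {is \<in> index_lists k (Suc d). in_range is T \<and> set (pick is T) \<subseteq> V})"
    by (simp add: succeeds_def sum_of_bool_eq Int_def)
  also have "\<dots> = real (card (set (el T) \<inter> V)) ^ Suc d"
    unfolding valid_index_lists[OF assms] card_positions[OF assms, symmetric]
    by (simp add: card_lists_length_eq)
  finally have "measure_pmf.expectation D (\<lambda>z. of_bool (succeeds V z T)) =
      real (card (set (el T) \<inter> V)) ^ Suc d / (2 ^ a * 2 ^ (k * Suc d))"
    by (subst expectation_trial_pmf) (simp_all add: succeeds_def)
  then show ?thesis
    by (simp only: \<rho>_def power_divide power_mult divide_divide_eq_left mult.commute)
qed

text \<open>One pick carries the value of \<open>f\<close> while the other \<open>d\<close> picks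
  only have to land in \<open>V\<close>. Hence the exponent \<open>d\<close>, through which
  \<open>g\<close> enters the query bound.\<close>

lemma expectation_pick:
  fixes f :: "nat \<Rightarrow> real"
  assumes "T \<in> F" "V \<subseteq> U"
  shows "measure_pmf.expectation D (\<lambda>z. case z of None \<Rightarrow> 0 | Some is \<Rightarrow>
     if in_range is T \<and> set (pick is T) \<subseteq> V then \<Sum>e\<leftarrow>pick is T. f e else 0) =
     real (Suc d) / (2 ^ a * 2 ^ k) * (\<rho> V T ^ d * (\<Sum>e\<in>set (el T) \<inter> V. f e))"
proof -
  let ?X = "{i. i < length (res T) \<and> res T ! i \<in> V}"
  have "(\<Sum>is\<in>index_lists k (Suc d).
      if in_range is T \<and> set (pick is T) \<subseteq> V then \<Sum>e\<leftarrow>pick is T. f e else 0) =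
     (\<Sum>is\<in>{is \<in> index_lists k (Suc d). in_range is T \<and> set (pick is T) \<subseteq> V}. \<Sum>e\<leftarrow>pick is T. f e)"
    by (rule sum.inter_filter[symmetric]) simp
  also have "\<dots> = (\<Sum>is\<in>{is. set is \<subseteq> ?X \<and> length is = Suc d}. \<Sum>i\<leftarrow>is. f (res T ! i))"
    unfolding valid_index_lists[OF assms] by (simp add: pick_def comp_def)
  also have "\<dots> = real (Suc d) * real (card (set (el T) \<inter> V)) ^ d * (\<Sum>i\<in>?X. f (res T ! i))"
    unfolding card_positions[OF assms, symmetric] by (rule sum_lists_sum_list) simp
  also have "(\<Sum>i\<in>?X. f (res T ! i)) = (\<Sum>e\<in>set (el T) \<inter> V. f e)"
    by (rule sum.reindex_bij_betw[OF bij_positions[OF assms]])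
  finally have sum: "(\<Sum>is\<in>index_lists k (Suc d).
      if in_range is T \<and> set (pick is T) \<subseteq> V then \<Sum>e\<leftarrow>pick is T. f e else 0) =
    real (Suc d) * real (card (set (el T) \<inter> V)) ^ d * (\<Sum>e\<in>set (el T) \<inter> V. f e)" .
  have pow: "(2::real) ^ (k * Suc d) = 2 ^ k * (2 ^ k) ^ d"
    by (simp only: power_mult power_Suc)
  show ?thesis
    by (subst expectation_trial_pmf, simp, unfold option.case sum pow)
      (simp add: \<rho>_def power_divide)
qed

text \<open>The set \<open>V\<close> is fixed here. Substituting \<open>V = lev y j\<close> gives
  the conditional probability given the earlier levels without any conditional measure.\<close>

definition survival :: "nat set \<Rightarrow> nat \<Rightarrow> nat set \<Rightarrow> real" where
  "survival V j X = measure_pmf.expectation (Pi_pmf (keys_at j) None (\<lambda>_. D))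
     (\<lambda>z. of_bool (\<forall>T\<in>X. \<forall>n<2 ^ j. \<not> succeeds V (z (j, T, n)) T))"

lemma \<rho>_nonneg: "0 \<le> \<rho> V T"
  by (simp add: \<rho>_def)

lemma \<rho>_le_1: "T \<in> F \<Longrightarrow> V \<subseteq> U \<Longrightarrow> \<rho> V T \<le> 1"
proof -
  assume "T \<in> F" "V \<subseteq> U"
  then have "card (set (el T) \<inter> V) \<le> 2 ^ k"
    using card_el_U[of T] card_mono[of "set (el T) \<inter> U" "set (el T) \<inter> V"] by (meson Int_mono finite_Int finite_set order_refl order_trans)
  then have "real (card (set (el T) \<inter> V)) \<le> 2 ^ k"
    by (metis of_nat_le_iff of_nat_numeral of_nat_power)
  then show ?thesis by (simp add: \<rho>_def)
qed

lemma \<rho>_mono: "V \<subseteq> V' \<Longrightarrow> \<rho> V T \<le> \<rho> V' T"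
  unfolding \<rho>_def by (intro divide_right_mono of_nat_mono card_mono) auto

lemma survival_nonneg: "0 \<le> survival V j X"
  unfolding survival_def by (intro integral_nonneg_AE AE_pmfI) simp

text \<open>Independence of the trials gives a product of factors
  \<open>(1 - \<rho> V T ^ Suc d / 2 ^ a) ^ 2 ^ j\<close>, to which
  \<open>1 - x \<le> exp (- x)\<close> is applied.\<close>

lemma survival_le:
  assumes X: "X \<subseteq> F" and V: "V \<subseteq> U"
  shows "survival V j X \<le> exp (- \<mu> j * (\<Sum>T\<in>X. \<rho> V T ^ Suc d))"
proof -
  let ?f = "\<lambda>\<kappa> z. if fst (snd \<kappa>) \<in> X then 1 - of_bool (succeeds V z (fst (snd \<kappa>))) else (1::real)"
  have finX: "finite X" using X finite_F by (rule finite_subset)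
  have q: "0 \<le> \<rho> V T ^ Suc d / 2 ^ a \<and> \<rho> V T ^ Suc d / 2 ^ a \<le> 1" if "T \<in> X" for T
  proof -
    have "\<rho> V T ^ Suc d \<le> 1"
      using \<rho>_le_1[OF subsetD[OF X that] V] \<rho>_nonneg by (intro power_le_one)
    moreover have "(1::real) \<le> 2 ^ a" by simp
    ultimately have "\<rho> V T ^ Suc d \<le> 2 ^ a" by linarith
    then show ?thesis using \<rho>_nonneg[of V T] by simp
  qed
  have "of_bool (\<forall>T\<in>X. \<forall>n<2 ^ j. \<not> succeeds V (z (j, T, n)) T) = (\<Prod>\<kappa>\<in>keys_at j. ?f \<kappa> (z \<kappa>))" for z
  proof (cases "\<forall>T\<in>X. \<forall>n<2 ^ j. \<not> succeeds V (z (j, T, n)) T")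
    case True
    then have "(\<Prod>\<kappa>\<in>keys_at j. ?f \<kappa> (z \<kappa>)) = 1"
      by (intro prod.neutral) (auto simp: keys_at_def)
    then show ?thesis using True by simp
  next
    case False
    then obtain T n where "T \<in> X" "n < 2 ^ j" "succeeds V (z (j, T, n)) T" by blast
    then have "(\<Prod>\<kappa>\<in>keys_at j. ?f \<kappa> (z \<kappa>)) = 0"
      using X finite_keys_at by (intro prod_zero bexI[of _ "(j, T, n)"]) (auto simp: keys_at_def)
    then show ?thesis using False by simp
  qed
  then have "survival V j X = measure_pmf.expectation (Pi_pmf (keys_at j) None (\<lambda>_. D))
     (\<lambda>z. \<Prod>\<kappa>\<in>keys_at j. ?f \<kappa> (z \<kappa>))"
    by (simp add: survival_def)
  also have "\<dots> = (\<Prod>\<kappa>\<in>keys_at j. measure_pmf.expectation D (?f \<kappa>))"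
    by (rule expectation_prod_Pi_pmf) (auto simp: finite_keys_at intro!: integrable_measure_pmf_finite)
  also have "\<dots> = (\<Prod>\<kappa>\<in>keys_at j. if fst (snd \<kappa>) \<in> X then 1 - \<rho> V (fst (snd \<kappa>)) ^ Suc d / 2 ^ a else 1)"
  proof (rule prod.cong[OF refl])
    fix \<kappa> assume "\<kappa> \<in> keys_at j"
    then have T: "fst (snd \<kappa>) \<in> F" by (auto simp: keys_at_def)
    show "measure_pmf.expectation D (?f \<kappa>) =
      (if fst (snd \<kappa>) \<in> X then 1 - \<rho> V (fst (snd \<kappa>)) ^ Suc d / 2 ^ a else 1)"
    proof (cases "fst (snd \<kappa>) \<in> X")
      case True
      then show ?thesis
        using expectation_succeeds[OF T V]
        by (simp only: if_True, subst Bochner_Integration.integral_diff)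
          (auto intro!: integrable_measure_pmf_finite)
    qed simp
  qed
  also have "\<dots> = (\<Prod>T\<in>F. if T \<in> X then (1 - \<rho> V T ^ Suc d / 2 ^ a) ^ 2 ^ j else 1)"
  proof -
    have "(\<Prod>\<kappa>\<in>keys_at j. G (fst (snd \<kappa>))) = (\<Prod>T\<in>F. G T ^ 2 ^ j)" for G :: "nat \<Rightarrow> real"
    proof -
      have "keys_at j = Pair j ` (F \<times> {..<2 ^ j})" by (auto simp: keys_at_def)
      then have "(\<Prod>\<kappa>\<in>keys_at j. G (fst (snd \<kappa>))) = (\<Prod>(T, n)\<in>F \<times> {..<2 ^ j :: nat}. G T)"
        by (simp add: prod.reindex inj_on_def case_prod_unfold)
      also have "\<dots> = (\<Prod>T\<in>F. \<Prod>n<2 ^ j :: nat. G T)"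
        by (rule prod.cartesian_product[symmetric])
      finally show ?thesis by simp
    qed
    from this[of "\<lambda>T. if T \<in> X then 1 - \<rho> V T ^ Suc d / 2 ^ a else 1"]
    show ?thesis by (auto simp: if_distrib intro!: prod.cong)
  qed
  also have "\<dots> = (\<Prod>T\<in>X. (1 - \<rho> V T ^ Suc d / 2 ^ a) ^ 2 ^ j)"
    using X finite_F by (simp add: prod.If_cases Int_absorb1)
  also have "\<dots> \<le> (\<Prod>T\<in>X. exp (- (\<rho> V T ^ Suc d / 2 ^ a)) ^ 2 ^ j)"
    using q exp_ge_add_one_self[of "- (\<rho> V T ^ Suc d / 2 ^ a)" for T]
    by (intro prod_mono conjI power_mono zero_le_power) auto
  also have "\<dots> = exp (- \<mu> j * (\<Sum>T\<in>X. \<rho> V T ^ Suc d))"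
    unfolding exp_of_nat_mult[symmetric] exp_sum[OF finX, symmetric]
    by (simp add: \<mu>_def sum_distrib_left sum_negf field_simps)
  finally show ?thesis .
qed

text \<open>The history up to level \<open>j\<close> enters only through \<open>\<phi>\<close>, which is unaffected by drawing level
  \<open>j\<close> afresh.\<close>

lemma expectation_no_success:
  assumes j: "j < R" and \<phi>: "\<And>y z. \<phi> (override_on y z (keys_at j)) = \<phi> y" and X: "X \<subseteq> F"
  shows "\<E> (\<lambda>y. \<phi> y * of_bool (\<forall>T\<in>X. \<forall>n<2 ^ j. \<not> succeeds (lev y j) (y (j, T, n)) T)) =
     \<E> (\<lambda>y. \<phi> y * survival (lev y j) j X)"
proof -
  have "(\<forall>T\<in>X. \<forall>n<2 ^ j. \<not> succeeds V (override_on y z (keys_at j) (j, T, n)) T) \<longleftrightarrow>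
     (\<forall>T\<in>X. \<forall>n<2 ^ j. \<not> succeeds V (z (j, T, n)) T)" for V y z
    using X by (auto simp: override_on_def keys_at_def)
  then show ?thesis
    by (subst resample_level[OF j]) (simp add: \<phi> lev_override survival_def)
qed

lemma expectation_lev_Suc:
  assumes j: "j < R" and \<phi>: "\<And>y z. \<phi> (override_on y z (keys_at j)) = \<phi> y" and e: "e \<in> U"
  shows "\<E> (\<lambda>y. \<phi> y * of_bool (e \<in> lev y (Suc j))) =
     \<E> (\<lambda>y. \<phi> y * of_bool (e \<in> lev y j) * survival (lev y j) j (set (st e)))"
proof -
  have "\<E> (\<lambda>y. \<phi> y * of_bool (e \<in> lev y (Suc j))) = \<E> (\<lambda>y. \<phi> y * of_bool (e \<in> lev y j) *
      of_bool (\<forall>T\<in>set (st e). \<forall>n<2 ^ j. \<not> succeeds (lev y j) (y (j, T, n)) T))"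
    by (simp add: of_bool_conj mult.assoc)
  also have "\<dots> = \<E> (\<lambda>y. \<phi> y * of_bool (e \<in> lev y j) * survival (lev y j) j (set (st e)))"
    by (rule expectation_no_success[OF j]) (use set_st[OF e] in \<open>auto simp: \<phi> lev_override\<close>)
  finally show ?thesis .
qed

section \<open>Load of an element against its chance of being covered\<close>

lemma h_nonneg: "0 \<le> h V e"
  unfolding h_def by (intro sum_nonneg zero_le_power \<rho>_nonneg)

lemma g_mono: "V \<subseteq> V' \<Longrightarrow> g V e \<le> g V' e"
  unfolding g_def by (intro sum_mono power_mono \<rho>_mono \<rho>_nonneg)

lemma g_le:
  assumes "e \<in> U" "V \<subseteq> U" shows "g V e \<le> t"
proof -
  have "g V e \<le> (\<Sum>T\<in>set (st e). 1)"
    unfolding g_def using set_st[OF assms(1)] assms(2)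
    by (intro sum_mono power_le_one \<rho>_nonneg \<rho>_le_1) auto
  then show ?thesis using card_st[OF assms(1)] by simp
qed

lemma \<mu>_g_le:
  assumes "e \<in> U" "V \<subseteq> U" shows "\<mu> j * g V e \<le> 2 ^ j"
proof -
  have "real t \<le> 2 ^ a"
    using t_le by (metis of_nat_le_iff of_nat_numeral of_nat_power)
  then have "g V e \<le> 2 ^ a" using g_le[OF assms] by linarith
  then show ?thesis by (simp add: \<mu>_def field_simps)
qed

text \<open>Where \<open>\<rho> \<ge> 1 / 4\<close>, one further factor \<open>\<rho>\<close> costs
  at most 4. Each other set adds at most \<open>4 / 4 ^ Suc d\<close>, and \<open>R_le\<close>
  bounds their total, multiplied by \<open>\<mu> j\<close>, by \<open>4 / R\<close>.\<close>

lemma g_le_h: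
  assumes "e \<in> U" "V \<subseteq> U" "j < R"
  shows "\<mu> j * g V e \<le> 4 * (\<mu> j * h V e) + 4 / R"
proof -
  have *: "\<rho> V T ^ d \<le> 4 * \<rho> V T ^ Suc d + 4 / 4 ^ Suc d" for T
  proof (cases "\<rho> V T \<ge> 1 / 4")
    case True
    then have "1 * \<rho> V T ^ d \<le> (4 * \<rho> V T) * \<rho> V T ^ d"
      by (intro mult_right_mono) (simp_all add: \<rho>_nonneg)
    then have "\<rho> V T ^ d \<le> 4 * \<rho> V T ^ Suc d" by (simp add: mult.assoc)
    moreover have "(0::real) \<le> 4 / 4 ^ Suc d" by simp
    ultimately show ?thesis by linarith
  next
    case False
    then have "\<rho> V T ^ d \<le> (1 / 4) ^ d"
      by (intro power_mono) (simp_all add: \<rho>_nonneg)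
    also have "\<dots> = 4 / 4 ^ Suc d" by (simp add: power_divide)
    also have "\<dots> \<le> 4 * \<rho> V T ^ Suc d + 4 / 4 ^ Suc d"
      using \<rho>_nonneg[of V T] by simp
    finally show ?thesis .
  qed
  have "g V e \<le> (\<Sum>T\<in>set (st e). 4 * \<rho> V T ^ Suc d + 4 / 4 ^ Suc d)"
    unfolding g_def by (intro sum_mono *)
  also have "\<dots> = 4 * h V e + card (set (st e)) * (4 / 4 ^ Suc d)"
    by (simp add: sum.distrib h_def sum_distrib_left)
  also have "\<dots> \<le> 4 * h V e + t * (4 / 4 ^ Suc d)"
    using card_st[OF assms(1)] by (intro add_left_mono mult_right_mono) simp_all
  finally have "\<mu> j * g V e \<le> \<mu> j * (4 * h V e + t * (4 / 4 ^ Suc d))"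
    using \<mu>_pos[of j] by (intro mult_left_mono) simp_all
  also have "\<dots> = 4 * (\<mu> j * h V e) + \<mu> j * t * (4 / 4 ^ Suc d)"
    by (simp add: algebra_simps)
  also have "\<mu> j * t * (4 / 4 ^ Suc d) \<le> 4 / R"
  proof -
    have "real t \<le> 2 ^ a"
      using t_le by (metis of_nat_le_iff of_nat_numeral of_nat_power)
    then have "\<mu> j * t \<le> \<mu> j * 2 ^ a" using \<mu>_pos[of j] by (intro mult_left_mono) simp_all
    also have "\<dots> = 2 ^ j" by (simp add: \<mu>_def)
    also have "\<dots> \<le> (2::real) ^ R" using assms(3) by (intro power_increasing) simp_all
    finally have "\<mu> j * t * R \<le> 2 ^ R * real R" by (rule mult_right_mono) simp
    also have "\<dots> \<le> 4 ^ Suc d"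
      using of_nat_mono[OF R_le, where 'a = real] by (simp only: of_nat_mult of_nat_power of_nat_numeral)
    finally show ?thesis using R_pos by (simp add: field_simps)
  qed
  finally show ?thesis by simp
qed

lemma survival_set_st:
  assumes "e \<in> U" "V \<subseteq> U"
  shows "survival V j (set (st e)) \<le> exp (- (\<mu> j * h V e))"
  using survival_le[OF _ assms(2), of "set (st e)" j] set_st[OF assms(1)] by (auto simp: h_def)

text \<open>Let \<open>z = \<mu> j * h V e\<close>. A survival probability
  \<open>S \<le> exp (- z)\<close> satisfies \<open>S * (1 + z) \<le> 1\<close>, hence
  \<open>z * S \<le> 1 - S\<close>: load that survives is paid for by the probability of being
  covered.\<close>

lemma survival_load:
  assumes "e \<in> U" "V \<subseteq> U" "j < R"
  shows "\<mu> j * g V e * survival V j (set (st e)) \<le> 4 * (1 - survival V j (set (st e))) + 4 / R"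
proof -
  let ?S = "survival V j (set (st e))"
  let ?z = "\<mu> j * h V e"
  have S: "0 \<le> ?S" "?S \<le> exp (- ?z)"
    using survival_nonneg survival_set_st[OF assms(1,2)] by auto
  have z: "0 \<le> ?z" using \<mu>_pos[of j] h_nonneg by simp
  have "?S * (1 + ?z) \<le> exp (- ?z) * exp ?z"
    using S z exp_ge_add_one_self[of ?z] by (intro mult_mono) auto
  then have 1: "?z * ?S \<le> 1 - ?S" by (simp add: exp_minus algebra_simps)
  have S1: "?S \<le> 1" using S(2) z by (meson exp_le_one_iff neg_le_0_iff_le order_trans)
  have "\<mu> j * g V e * ?S \<le> (4 * ?z + 4 / R) * ?S"
    using g_le_h[OF assms] S by (intro mult_right_mono) auto
  also have "\<dots> = 4 * (?z * ?S) + 4 / R * ?S" by (simp add: algebra_simps)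
  also have "4 / R * ?S \<le> 4 / R * 1" using S1 by (intro mult_left_mono) simp_all
  finally show ?thesis using 1 by simp
qed

end

section \<open>Expected number of sets selected in a phase\<close>

context random_phase begin

text \<open>The constant is \<open>1 + 8 + 8\<close>: the first term, the telescoping differences,
  and fewer than \<open>R\<close> error terms \<open>8 / R\<close>.\<close>

lemma sum_telescope_bound:
  fixes x p :: "nat \<Rightarrow> real"
  assumes "x 0 \<le> 1" "\<And>j. Suc j < R \<Longrightarrow> x (Suc j) \<le> 8 * (p j - p (Suc j)) + 8 / R"
    and "p 0 \<le> 1" "\<And>j. 0 \<le> p j"
  shows "(\<Sum>j<R. x j) \<le> 17"
proof -
  have "(\<Sum>j<Suc m. x j) \<le> 1 + 8 * (p 0 - p m) + 8 * m / R" if "m < R" for m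
    using that
  proof (induction m)
    case 0
    then show ?case using assms(1) by simp
  next
    case (Suc m)
    then show ?case using assms(2)[of m] by (simp add: field_simps)
  qed
  from this[of "R - 1"] have "(\<Sum>j<R. x j) \<le> 1 + 8 * (p 0 - p (R - 1)) + 8 * real (R - 1) / R"
    using R_pos by simp
  moreover have "8 * real (R - 1) / R \<le> 8" using R_pos by (simp add: field_simps)
  ultimately show ?thesis using assms(3) assms(4)[of "R - 1"] by simp
qed

text \<open>Level \<open>Suc j\<close> meets at most twice the load of level \<open>j\<close>, and
  only if \<open>e\<close> survives level \<open>j\<close>. By \<open>survival_load\<close> this is,
  up to \<open>8 / R\<close>, at most eight times the drop in the probability of being uncovered,
  and the drops telescope.\<close>

lemma total_load:
  assumes e: "e \<in> U"
  shows "(\<Sum>j<R. \<E> (\<lambda>y. of_bool (e \<in> lev y j) * (\<mu> j * g (lev y j) e))) \<le> 17"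
proof (rule sum_telescope_bound)
  let ?p = "\<lambda>j. \<E> (\<lambda>y. of_bool (e \<in> lev y j))"
  have "\<mu> 0 * g U e \<le> 1" using \<mu>_g_le[OF e order_refl, of 0] by simp
  then show "\<E> (\<lambda>y. of_bool (e \<in> lev y 0) * (\<mu> 0 * g (lev y 0) e)) \<le> 1"
    using e by simp
  show "?p 0 \<le> 1" by simp
  show "0 \<le> ?p j" for j by (intro expect_nonneg) simp
  fix j assume j: "Suc j < R"
  then have jR: "j < R" by simp
  let ?S = "\<lambda>y. survival (lev y j) j (set (st e))"
  have "\<E> (\<lambda>y. of_bool (e \<in> lev y (Suc j)) * (\<mu> (Suc j) * g (lev y (Suc j)) e)) \<le>
     \<E> (\<lambda>y. 2 * (\<mu> j * g (lev y j) e) * of_bool (e \<in> lev y (Suc j)))"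
  proof (rule expect_mono)
    fix y
    have "g (lev y (Suc j)) e \<le> g (lev y j) e"
      by (intro g_mono lev_antimono) simp
    then show "of_bool (e \<in> lev y (Suc j)) * (\<mu> (Suc j) * g (lev y (Suc j)) e) \<le>
        2 * (\<mu> j * g (lev y j) e) * of_bool (e \<in> lev y (Suc j))"
      using \<mu>_pos[of j] unfolding \<mu>_Suc by (simp add: mult.assoc del: lev.simps)
  qed
  also have "\<dots> = \<E> (\<lambda>y. 2 * (\<mu> j * g (lev y j) e) * of_bool (e \<in> lev y j) * ?S y)"
    by (rule expectation_lev_Suc[OF jR _ e]) (simp add: lev_override)
  also have "\<dots> \<le> \<E> (\<lambda>y. 8 * (of_bool (e \<in> lev y j) - of_bool (e \<in> lev y j) * ?S y) + 8 / R)"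
  proof (rule expect_mono)
    fix y
    show "2 * (\<mu> j * g (lev y j) e) * of_bool (e \<in> lev y j) * ?S y \<le>
        8 * (of_bool (e \<in> lev y j) - of_bool (e \<in> lev y j) * ?S y) + 8 / R"
      using survival_load[OF e lev_subset jR, of y j] by (cases "e \<in> lev y j") simp_all
  qed
  also have "\<dots> = 8 * (?p j - \<E> (\<lambda>y. of_bool (e \<in> lev y j) * ?S y)) + 8 / R"
    by simp
  also have "\<E> (\<lambda>y. of_bool (e \<in> lev y j) * ?S y) = ?p (Suc j)"
    using expectation_lev_Suc[OF jR _ e, of "\<lambda>_. 1"] by simp
  finally show "\<E> (\<lambda>y. of_bool (e \<in> lev y (Suc j)) * (\<mu> (Suc j) * g (lev y (Suc j)) e)) \<le>
     8 * (?p j - ?p (Suc j)) + 8 / R" .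
qed

lemma double_count:
  fixes f :: "nat \<Rightarrow> nat \<Rightarrow> real"
  assumes "V \<subseteq> U"
  shows "(\<Sum>T\<in>F. \<Sum>e\<in>set (el T) \<inter> V. f T e) = (\<Sum>e\<in>V. \<Sum>T\<in>set (st e). f T e)"
proof -
  have finV: "finite V" using assms finite_U by (rule finite_subset)
  have "(\<Sum>T\<in>F. \<Sum>e\<in>set (el T) \<inter> V. f T e) = (\<Sum>T\<in>F. \<Sum>e\<in>V. if e \<in> set (el T) then f T e else 0)"
    using finV by (subst sum.inter_filter[symmetric]) (auto intro!: sum.cong)
  also have "\<dots> = (\<Sum>e\<in>V. \<Sum>T\<in>F. if e \<in> set (el T) then f T e else 0)"
    by (rule sum.swap)
  also have "\<dots> = (\<Sum>e\<in>V. \<Sum>T\<in>set (st e). f T e)"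
  proof (rule sum.cong[OF refl])
    fix e assume "e \<in> V"
    then have "set (st e) = F \<inter> {T. e \<in> set (el T)}" using set_st assms by blast
    then show "(\<Sum>T\<in>F. if e \<in> set (el T) then f T e else 0) = (\<Sum>T\<in>set (st e). f T e)"
      using finite_F by (simp add: sum.If_cases)
  qed
  finally show ?thesis .
qed

lemma sum_\<rho>_g:
  assumes "V \<subseteq> U"
  shows "(\<Sum>T\<in>F. \<rho> V T ^ d * (\<Sum>e\<in>set (el T) \<inter> V. f e)) = (\<Sum>e\<in>V. g V e * f e)"
  using double_count[OF assms, of "\<lambda>T e. \<rho> V T ^ d * f e"]
  by (simp add: g_def sum_distrib_left sum_distrib_right)

text \<open>One of the factors \<open>\<rho>\<close> in the success probability is spread over the
  uncovered elements of the set, \<open>1 / 2 ^ k\<close> to each. This charges successes to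
  elements, for which \<open>total_load\<close> sums over the levels.\<close>

lemma expected_successes:
  "\<E> (\<lambda>y. \<Sum>j<R. \<Sum>T\<in>F. \<Sum>n<2 ^ j. of_bool (succeeds (lev y j) (y (j, T, n)) T)) \<le> 17 * card U / 2 ^ k"
proof -
  have one: "\<E> (\<lambda>y. of_bool (succeeds (lev y j) (y (j, T, n)) T)) = \<E> (\<lambda>y. \<rho> (lev y j) T ^ Suc d / 2 ^ a)"
    if "j < R" "T \<in> F" "n < 2 ^ j" for j T n
  proof -
    have "lev (y((j, T, n) := z)) j = lev y j" for y z
      by (rule lev_cong) auto
    then show ?thesis
      using that expectation_succeeds[OF that(2) lev_subset]
      by (subst resample_one[of "(j, T, n)"]) (auto simp: keys_def)
  qed
  have pt: "(\<Sum>T\<in>F. \<mu> j * \<rho> V T ^ Suc d) = (\<Sum>e\<in>V. \<mu> j * g V e) / 2 ^ k" if "V \<subseteq> U" for V j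
  proof -
    have "(\<Sum>T\<in>F. \<rho> V T ^ Suc d) = (\<Sum>T\<in>F. \<rho> V T ^ d * (\<Sum>e\<in>set (el T) \<inter> V. 1 / 2 ^ k))"
      by (simp add: \<rho>_def mult.commute)
    then show ?thesis
      unfolding sum_\<rho>_g[OF that] by (simp add: sum_distrib_left[symmetric] sum_divide_distrib[symmetric])
  qed
  have "\<E> (\<lambda>y. \<Sum>j<R. \<Sum>T\<in>F. \<Sum>n<2 ^ j. of_bool (succeeds (lev y j) (y (j, T, n)) T)) =
     (\<Sum>j<R. \<Sum>T\<in>F. \<Sum>n<2 ^ j. \<E> (\<lambda>y. of_bool (succeeds (lev y j) (y (j, T, n)) T)))"
    by (simp del: sum_of_bool_eq)
  also have "\<dots> = (\<Sum>j<R. \<Sum>T\<in>F. \<Sum>n<(2::nat) ^ j. \<E> (\<lambda>y. \<rho> (lev y j) T ^ Suc d / 2 ^ a))"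
    by (intro sum.cong refl one) auto
  also have "\<dots> = (\<Sum>j<R. \<Sum>T\<in>F. \<E> (\<lambda>y. \<mu> j * \<rho> (lev y j) T ^ Suc d))"
    by (simp add: \<mu>_def)
  also have "\<dots> = (\<Sum>j<R. \<E> (\<lambda>y. \<Sum>T\<in>F. \<mu> j * \<rho> (lev y j) T ^ Suc d))"
    by simp
  also have "\<dots> = (\<Sum>j<R. \<E> (\<lambda>y. (\<Sum>e\<in>lev y j. \<mu> j * g (lev y j) e) / 2 ^ k))"
    by (simp only: pt[OF lev_subset])
  also have "\<dots> = (\<Sum>j<R. \<E> (\<lambda>y. (\<Sum>e\<in>U. of_bool (e \<in> lev y j) * (\<mu> j * g (lev y j) e)) / 2 ^ k))"
  proof -
    have "(\<Sum>e\<in>lev y j. f e) = (\<Sum>e\<in>U. of_bool (e \<in> lev y j) * (f e :: real))" for y j f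
      using finite_U lev_subset[of y j]
      by (simp add: of_bool_def if_distrib[where f = "\<lambda>x. x * _"] sum.If_cases Int_absorb1 cong: if_cong)
    then show ?thesis by simp
  qed
  also have "\<dots> = (\<Sum>e\<in>U. \<Sum>j<R. \<E> (\<lambda>y. of_bool (e \<in> lev y j) * (\<mu> j * g (lev y j) e))) / 2 ^ k"
    by (simp add: sum_divide_distrib sum.swap[of _ U])
  also have "\<dots> \<le> (\<Sum>e\<in>U. 17) / 2 ^ k"
    by (intro divide_right_mono sum_mono total_load) auto
  finally show ?thesis by (simp add: mult.commute)
qed

text \<open>Only the trials of \<open>T\<close> itself in the last level are used. A set in need of
  cleanup had at least \<open>2 ^ (k - 1)\<close> uncovered elements before that level, and none of
  its trials there succeeded, as a success would have covered all of \<open>T\<close>.\<close>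

lemma expected_cleanup:
  assumes T: "T \<in> F"
  shows "\<E> (\<lambda>y. of_bool (2 ^ (k - 1) \<le> card (set (el T) \<inter> lev y R))) \<le> exp (- (2 ^ b))"
proof -
  define r where "r = R - 1"
  have R: "R = Suc r" "r < R" using R_pos by (simp_all add: r_def)
  let ?\<phi> = "\<lambda>y. of_bool (2 ^ (k - 1) \<le> card (set (el T) \<inter> lev y r)) :: real"
  have "\<E> (\<lambda>y. of_bool (2 ^ (k - 1) \<le> card (set (el T) \<inter> lev y R))) \<le>
    \<E> (\<lambda>y. ?\<phi> y * of_bool (\<forall>T\<in>{T}. \<forall>n<2 ^ r. \<not> succeeds (lev y r) (y (r, T, n)) T))"
  proof (rule expect_mono)
    fix y
    have "card (set (el T) \<inter> lev y R) = 0" if "n < 2 ^ r" "succeeds (lev y r) (y (r, T, n)) T" for n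
    proof -
      have "T \<in> set (st e)" if "e \<in> set (el T)" "e \<in> lev y r" for e
        using that T set_st lev_subset by blast
      then have "set (el T) \<inter> lev y R = {}" using that by (auto simp: R(1))
      then show ?thesis by simp
    qed
    moreover have "card (set (el T) \<inter> lev y R) \<le> card (set (el T) \<inter> lev y r)"
      using lev_antimono[of r R y] R by (intro card_mono) auto
    ultimately show "of_bool (2 ^ (k - 1) \<le> card (set (el T) \<inter> lev y R)) \<le>
      ?\<phi> y * of_bool (\<forall>T\<in>{T}. \<forall>n<2 ^ r. \<not> succeeds (lev y r) (y (r, T, n)) T)"
      by (auto simp: of_bool_def)
  qed
  also have "\<dots> = \<E> (\<lambda>y. ?\<phi> y * survival (lev y r) r {T})"
    by (rule expectation_no_success[OF R(2)]) (use T in \<open>auto simp: lev_override\<close>)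
  also have "\<dots> \<le> \<E> (\<lambda>y. exp (- (2 ^ b)))"
  proof (rule expect_mono)
    fix y
    show "?\<phi> y * survival (lev y r) r {T} \<le> exp (- (2 ^ b))"
    proof (cases "2 ^ (k - 1) \<le> card (set (el T) \<inter> lev y r)")
      case True
      then have "(2::real) ^ (k - 1) \<le> card (set (el T) \<inter> lev y r)"
        by (metis of_nat_le_iff of_nat_numeral of_nat_power)
      moreover have "(2::real) ^ k = 2 * 2 ^ (k - 1)"
        using k_pos by (cases k) simp_all
      ultimately have "1 / 2 \<le> \<rho> (lev y r) T"
        by (simp add: \<rho>_def field_simps)
      then have "(1 / 2) ^ Suc d \<le> \<rho> (lev y r) T ^ Suc d"
        by (intro power_mono) simp_all
      then have "\<mu> r * (1 / 2) ^ Suc d \<le> \<mu> r * \<rho> (lev y r) T ^ Suc d"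
        using \<mu>_pos[of r] by (intro mult_left_mono) simp_all
      moreover have "\<mu> r * (1 / 2) ^ Suc d = 2 ^ b"
        by (simp add: \<mu>_def r_def R_eq power_add power_divide)
      moreover have "survival (lev y r) r {T} \<le> exp (- \<mu> r * (\<Sum>T\<in>{T}. \<rho> (lev y r) T ^ Suc d))"
        using T lev_subset by (intro survival_le) auto
      ultimately have "survival (lev y r) r {T} \<le> exp (- (2 ^ b))"
        by (elim order_trans) simp
      then show ?thesis by simp
    qed simp
  qed
  also have "\<dots> = exp (- (2 ^ b))" by simp
  finally show ?thesis .
qed

text \<open>A load above \<open>lam\<close> forces a load above \<open>lam / 2\<close> one level
  earlier, because \<open>\<mu>\<close> doubles and \<open>g\<close> decreases. By
  \<open>g_le_h\<close>, surviving that earlier level has probability at most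
  \<open>exp (1 - lam / 8)\<close>. In level 0 the load is at most 1.\<close>

lemma heavy_load_rare:
  assumes e: "e \<in> U" and i: "i < R" and lam: "1 \<le> lam"
  shows "\<E> (\<lambda>y. of_bool (e \<in> lev y i \<and> lam < \<mu> i * g (lev y i) e)) \<le> exp (1 - lam / 8)"
proof (cases i)
  case 0
  have "\<mu> 0 * g U e \<le> lam" using \<mu>_g_le[OF e order_refl, of 0] lam by simp
  then show ?thesis using 0 by simp
next
  case (Suc j)
  then have j: "j < R" using i by simp
  let ?\<phi> = "\<lambda>y. of_bool (lam / 2 < \<mu> j * g (lev y j) e) :: real"
  have "\<E> (\<lambda>y. of_bool (e \<in> lev y i \<and> lam < \<mu> i * g (lev y i) e)) \<le>
      \<E> (\<lambda>y. ?\<phi> y * of_bool (e \<in> lev y (Suc j)))"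
  proof (rule expect_mono)
    fix y
    have "\<mu> j * g (lev y (Suc j)) e \<le> \<mu> j * g (lev y j) e"
      using \<mu>_pos[of j] by (intro mult_left_mono g_mono lev_antimono) simp_all
    then show "of_bool (e \<in> lev y i \<and> lam < \<mu> i * g (lev y i) e) \<le> ?\<phi> y * of_bool (e \<in> lev y (Suc j))"
      unfolding Suc \<mu>_Suc by (simp add: of_bool_def del: lev.simps)
  qed
  also have "\<dots> = \<E> (\<lambda>y. ?\<phi> y * of_bool (e \<in> lev y j) * survival (lev y j) j (set (st e)))"
    by (rule expectation_lev_Suc[OF j _ e]) (simp add: lev_override)
  also have "\<dots> \<le> \<E> (\<lambda>y. exp (1 - lam / 8))"
  proof (rule expect_mono)
    fix y
    show "?\<phi> y * of_bool (e \<in> lev y j) * survival (lev y j) j (set (st e)) \<le> exp (1 - lam / 8)"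
    proof (cases "lam / 2 < \<mu> j * g (lev y j) e")
      case True
      have "1 / real R \<le> 1" using R_pos by simp
      then have "lam / 8 - 1 \<le> \<mu> j * h (lev y j) e"
        using True g_le_h[OF e lev_subset j, of y j] by (simp add: field_simps)
      then have "exp (- (\<mu> j * h (lev y j) e)) \<le> exp (1 - lam / 8)" by simp
      then have "survival (lev y j) j (set (st e)) \<le> exp (1 - lam / 8)"
        using survival_set_st[OF e lev_subset[of y j], of j] by linarith
      then show ?thesis by (simp add: of_bool_def)
    qed simp
  qed
  also have "\<dots> = exp (1 - lam / 8)" by simp
  finally show ?thesis .
qed

end

section \<open>The queries of one phase\<close>

text \<open>Here \<open>w T\<close> stands for the queries, spent on earlier phases, that list the
  residual elements of \<open>T\<close>. By \<open>lam_large\<close>, a load above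
  \<open>lam\<close> is so improbable that it outweighs even the worst-case costs.\<close>

locale random_phase_cost = random_phase el st U F t a d b k R
  for el st U F t a d b k R +
  fixes w :: "nat \<Rightarrow> nat" and M lam :: real
  assumes w_le: "T \<in> F \<Longrightarrow> w T \<le> M"
    and card_U_le: "card U \<le> (\<Sum>T\<in>F. w T)"
    and lam_ge_1: "1 \<le> lam"
    and lam_large: "2 ^ R * ((1 + M) * (1 + Suc d * t * 2 ^ R) ^ R) * exp (1 - lam / 8) \<le> 1"
    and M_nonneg: "0 \<le> M"
begin

definition A :: real where
  "A = (\<Sum>T\<in>F. w T)"

definition tc :: "phase_outcome \<Rightarrow> nat \<Rightarrow> nat \<Rightarrow> nat \<Rightarrow> real" where
  "tc y j T n = trial_cost w (block_cost t w y j) (y (j, T, n)) T"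

text \<open>The contribution of \<open>e\<close> to a block test in level \<open>i\<close>, provided
  that the test gets that far.\<close>

definition ec :: "phase_outcome \<Rightarrow> nat \<Rightarrow> nat \<Rightarrow> real" where
  "ec y i e = t + (\<Sum>T\<in>set (st e). \<Sum>n<2 ^ i. tc y i T n)"

definition \<Phi> :: "nat \<Rightarrow> real" where
  "\<Phi> j = \<E> (\<lambda>y. \<Sum>T\<in>F. \<Sum>n<2 ^ j. tc y j T n)"

lemma A_nonneg: "0 \<le> A"
  by (simp add: A_def sum_nonneg)

lemma tc_nonneg: "0 \<le> tc y j T n"
  by (simp add: tc_def)

lemma ec_nonneg: "0 \<le> ec y i e"
  by (simp add: ec_def tc_nonneg sum_nonneg)

lemma block_cost_eq:
  "real (block_cost t w y j es) = (\<Sum>i<j. if set es \<subseteq> lev y i then \<Sum>e\<leftarrow>es. ec y i e else 0)"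
proof (induction j)
  case (Suc j)
  have "real (\<Sum>e\<leftarrow>es. t + (\<Sum>T\<in>set (st e). \<Sum>n<2 ^ j. trial_cost w (block_cost t w y j) (y (j, T, n)) T)) =
      (\<Sum>e\<leftarrow>es. ec y j e)"
    by (induction es) (simp_all add: ec_def tc_def)
  then show ?case using Suc by simp
qed simp

lemma expectation_weight:
  fixes v :: real
  shows "measure_pmf.expectation D (\<lambda>z. case z of None \<Rightarrow> 0 | Some _ \<Rightarrow> v) = v / 2 ^ a"
  by (subst expectation_trial_pmf) (simp_all add: card_index_lists)

text \<open>The block test behind a trial of level \<open>j\<close> depends only on lower levels, so
  the trial may be drawn afresh. The test enters level \<open>i\<close> exactly when all picks are
  still uncovered there, and \<open>expectation_pick\<close> with \<open>f = ec y i\<close> gives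
  the corresponding summand.\<close>

lemma expectation_tc:
  assumes "j < R" "T \<in> F" "n < 2 ^ j"
  shows "\<E> (\<lambda>y. tc y j T n) = w T / 2 ^ a + (\<Sum>i<j. Suc d / (2 ^ a * 2 ^ k) *
     \<E> (\<lambda>y. \<rho> (lev y i) T ^ d * (\<Sum>e\<in>set (el T) \<inter> lev y i. ec y i e)))"
proof -
  let ?f = "\<lambda>y i z. case z of None \<Rightarrow> 0 | Some is \<Rightarrow>
     if in_range is T \<and> set (pick is T) \<subseteq> lev y i then \<Sum>e\<leftarrow>pick is T. ec y i e else (0::real)"
  have cost: "block_cost t w (y((j, T, n) := z)) j = block_cost t w y j" for y z
    by (rule block_cost_cong) auto
  have tc: "tc (y((j, T, n) := z)) j T n = (case z of None \<Rightarrow> 0 | Some _ \<Rightarrow> real (w T)) + (\<Sum>i<j. ?f y i z)"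
    for y z
  proof (cases z)
    case (Some "is")
    then show ?thesis
      by (cases "in_range is T") (simp_all add: tc_def trial_cost_def block_cost_eq cost)
  qed (simp add: tc_def trial_cost_def)
  have int: "integrable (measure_pmf D) (f :: _ \<Rightarrow> real)" for f
    by (rule integrable_measure_pmf_finite) simp
  have "\<E> (\<lambda>y. tc y j T n) = \<E> (\<lambda>y. measure_pmf.expectation D (\<lambda>z. tc (y((j, T, n) := z)) j T n))"
    by (rule resample_one) (use assms in \<open>simp add: keys_def\<close>)
  also have "\<dots> = \<E> (\<lambda>y. w T / 2 ^ a + (\<Sum>i<j. Suc d / (2 ^ a * 2 ^ k) *
     (\<rho> (lev y i) T ^ d * (\<Sum>e\<in>set (el T) \<inter> lev y i. ec y i e))))"
  proof -
    have "measure_pmf.expectation D (\<lambda>z. tc (y((j, T, n) := z)) j T n) =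
      measure_pmf.expectation D (\<lambda>z. case z of None \<Rightarrow> 0 | Some _ \<Rightarrow> real (w T)) +
      (\<Sum>i<j. measure_pmf.expectation D (?f y i))" for y
      unfolding tc by (simp only: Bochner_Integration.integral_add Bochner_Integration.integral_sum int)
    then show ?thesis
      unfolding expectation_weight expectation_pick[OF assms(2) lev_subset] by (simp only:)
  qed
  also have "\<dots> = w T / 2 ^ a + (\<Sum>i<j. Suc d / (2 ^ a * 2 ^ k) *
     \<E> (\<lambda>y. \<rho> (lev y i) T ^ d * (\<Sum>e\<in>set (el T) \<inter> lev y i. ec y i e)))"
    by (simp only: Bochner_Integration.integral_add Bochner_Integration.integral_sum integrable_P
        Bochner_Integration.integral_mult_right_zero lebesgue_integral_const measure_pmf.prob_space scaleR_one mult_1)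
  finally show ?thesis .
qed

text \<open>Double counting turns the sums over sets into sums over elements: an element uncovered
  before level \<open>i\<close> is replayed by level \<open>j\<close> with an expected multiplicity
  proportional to \<open>g\<close>.\<close>

lemma \<Phi>_eq:
  assumes j: "j < R"
  shows "\<Phi> j = \<mu> j * A + (\<Sum>i<j. \<mu> j * (Suc d / 2 ^ k) * \<E> (\<lambda>y. \<Sum>e\<in>lev y i. g (lev y i) e * ec y i e))"
proof -
  let ?r = "\<lambda>i T. \<E> (\<lambda>y. \<rho> (lev y i) T ^ d * (\<Sum>e\<in>set (el T) \<inter> lev y i. ec y i e))"
  have "\<Phi> j = (\<Sum>T\<in>F. \<Sum>n<2 ^ j. \<E> (\<lambda>y. tc y j T n))"
    by (simp add: \<Phi>_def)
  also have "\<dots> = (\<Sum>T\<in>F. \<Sum>n<(2::nat) ^ j. w T / 2 ^ a + (\<Sum>i<j. Suc d / (2 ^ a * 2 ^ k) * ?r i T))"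
    by (intro sum.cong refl expectation_tc j) auto
  also have "\<dots> = (\<Sum>T\<in>F. \<mu> j * w T + (\<Sum>i<j. \<mu> j * (Suc d / 2 ^ k) * ?r i T))"
  proof -
    have "(\<Sum>n<(2::nat) ^ j. w T / 2 ^ a + (\<Sum>i<j. Suc d / (2 ^ a * 2 ^ k) * ?r i T)) =
        2 ^ j * (w T / 2 ^ a) + (\<Sum>i<j. 2 ^ j * (Suc d / (2 ^ a * 2 ^ k) * ?r i T))" for T
      by (simp add: distrib_left sum_distrib_left del: of_nat_Suc)
    moreover have "2 ^ j * (Suc d / (2 ^ a * 2 ^ k) * x) = \<mu> j * (Suc d / 2 ^ k) * x" for x
      by (simp add: \<mu>_def)
    ultimately show ?thesis by (simp only:) (simp add: \<mu>_def)
  qed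
  also have "\<dots> = \<mu> j * A + (\<Sum>T\<in>F. \<Sum>i<j. \<mu> j * (Suc d / 2 ^ k) * ?r i T)"
    by (simp only: sum.distrib A_def sum_distrib_left of_nat_sum)
  also have "(\<Sum>T\<in>F. \<Sum>i<j. \<mu> j * (Suc d / 2 ^ k) * ?r i T) =
      (\<Sum>i<j. \<Sum>T\<in>F. \<mu> j * (Suc d / 2 ^ k) * ?r i T)"
    by (rule sum.swap)
  also have "\<dots> = (\<Sum>i<j. \<mu> j * (Suc d / 2 ^ k) * (\<Sum>T\<in>F. ?r i T))"
    by (simp only: sum_distrib_left)
  also have "\<dots> = (\<Sum>i<j. \<mu> j * (Suc d / 2 ^ k) * \<E> (\<lambda>y. \<Sum>e\<in>lev y i. g (lev y i) e * ec y i e))"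
  proof (intro sum.cong refl arg_cong2[of _ _ _ _ "(*)"])
    fix i
    have "\<E> (\<lambda>y. \<Sum>T\<in>F. \<rho> (lev y i) T ^ d * (\<Sum>e\<in>set (el T) \<inter> lev y i. ec y i e)) = (\<Sum>T\<in>F. ?r i T)"
      by (rule Bochner_Integration.integral_sum) simp
    then show "(\<Sum>T\<in>F. ?r i T) = \<E> (\<lambda>y. \<Sum>e\<in>lev y i. g (lev y i) e * ec y i e)"
      by (simp only: sum_\<rho>_g[OF lev_subset])
  qed
  finally show ?thesis .
qed

section \<open>Worst-case cost of a block test\<close>

definition H :: real where
  "H = 1 + Suc d * t * 2 ^ R"

lemma H_ge_1: "1 \<le> H"
  by (simp add: H_def)

lemma length_trial:
  assumes "y \<in> set_pmf P" "y \<kappa> = Some is"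
  shows "length is = Suc d"
proof -
  have "(\<kappa> \<in> keys \<longrightarrow> y \<kappa> \<in> set_pmf D) \<and> (\<kappa> \<notin> keys \<longrightarrow> y \<kappa> = None)"
    using assms(1) set_Pi_pmf[OF finite_keys, of None "\<lambda>_. D"] unfolding PiE_dflt_def by (cases \<kappa>) auto
  then have "Some is \<in> set_pmf D"
    using assms(2) by (cases "\<kappa> \<in> keys") auto
  then have "is \<in> index_lists k (Suc d)"
    by (auto simp: trial_pmf_def split: if_splits)
  then show ?thesis
    by (simp add: index_lists_def)
qed

text \<open>The extra \<open>1 + M\<close> in the hypothesis absorbs both the cost
  \<open>w T\<close> of a residual list and the additive \<open>t\<close>. The induction in
  \<open>block_cost_le\<close> thereby becomes a plain multiplication by \<open>H\<close>.\<close>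

lemma block_step:
  fixes B :: real
  assumes B: "\<And>es. set es \<subseteq> U \<Longrightarrow> length es \<le> Suc d \<Longrightarrow> real (block_cost t w y j es) + 1 + M \<le> B"
    and y: "y \<in> set_pmf P" and j: "j < R" and e: "e \<in> U"
  shows "ec y j e \<le> t * 2 ^ R * B"
proof -
  have B1: "1 + M \<le> B" using B[of "[]"] by simp
  have tc: "tc y j T n \<le> B - 1" if "T \<in> F" for T n
  proof (cases "y (j, T, n)")
    case None
    then show ?thesis using B1 M_nonneg by (simp add: tc_def trial_cost_def)
  next
    case (Some "is")
    have "set (pick is T) \<subseteq> U" if "in_range is T"
      using that by (force simp: pick_def in_range_def res_def dest!: nth_mem)
    moreover have "length (pick is T) \<le> Suc d"
      using length_trial[OF y Some] by (simp add: pick_def)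
    ultimately show ?thesis
      using B[of "pick is T"] B1 w_le[OF that] by (auto simp: tc_def trial_cost_def Some)
  qed
  have "ec y j e \<le> t + (\<Sum>T\<in>set (st e). \<Sum>n<(2::nat) ^ j. B - 1)"
    unfolding ec_def using set_st[OF e] by (intro add_left_mono sum_mono tc) auto
  also have "\<dots> = t + card (set (st e)) * (2 ^ j * (B - 1))" by simp
  also have "\<dots> \<le> t + t * (2 ^ R * (B - 1))"
    using card_st[OF e] B1 M_nonneg j
    by (intro add_left_mono mult_mono power_increasing) auto
  also have "\<dots> \<le> t * 2 ^ R * B"
  proof -
    have "real t * 1 \<le> real t * 2 ^ R" by (intro mult_left_mono) simp_all
    then show ?thesis by (simp add: algebra_simps)
  qed
  finally show ?thesis .
qed

lemma block_cost_le:
  assumes y: "y \<in> set_pmf P"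
  shows "j \<le> R \<Longrightarrow> set es \<subseteq> U \<Longrightarrow> length es \<le> Suc d \<Longrightarrow>
    real (block_cost t w y j es) + 1 + M \<le> (1 + M) * H ^ j"
proof (induction j arbitrary: es)
  case 0
  then show ?case by simp
next
  case (Suc j)
  let ?B = "(1 + M) * H ^ j"
  have B0: "0 \<le> ?B" using M_nonneg H_ge_1 by simp
  have ec: "ec y j e \<le> t * 2 ^ R * ?B" if "e \<in> U" for e
    using Suc.prems(1) that by (intro block_step[OF Suc.IH y]) auto
  have "real (block_cost t w y (Suc j) es) + 1 + M \<le>
      real (block_cost t w y j es) + 1 + M + (\<Sum>e\<leftarrow>es. ec y j e)"
    using sum_list_nonneg[of "map (ec y j) es"] ec_nonneg
    by (auto simp: block_cost_eq simp del: block_cost.simps)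
  also have "(\<Sum>e\<leftarrow>es. ec y j e) \<le> (\<Sum>e\<leftarrow>es. t * 2 ^ R * ?B)"
    using Suc.prems(2) by (intro sum_list_mono ec) auto
  also have "\<dots> = length es * (t * 2 ^ R * ?B)" by (simp add: sum_list_triv)
  also have "\<dots> \<le> Suc d * (t * 2 ^ R * ?B)"
    using Suc.prems(3) B0 by (intro mult_right_mono of_nat_mono) auto
  also have "real (block_cost t w y j es) + 1 + M \<le> ?B"
    using Suc by simp
  finally show ?case by (simp add: H_def algebra_simps)
qed

lemma ec_le:
  assumes "y \<in> set_pmf P" "i < R" "e \<in> U"
  shows "ec y i e \<le> (1 + M) * H ^ R"
proof -
  have "ec y i e \<le> t * 2 ^ R * ((1 + M) * H ^ i)"
    using assms(2) by (intro block_step[OF block_cost_le[OF assms(1)] assms]) auto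
  also have "\<dots> \<le> H * ((1 + M) * H ^ i)"
  proof (rule mult_right_mono)
    have "real t * 2 ^ R * 1 \<le> real t * 2 ^ R * Suc d" by (intro mult_left_mono) simp_all
    then show "real (t * 2 ^ R) \<le> H" by (simp add: H_def algebra_simps)
  qed (use M_nonneg H_ge_1 in simp)
  also have "\<dots> = (1 + M) * H ^ Suc i" by simp
  also have "\<dots> \<le> (1 + M) * H ^ R"
    using assms(2) M_nonneg H_ge_1 by (intro mult_left_mono power_increasing) auto
  finally show ?thesis .
qed

text \<open>The trials of a set are replayed for each of its uncovered elements, of which there are
  at most \<open>2 ^ k\<close>. The additive \<open>t\<close> per element is bounded through
  \<open>card_U_le\<close>.\<close>

lemma sum_ec_le:
  "\<E> (\<lambda>y. \<Sum>e\<in>lev y i. ec y i e) \<le> t * A + 2 ^ k * \<Phi> i"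
proof -
  have "\<E> (\<lambda>y. \<Sum>e\<in>lev y i. ec y i e) \<le> \<E> (\<lambda>y. t * A + 2 ^ k * (\<Sum>T\<in>F. \<Sum>n<2 ^ i. tc y i T n))"
  proof (rule expect_mono)
    fix y
    have "(\<Sum>e\<in>lev y i. ec y i e) =
        real t * real (card (lev y i)) + (\<Sum>T\<in>F. \<Sum>e\<in>set (el T) \<inter> lev y i. \<Sum>n<2 ^ i. tc y i T n)"
      by (simp only: ec_def sum.distrib double_count[OF lev_subset]) simp
    also have "\<dots> = real t * real (card (lev y i)) + (\<Sum>T\<in>F. card (set (el T) \<inter> lev y i) * (\<Sum>n<2 ^ i. tc y i T n))"
      by simp
    also have "\<dots> \<le> t * A + (\<Sum>T\<in>F. 2 ^ k * (\<Sum>n<2 ^ i. tc y i T n))"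
    proof (intro add_mono mult_left_mono sum_mono mult_right_mono)
      have "card (lev y i) \<le> card U" by (intro card_mono finite_U lev_subset)
      then show "real (card (lev y i)) \<le> A"
        using card_U_le by (metis A_def of_nat_le_iff of_nat_sum order_trans)
      fix T assume "T \<in> F"
      then have "card (set (el T) \<inter> lev y i) \<le> 2 ^ k"
        using card_el_U[of T] card_mono[of "set (el T) \<inter> U" "set (el T) \<inter> lev y i"] lev_subset[of y i]
        by (meson Int_mono finite_Int finite_set order_refl order_trans)
      then show "real (card (set (el T) \<inter> lev y i)) \<le> 2 ^ k"
        by (metis of_nat_le_iff of_nat_numeral of_nat_power)
    qed (auto intro!: sum_nonneg tc_nonneg)
    finally show "(\<Sum>e\<in>lev y i. ec y i e) \<le> t * A + 2 ^ k * (\<Sum>T\<in>F. \<Sum>n<2 ^ i. tc y i T n)"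
      by (simp add: sum_distrib_left)
  qed
  also have "\<dots> = t * A + 2 ^ k * \<Phi> i"
    unfolding \<Phi>_def by (subst Bochner_Integration.integral_add) simp_all
  finally show ?thesis .
qed

text \<open>Elements of load at most \<open>lam\<close> lose the factor \<open>lam\<close>. The
  others are so rare by \<open>heavy_load_rare\<close> that the crude bounds \<open>2 ^ R\<close> on
  their load and \<open>ec_le\<close> on their cost add at most 1 per element in
  expectation.\<close>

lemma sum_g_ec_le:
  assumes i: "i < R"
  shows "\<mu> i * \<E> (\<lambda>y. \<Sum>e\<in>lev y i. g (lev y i) e * ec y i e) \<le> lam * (t * A + 2 ^ k * \<Phi> i) + A"
proof -
  let ?W = "2 ^ R * ((1 + M) * H ^ R)"
  let ?bad = "\<lambda>y e. of_bool (e \<in> lev y i \<and> lam < \<mu> i * g (lev y i) e) :: real"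
  have W0: "0 \<le> ?W" using M_nonneg H_ge_1 by simp
  have "\<mu> i * \<E> (\<lambda>y. \<Sum>e\<in>lev y i. g (lev y i) e * ec y i e) =
      \<E> (\<lambda>y. \<Sum>e\<in>lev y i. \<mu> i * g (lev y i) e * ec y i e)"
    by (simp add: sum_distrib_left mult.assoc flip: Bochner_Integration.integral_mult_right_zero)
  also have "\<dots> \<le> \<E> (\<lambda>y. lam * (\<Sum>e\<in>lev y i. ec y i e) + (\<Sum>e\<in>U. ?bad y e * ?W))"
  proof (rule expect_mono)
    fix y assume y: "y \<in> set_pmf P"
    have "(\<Sum>e\<in>lev y i. \<mu> i * g (lev y i) e * ec y i e) \<le> (\<Sum>e\<in>lev y i. lam * ec y i e + ?bad y e * ?W)"
    proof (rule sum_mono)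
      fix e assume e: "e \<in> lev y i"
      then have eU: "e \<in> U" using lev_subset by blast
      show "\<mu> i * g (lev y i) e * ec y i e \<le> lam * ec y i e + ?bad y e * ?W"
      proof (cases "lam < \<mu> i * g (lev y i) e")
        case True
        have "\<mu> i * g (lev y i) e \<le> 2 ^ R"
          using \<mu>_g_le[OF eU lev_subset[of y i], of i] power_increasing[of i R "2::real"] i
          by linarith
        then have "\<mu> i * g (lev y i) e * ec y i e \<le> ?W"
          using ec_le[OF y i eU] ec_nonneg by (intro mult_mono) auto
        moreover have "0 \<le> lam * ec y i e" using lam_ge_1 ec_nonneg by simp
        ultimately show ?thesis using e True by simp
      next
        case False
        then show ?thesis using ec_nonneg[of y i e] by (simp add: mult_right_mono)
      qed
    qed
    also have "\<dots> = lam * (\<Sum>e\<in>lev y i. ec y i e) + (\<Sum>e\<in>lev y i. ?bad y e * ?W)"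
      by (simp add: sum.distrib sum_distrib_left)
    also have "(\<Sum>e\<in>lev y i. ?bad y e * ?W) \<le> (\<Sum>e\<in>U. ?bad y e * ?W)"
      by (rule sum_mono2[OF finite_U lev_subset]) (use W0 in simp)
    finally show "(\<Sum>e\<in>lev y i. \<mu> i * g (lev y i) e * ec y i e) \<le>
      lam * (\<Sum>e\<in>lev y i. ec y i e) + (\<Sum>e\<in>U. ?bad y e * ?W)" by simp
  qed
  also have "\<dots> = lam * \<E> (\<lambda>y. \<Sum>e\<in>lev y i. ec y i e) + (\<Sum>e\<in>U. \<E> (\<lambda>y. ?bad y e) * ?W)"
    by (simp only: Bochner_Integration.integral_add Bochner_Integration.integral_sum integrable_P
        Bochner_Integration.integral_mult_right_zero Bochner_Integration.integral_mult_left_zero)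
  also have "\<dots> \<le> lam * (t * A + 2 ^ k * \<Phi> i) + (\<Sum>e\<in>U. exp (1 - lam / 8) * ?W)"
    using lam_ge_1 W0 i
    by (intro add_mono mult_left_mono sum_ec_le sum_mono mult_right_mono heavy_load_rare) auto
  also have "(\<Sum>e\<in>U. exp (1 - lam / 8) * ?W) \<le> (\<Sum>e\<in>U. 1)"
    using lam_large by (intro sum_mono) (simp add: H_def mult_ac)
  also have "\<dots> \<le> A"
    using card_U_le by (simp add: A_def flip: of_nat_sum)
  finally show ?thesis by simp
qed

text \<open>Dividing by \<open>2 ^ j\<close> removes the growth in the number of trials, since
  \<open>\<mu> j = 2 ^ j / 2 ^ i * \<mu> i\<close> and the load is measured in level
  \<open>i\<close>. The \<open>2 ^ k\<close> from \<open>sum_ec_le\<close> cancels against the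
  \<open>1 / 2 ^ k\<close> of a pick.\<close>

lemma \<Phi>_rec:
  assumes j: "j < R"
  shows "\<Phi> j / 2 ^ j \<le> A + (\<Sum>i<j. Suc d * lam * ((1 + t) * A + \<Phi> i / 2 ^ i))"
proof -
  have "\<mu> j * (Suc d / 2 ^ k) * \<E> (\<lambda>y. \<Sum>e\<in>lev y i. g (lev y i) e * ec y i e) \<le>
      2 ^ j * (Suc d * lam * ((1 + t) * A + \<Phi> i / 2 ^ i))" if i: "i < j" for i
  proof -
    let ?x = "\<E> (\<lambda>y. \<Sum>e\<in>lev y i. g (lev y i) e * ec y i e)"
    have mu: "\<mu> j = 2 ^ j / 2 ^ i * \<mu> i" by (simp add: \<mu>_def)
    have k1: "(1::real) \<le> 2 ^ k" by simp
    have "\<mu> i * ?x \<le> lam * (t * A + 2 ^ k * \<Phi> i) + A"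
      using i j by (intro sum_g_ec_le) simp
    also have "\<dots> \<le> 2 ^ k * (lam * ((1 + t) * A + \<Phi> i))"
    proof -
      have "A \<le> lam * A" using lam_ge_1 A_nonneg mult_right_mono[of 1 lam A] by simp
      then have "lam * (t * A) + A \<le> 1 * (lam * ((1 + t) * A))" by (simp add: algebra_simps)
      also have "\<dots> \<le> 2 ^ k * (lam * ((1 + t) * A))"
        using k1 lam_ge_1 A_nonneg by (intro mult_right_mono) auto
      finally show ?thesis by (simp add: algebra_simps)
    qed
    finally have "\<mu> i * ?x / 2 ^ k \<le> lam * ((1 + t) * A + \<Phi> i)"
      by (simp add: field_simps)
    then have "2 ^ j * (Suc d / 2 ^ i * (\<mu> i * ?x / 2 ^ k)) \<le> 2 ^ j * (Suc d / 2 ^ i * (lam * ((1 + t) * A + \<Phi> i)))"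
      by (intro mult_left_mono) simp_all
    also have "Suc d / 2 ^ i * (lam * ((1 + t) * A + \<Phi> i)) = Suc d * lam * ((1 + t) * A / 2 ^ i + \<Phi> i / 2 ^ i)"
      by (simp add: field_simps del: of_nat_Suc)
    also have "2 ^ j * \<dots> \<le> 2 ^ j * (Suc d * lam * ((1 + t) * A + \<Phi> i / 2 ^ i))"
    proof -
      have "(1 + t) * A / 2 ^ i \<le> (1 + t) * A / 1"
        using A_nonneg by (intro divide_left_mono) simp_all
      then show ?thesis
        using lam_ge_1 by (intro mult_left_mono add_right_mono) simp_all
    qed
    finally show ?thesis unfolding mu by (simp add: mult_ac del: of_nat_Suc)
  qed
  then have "\<Phi> j \<le> \<mu> j * A + (\<Sum>i<j. 2 ^ j * (Suc d * lam * ((1 + t) * A + \<Phi> i / 2 ^ i)))"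
    unfolding \<Phi>_eq[OF j] by (intro add_left_mono sum_mono) simp
  also have "\<mu> j * A \<le> 2 ^ j * A"
    using A_nonneg unfolding \<mu>_def by (intro mult_right_mono) (simp_all add: field_simps)
  finally have "\<Phi> j \<le> 2 ^ j * (A + (\<Sum>i<j. Suc d * lam * ((1 + t) * A + \<Phi> i / 2 ^ i)))"
    by (simp add: distrib_left sum_distrib_left)
  then show ?thesis by (simp add: field_simps)
qed

text \<open>After adding \<open>(1 + t) * A\<close>, the recurrence is that of a geometric sum with
  ratio \<open>1 + Suc d * lam\<close>. This ratio to the power \<open>R\<close> is the
  polylogarithmic power in the query bound.\<close>

lemma \<Phi>_bound:
  assumes "j < R"
  shows "\<Phi> j \<le> 2 ^ R * (2 + t) * (1 + Suc d * lam) ^ R * A"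
proof -
  define q where "q = 1 + Suc d * lam"
  have q: "1 \<le> q" using lam_ge_1 by (simp add: q_def)
  have "\<Phi> j / 2 ^ j + (1 + t) * A \<le> (2 + t) * A * q ^ j" if "j < R" for j
    using that
  proof (induction j rule: less_induct)
    case (less j)
    have "\<Phi> j / 2 ^ j + (1 + t) * A \<le> (2 + t) * A + (\<Sum>i<j. (q - 1) * ((1 + t) * A + \<Phi> i / 2 ^ i))"
      using \<Phi>_rec[OF less.prems] by (simp add: q_def algebra_simps)
    also have "\<dots> \<le> (2 + t) * A + (\<Sum>i<j. (q - 1) * ((2 + t) * A * q ^ i))"
      using less q by (intro add_left_mono sum_mono mult_left_mono) (auto simp: add.commute)
    also have "\<dots> = (2 + t) * A * (1 + (q - 1) * (\<Sum>i<j. q ^ i))"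
      by (simp add: sum_distrib_left[symmetric] distrib_left mult.left_commute mult.assoc)
    also have "(q - 1) * (\<Sum>i<j. q ^ i) = q ^ j - 1"
      by (rule power_diff_1_eq[symmetric])
    finally show ?case by simp
  qed
  moreover have "0 \<le> (1 + t) * A" using A_nonneg by simp
  ultimately have "\<Phi> j / 2 ^ j \<le> (2 + t) * A * q ^ j"
    using assms by fastforce
  then have "\<Phi> j \<le> 2 ^ j * ((2 + t) * A * q ^ j)"
    by (simp add: field_simps)
  also have "\<dots> \<le> 2 ^ R * ((2 + t) * A * q ^ R)"
    using assms q A_nonneg by (intro mult_mono power_increasing mult_left_mono) auto
  finally show ?thesis by (simp add: q_def algebra_simps)
qed

lemma expected_block_cost:
  "\<E> (\<lambda>y. \<Sum>e\<in>U. real (block_cost t w y R [e])) \<le>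
     R * (t + 2 ^ k * (2 ^ R * (2 + t) * (1 + Suc d * lam) ^ R)) * A"
proof -
  have "(\<Sum>e\<in>U. real (block_cost t w y R [e])) = (\<Sum>i<R. \<Sum>e\<in>lev y i. ec y i e)" for y
  proof -
    have "(\<Sum>e\<in>U. if e \<in> lev y i then ec y i e else 0) = (\<Sum>e\<in>lev y i. ec y i e)" for i
      using finite_U lev_subset[of y i] by (simp add: sum.If_cases Int_absorb1)
    moreover have "(\<Sum>e\<in>U. real (block_cost t w y R [e])) =
        (\<Sum>e\<in>U. \<Sum>i<R. if e \<in> lev y i then ec y i e else 0)"
      by (simp add: block_cost_eq cong: if_cong)
    ultimately show ?thesis
      by (simp only: sum.swap[of _ "{..<R}" U])
  qed
  then have "\<E> (\<lambda>y. \<Sum>e\<in>U. real (block_cost t w y R [e])) = (\<Sum>i<R. \<E> (\<lambda>y. \<Sum>e\<in>lev y i. ec y i e))"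
    by (simp only: Bochner_Integration.integral_sum integrable_P)
  also have "\<dots> \<le> (\<Sum>i<R. t * A + 2 ^ k * (2 ^ R * (2 + t) * (1 + Suc d * lam) ^ R * A))"
  proof (rule sum_mono)
    fix i assume "i \<in> {..<R}"
    then show "\<E> (\<lambda>y. \<Sum>e\<in>lev y i. ec y i e) \<le> t * A + 2 ^ k * (2 ^ R * (2 + t) * (1 + Suc d * lam) ^ R * A)"
      by (intro order_trans[OF sum_ec_le] add_left_mono mult_left_mono \<Phi>_bound) simp_all
  qed
  also have "\<dots> = R * (t + 2 ^ k * (2 ^ R * (2 + t) * (1 + Suc d * lam) ^ R)) * A"
    by (simp add: algebra_simps)
  finally show ?thesis .
qed

end

section \<open>From the random tape to independent trials\<close>

abbreviation bits_pmf :: "nat set \<Rightarrow> tape pmf" where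
  "bits_pmf B \<equiv> Pi_pmf B False (\<lambda>_. bernoulli_pmf (1 / 2))"

lemma set_bits_pmf: "finite B \<Longrightarrow> set_pmf (bits_pmf B) = {h. \<forall>x. x \<notin> B \<longrightarrow> \<not> h x}"
  by (auto simp: set_Pi_pmf PiE_dflt_def)

lemma finite_set_bits_pmf: "finite B \<Longrightarrow> finite (set_pmf (bits_pmf B))"
  by (intro finite_set_Pi_pmf) simp_all

lemma pmf_bits_pmf:
  assumes "finite B" "h \<in> set_pmf (bits_pmf B)"
  shows "pmf (bits_pmf B) h = (1 / 2) ^ card B"
proof -
  have "pmf (bernoulli_pmf (1 / 2)) x = 1 / 2" for x by (cases x) simp_all
  then show ?thesis
    using assms set_bits_pmf[OF assms(1)] by (subst pmf_Pi') auto
qed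

lemma prob_tape_prefix:
  assumes "finite B"
  shows "measure random_tape {\<omega>. \<forall>x\<in>B. \<omega> x = h x} = (1 / 2) ^ card B"
proof -
  interpret product_prob_space "\<lambda>_. measure_pmf (bernoulli_pmf (1 / 2))" "UNIV :: nat set"
    by unfold_locales
  have half: "measure_pmf.prob (bernoulli_pmf (1 / 2)) {h x} = 1 / 2" for x
    by (cases "h x") (simp_all add: measure_pmf_single)
  have "{\<omega>. \<forall>x\<in>B. \<omega> x = h x} =
      prod_emb UNIV (\<lambda>_. measure_pmf (bernoulli_pmf (1 / 2))) B (\<Pi>\<^sub>E x\<in>B. {h x})"
    by (simp add: prod_emb_def vimage_def restrict_PiE_iff Pi_def Ball_def)
  moreover have "measure random_tape \<dots> = (\<Prod>x\<in>B. measure_pmf.prob (bernoulli_pmf (1 / 2)) {h x})"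
    unfolding random_tape_def by (rule measure_PiM_emb) (use assms in simp_all)
  ultimately show ?thesis by (simp add: half)
qed

text \<open>A function of finitely many bits is a finite combination of indicators of cylinders,
  whose measures \<open>prob_tape_prefix\<close> gives. Integrals over the infinite tape thus become
  finite sums.\<close>

lemma integral_random_tape_finite:
  fixes f :: "tape \<Rightarrow> real"
  assumes B: "finite B" and f: "\<And>\<omega> \<omega>'. (\<And>x. x \<in> B \<Longrightarrow> \<omega> x = \<omega>' x) \<Longrightarrow> f \<omega> = f \<omega>'"
  shows "integral\<^sup>L random_tape f = measure_pmf.expectation (bits_pmf B) f"
proof -
  interpret prob_space random_tape by (rule prob_space_random_tape)
  let ?S = "set_pmf (bits_pmf B)"
  let ?C = "\<lambda>h. {\<omega>. \<forall>x\<in>B. \<omega> x = h x}"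
  have finS: "finite ?S" by (rule finite_set_bits_pmf[OF B])
  have space: "space random_tape = UNIV"
    by (simp add: random_tape_def space_PiM)
  have meas: "?C h \<in> sets random_tape" for h
  proof -
    have "Measurable.pred random_tape (\<lambda>\<omega>. \<omega> x = h x)" for x
    proof -
      have "(\<lambda>\<omega>. \<omega> x) \<in> measurable random_tape (measure_pmf (bernoulli_pmf (1/2)))"
        unfolding random_tape_def by (rule measurable_component_singleton) simp
      then have [measurable]: "Measurable.pred random_tape (\<lambda>\<omega>. \<omega> x)" by simp
      show ?thesis by (cases "h x") simp_all
    qed
    then have "Measurable.pred random_tape (\<lambda>\<omega>. \<forall>x\<in>B. \<omega> x = h x)"
      using B by (intro pred_intros_finite)
    then show ?thesis
      using space by (simp add: pred_def)
  qed
  have eq: "f \<omega> = (\<Sum>h\<in>?S. f h * indicator (?C h) \<omega>)" for \<omega>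
  proof -
    let ?h = "\<lambda>x. x \<in> B \<and> \<omega> x"
    have "?h \<in> ?S" using set_bits_pmf[OF B] by simp
    moreover have "indicator (?C h) \<omega> = (0::real)" if "h \<in> ?S - {?h}" for h
    proof -
      have "\<omega> \<notin> ?C h"
      proof
        assume "\<omega> \<in> ?C h"
        then have in_B: "h x = \<omega> x" if "x \<in> B" for x using that by blast
        have out_B: "\<not> h x" if "x \<notin> B" for x
          using \<open>h \<in> ?S - {?h}\<close> that set_bits_pmf[OF B] by blast
        have "h = ?h" by (rule ext) (use in_B out_B in blast)
        then show False using that by blast
      qed
      then show ?thesis by simp
    qed
    ultimately have "(\<Sum>h\<in>?S. f h * indicator (?C h) \<omega>) = f ?h * indicator (?C ?h) \<omega>"
      by (subst sum.remove[OF finS, of ?h]) simp_all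
    moreover have "f ?h = f \<omega>" by (rule f) simp
    ultimately show ?thesis by simp
  qed
  have "integral\<^sup>L random_tape f = (\<integral>\<omega>. (\<Sum>h\<in>?S. f h * indicator (?C h) \<omega>) \<partial>random_tape)"
    by (rule Bochner_Integration.integral_cong[OF refl eq])
  also have "\<dots> = (\<Sum>h\<in>?S. f h * measure random_tape (?C h))"
    using meas by (subst Bochner_Integration.integral_sum) (auto simp: emeasure_eq_measure)
  also have "\<dots> = (\<Sum>h\<in>?S. f h * pmf (bits_pmf B) h)"
    by (intro sum.cong refl) (simp add: prob_tape_prefix[OF B] pmf_bits_pmf[OF B])
  also have "\<dots> = measure_pmf.expectation (bits_pmf B) f"
    using finS by (subst integral_measure_pmf_real[where A = ?S]) auto
  finally show ?thesis .
qed

text \<open>Functions of disjoint groups of bits are independent; the induction splits off one group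
  at a time.\<close>

lemma map_bits_pmf_group:
  fixes B :: "'k \<Rightarrow> nat set" and G :: "'k \<Rightarrow> tape \<Rightarrow> 'v"
  assumes "finite K" and fin: "\<And>\<kappa>. \<kappa> \<in> K \<Longrightarrow> finite (B \<kappa>)"
    and disj: "disjoint_family_on B K"
    and G: "\<And>\<kappa> \<omega> \<omega>'. \<kappa> \<in> K \<Longrightarrow> (\<And>x. x \<in> B \<kappa> \<Longrightarrow> \<omega> x = \<omega>' x) \<Longrightarrow> G \<kappa> \<omega> = G \<kappa> \<omega>'"
  shows "map_pmf (\<lambda>\<omega> \<kappa>. if \<kappa> \<in> K then G \<kappa> \<omega> else dflt) (bits_pmf (\<Union>\<kappa>\<in>K. B \<kappa>)) =
    Pi_pmf K dflt (\<lambda>\<kappa>. map_pmf (G \<kappa>) (bits_pmf (B \<kappa>)))"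
  using assms
proof (induction K)
  case empty
  then show ?case by simp
next
  case (insert \<kappa> K)
  let ?R = "\<Union>\<kappa>\<in>K. B \<kappa>"
  have dis: "B \<kappa> \<inter> ?R = {}"
    using insert.hyps insert.prems(2) by (auto simp: disjoint_family_on_def)
  have IH: "map_pmf (\<lambda>\<omega> \<kappa>. if \<kappa> \<in> K then G \<kappa> \<omega> else dflt) (bits_pmf ?R) =
      Pi_pmf K dflt (\<lambda>\<kappa>. map_pmf (G \<kappa>) (bits_pmf (B \<kappa>)))"
  proof (rule insert.IH)
    show "disjoint_family_on B K"
      using insert.prems(2) by (rule disjoint_family_on_mono[rotated]) auto
    show "finite (B \<kappa>)" if "\<kappa> \<in> K" for \<kappa>
      using insert.prems(1)[of \<kappa>] that by simp
    show "G \<kappa> \<omega> = G \<kappa> \<omega>'" if "\<kappa> \<in> K" "\<And>x. x \<in> B \<kappa> \<Longrightarrow> \<omega> x = \<omega>' x" for \<kappa> \<omega> \<omega>'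
      by (rule insert.prems(3)) (rule insertI2[OF that(1)], rule that(2))
  qed
  have "bits_pmf (\<Union>\<kappa>\<in>insert \<kappa> K. B \<kappa>) =
      map_pmf (\<lambda>(f, g) x. if x \<in> B \<kappa> then f x else g x) (pair_pmf (bits_pmf (B \<kappa>)) (bits_pmf ?R))"
    unfolding UN_insert using insert.hyps(1) insert.prems(1) dis by (intro Pi_pmf_union) auto
  then have "map_pmf (\<lambda>\<omega> \<kappa>'. if \<kappa>' \<in> insert \<kappa> K then G \<kappa>' \<omega> else dflt) (bits_pmf (\<Union>\<kappa>\<in>insert \<kappa> K. B \<kappa>)) =
     map_pmf (\<lambda>(f, g) \<kappa>'. if \<kappa>' \<in> insert \<kappa> K then G \<kappa>' (\<lambda>x. if x \<in> B \<kappa> then f x else g x) else dflt)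
       (pair_pmf (bits_pmf (B \<kappa>)) (bits_pmf ?R))"
    by (simp only: pmf.map_comp comp_def case_prod_unfold)
  also have "\<dots> = map_pmf (\<lambda>(f, g). (\<lambda>\<kappa>'. if \<kappa>' \<in> K then G \<kappa>' g else dflt)(\<kappa> := G \<kappa> f))
       (pair_pmf (bits_pmf (B \<kappa>)) (bits_pmf ?R))"
  proof (intro map_pmf_cong refl)
    have 1: "G \<kappa> (\<lambda>x. if x \<in> B \<kappa> then f x else g x) = G \<kappa> f" for f g
      by (rule insert.prems(3)) simp_all
    have 2: "G \<kappa>' (\<lambda>x. if x \<in> B \<kappa> then f x else g x) = G \<kappa>' g" if "\<kappa>' \<in> K" for f g \<kappa>'
    proof (rule insert.prems(3))
      show "\<kappa>' \<in> insert \<kappa> K" using that by simp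
      show "(if x \<in> B \<kappa> then f x else g x) = g x" if "x \<in> B \<kappa>'" for x
        using that dis \<open>\<kappa>' \<in> K\<close> by auto
    qed
    fix p :: "tape \<times> tape"
    obtain f g where p: "p = (f, g)" by (cases p)
    show "(case p of (f, g) \<Rightarrow> \<lambda>\<kappa>'. if \<kappa>' \<in> insert \<kappa> K
          then G \<kappa>' (\<lambda>x. if x \<in> B \<kappa> then f x else g x) else dflt) =
        (case p of (f, g) \<Rightarrow> (\<lambda>\<kappa>'. if \<kappa>' \<in> K then G \<kappa>' g else dflt)(\<kappa> := G \<kappa> f))"
      unfolding p prod.case
    proof (rule ext)
      fix \<kappa>'
      show "(if \<kappa>' \<in> insert \<kappa> K then G \<kappa>' (\<lambda>x. if x \<in> B \<kappa> then f x else g x) else dflt) =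
        ((\<lambda>\<kappa>'. if \<kappa>' \<in> K then G \<kappa>' g else dflt)(\<kappa> := G \<kappa> f)) \<kappa>'"
        using 1[of f g] 2[of \<kappa>' f g] by (cases "\<kappa>' = \<kappa>") simp_all
    qed
  qed
  also have "\<dots> = map_pmf (\<lambda>(v, g). g(\<kappa> := v)) (pair_pmf (map_pmf (G \<kappa>) (bits_pmf (B \<kappa>)))
      (map_pmf (\<lambda>\<omega> \<kappa>. if \<kappa> \<in> K then G \<kappa> \<omega> else dflt) (bits_pmf ?R)))"
    unfolding map_pair[symmetric] pmf.map_comp
    by (intro map_pmf_cong refl) (simp add: case_prod_unfold)
  also have "\<dots> = Pi_pmf (insert \<kappa> K) dflt (\<lambda>\<kappa>. map_pmf (G \<kappa>) (bits_pmf (B \<kappa>)))"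
    unfolding IH using insert.hyps by (subst Pi_pmf_insert) simp_all
  finally show ?case .
qed

section \<open>The bits owned by a trial\<close>

context lca_scheme begin

definition trial_addresses :: "nat \<times> nat \<times> nat \<times> nat \<Rightarrow> nat set" where
  "trial_addresses \<kappa> = address \<kappa> ` {..<a + c * (L - fst \<kappa>)}"

lemma address_eq_iff: "address \<kappa> b = address \<kappa>' b' \<longleftrightarrow> \<kappa> = \<kappa>' \<and> b = b'"
  by (simp add: address_def)

lemma card_trial_addresses: "card (trial_addresses \<kappa>) = a + c * (L - fst \<kappa>)"
  unfolding trial_addresses_def by (subst card_image) (auto simp: inj_on_def address_eq_iff)

lemma finite_trial_addresses [simp]: "finite (trial_addresses \<kappa>)"
  by (simp add: trial_addresses_def)

lemma index_bound: "r < c \<Longrightarrow> b < k \<Longrightarrow> a + r * k + b < a + c * (k::nat)"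
proof -
  assume "r < c" "b < k"
  then have "r * k + b < Suc r * k" by simp
  also have "\<dots> \<le> c * k" using \<open>r < c\<close> by (intro mult_right_mono) simp_all
  finally show ?thesis by simp
qed

lemma trial_cong:
  assumes "\<And>x. x \<in> trial_addresses \<kappa> \<Longrightarrow> \<omega> x = \<omega>' x"
  shows "trial \<omega> \<kappa> = trial \<omega>' \<kappa>"
proof -
  have act: "\<omega> (address \<kappa> b) = \<omega>' (address \<kappa> b)" if "b < a" for b
    using that by (intro assms) (auto simp: trial_addresses_def)
  have idx: "\<omega> (address \<kappa> (a + r * (L - fst \<kappa>) + b)) = \<omega>' (address \<kappa> (a + r * (L - fst \<kappa>) + b))"
    if "r < c" "b < L - fst \<kappa>" for r b
    using index_bound[OF that] by (intro assms) (auto simp: trial_addresses_def)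
  have "map (\<lambda>r. horner_sum of_bool (2::nat) (map (\<lambda>b. \<omega> (address \<kappa> (a + r * (L - fst \<kappa>) + b))) [0..<L - fst \<kappa>])) [0..<c] =
      map (\<lambda>r. horner_sum of_bool 2 (map (\<lambda>b. \<omega>' (address \<kappa> (a + r * (L - fst \<kappa>) + b))) [0..<L - fst \<kappa>])) [0..<c]"
    by (intro map_cong refl arg_cong[of _ _ "horner_sum of_bool 2"] idx) simp_all
  moreover have "(\<forall>b<a. \<omega> (address \<kappa> b)) = (\<forall>b<a. \<omega>' (address \<kappa> b))"
    using act by blast
  ultimately show ?thesis
    by (simp only: trial_def)
qed

lemma trial_eq_Some_iff:
  assumes "xs \<in> index_lists (L - fst \<kappa>) c"
  shows "trial \<omega> \<kappa> = Some xs \<longleftrightarrow> (\<forall>b<a. \<omega> (address \<kappa> b)) \<and>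
    (\<forall>r<c. \<forall>b<L - fst \<kappa>. \<omega> (address \<kappa> (a + r * (L - fst \<kappa>) + b)) = bit (xs ! r) b)"
proof -
  let ?k = "L - fst \<kappa>"
  let ?w = "\<lambda>r b. \<omega> (address \<kappa> (a + r * ?k + b))"
  have xs: "length xs = c" "\<And>r. r < c \<Longrightarrow> xs ! r < 2 ^ ?k"
    using assms by (auto simp: index_lists_def dest: nth_mem)
  have num: "horner_sum of_bool 2 (map (?w r) [0..<?k]) = xs ! r \<longleftrightarrow> (\<forall>b<?k. ?w r b = bit (xs ! r) b)"
    if "r < c" for r
  proof
    assume eq: "horner_sum of_bool 2 (map (?w r) [0..<?k]) = xs ! r"
    show "\<forall>b<?k. ?w r b = bit (xs ! r) b"
      unfolding eq[symmetric] by (simp add: bit_horner_sum_bit_iff)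
  next
    assume "\<forall>b<?k. ?w r b = bit (xs ! r) b"
    then have eq: "map (?w r) [0..<?k] = map (bit (xs ! r)) [0..<?k]"
      by (intro map_cong refl) simp
    show "horner_sum of_bool 2 (map (?w r) [0..<?k]) = xs ! r"
      unfolding eq using xs(2)[OF that] by (simp add: horner_sum_bit_eq_take_bit take_bit_nat_eq_self)
  qed
  have "map (\<lambda>r. horner_sum of_bool 2 (map (?w r) [0..<?k])) [0..<c] = xs \<longleftrightarrow>
      (\<forall>r<c. horner_sum of_bool 2 (map (?w r) [0..<?k]) = xs ! r)"
    using xs(1) by (auto simp: list_eq_iff_nth_eq)
  then show ?thesis
    using num by (auto simp: trial_def)
qed

lemma trial_in_index_lists: "trial \<omega> \<kappa> = Some xs \<Longrightarrow> xs \<in> index_lists (L - fst \<kappa>) c"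
proof -
  have "(horner_sum of_bool 2 (map f [0..<k]) :: nat) < 2 ^ k" for f k
    using horner_sum_of_bool_2_less[of "map f [0..<k]", where 'a = int]
    by (metis horner_sum_of_bool_2_less length_map length_upt diff_zero)
  then show "trial \<omega> \<kappa> = Some xs \<Longrightarrow> xs \<in> index_lists (L - fst \<kappa>) c"
    by (auto simp: trial_def index_lists_def split: if_splits)
qed

text \<open>A list in \<open>index_lists\<close> determines all bits of the trial, so exactly one
  assignment yields \<open>Some xs\<close>. Comparing the values \<open>Some xs\<close> suffices
  because they determine the mass of \<open>None\<close>.\<close>

lemma map_trial_bits_pmf:
  "map_pmf (\<lambda>\<omega>. trial \<omega> \<kappa>) (bits_pmf (trial_addresses \<kappa>)) = trial_pmf a c (L - fst \<kappa>)"
proof (rule spmf_eqI)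
  fix xs
  let ?k = "L - fst \<kappa>"
  let ?B = "trial_addresses \<kappa>"
  let ?p = "map_pmf (\<lambda>\<omega>. trial \<omega> \<kappa>) (bits_pmf ?B)"
  have rhs: "pmf (trial_pmf a c ?k) (Some xs) = of_bool (xs \<in> index_lists ?k c) / (2 ^ a * 2 ^ (?k * c))"
  proof -
    have "pmf (trial_pmf a c ?k) (Some xs) = measure_pmf.expectation (trial_pmf a c ?k) (indicator {Some xs})"
      by (simp add: measure_pmf_single)
    also have "\<dots> = (\<Sum>is\<in>index_lists ?k c. indicator {Some xs} (Some is)) / (2 ^ a * 2 ^ (?k * c))"
      by (rule expectation_trial_pmf) simp
    also have "(\<Sum>is\<in>index_lists ?k c. indicator {Some xs} (Some is)) = (of_bool (xs \<in> index_lists ?k c) :: real)"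
      by (simp add: indicator_def if_distrib sum.delta' of_bool_def cong: if_cong)
    finally show ?thesis .
  qed
  show "pmf ?p (Some xs) = pmf (trial_pmf a c ?k) (Some xs)"
  proof (cases "xs \<in> index_lists ?k c")
    case False
    then have "Some xs \<notin> set_pmf ?p"
      using trial_in_index_lists[of _ \<kappa> xs] by (auto simp: eq_commute[of "Some xs"])
    then have "pmf ?p (Some xs) = 0" unfolding set_pmf_iff by blast
    then show ?thesis using False rhs by simp
  next
    case True
    \<comment> \<open>Bits below \<open>a\<close> are the activation bits. A later bit, numbered
      \<open>b - a\<close> among the rest, belongs to the index given by the quotient by
      \<open>?k\<close>, at the place given by the remainder.\<close>
    define h where "h x \<longleftrightarrow> (\<exists>b<a + c * ?k. x = address \<kappa> b \<and> (b < a \<or> bit (xs ! ((b - a) div ?k)) ((b - a) mod ?k)))" for x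
    have h: "h (address \<kappa> b) \<longleftrightarrow> b < a \<or> bit (xs ! ((b - a) div ?k)) ((b - a) mod ?k)" if "b < a + c * ?k" for b
      using that by (auto simp: h_def address_eq_iff)
    have hB: "h \<in> set_pmf (bits_pmf ?B)"
      by (auto simp: set_bits_pmf h_def trial_addresses_def)
    have "trial \<omega> \<kappa> = Some xs \<longleftrightarrow> \<omega> = h" if \<omega>: "\<omega> \<in> set_pmf (bits_pmf ?B)" for \<omega>
    proof -
      have "\<omega> = h \<longleftrightarrow> (\<forall>b<a + c * ?k. \<omega> (address \<kappa> b) = h (address \<kappa> b))"
      proof
        assume eq: "\<forall>b<a + c * ?k. \<omega> (address \<kappa> b) = h (address \<kappa> b)"
        show "\<omega> = h"
        proof
          fix x show "\<omega> x = h x"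
            using eq \<omega> hB by (cases "x \<in> ?B") (auto simp: set_bits_pmf trial_addresses_def)
        qed
      qed simp
      also have "\<dots> \<longleftrightarrow> (\<forall>b<a. \<omega> (address \<kappa> b)) \<and>
         (\<forall>r<c. \<forall>b<?k. \<omega> (address \<kappa> (a + r * ?k + b)) = bit (xs ! r) b)"
        (is "?all = ?bits")
      proof (rule iffI)
        assume all: ?all
        have "\<omega> (address \<kappa> b)" if "b < a" for b
          using all h[of b] that by simp
        moreover have "\<omega> (address \<kappa> (a + r * ?k + b)) = bit (xs ! r) b" if "r < c" "b < ?k" for r b
          using all h[OF index_bound[OF that]] index_bound[OF that] that by (simp add: add.assoc)
        ultimately show ?bits by blast
      next
        assume bits: ?bits
        have "\<omega> (address \<kappa> b) = h (address \<kappa> b)" if lt: "b < a + c * ?k" for b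
        proof (cases "b < a")
          case True
          then show ?thesis using bits h[OF lt] by simp
        next
          case False
          then have lt': "b - a < c * ?k" using lt by simp
          then have k: "0 < ?k" by (cases "?k = 0") simp_all
          have "(b - a) div ?k < c" using lt' k by (simp add: less_mult_imp_div_less)
          moreover have "(b - a) mod ?k < ?k" using k by simp
          ultimately have "\<omega> (address \<kappa> (a + (b - a) div ?k * ?k + (b - a) mod ?k)) =
              bit (xs ! ((b - a) div ?k)) ((b - a) mod ?k)"
            using bits by blast
          moreover have "a + (b - a) div ?k * ?k + (b - a) mod ?k = b"
            using False by (simp only: add.assoc div_mult_mod_eq)
          ultimately show ?thesis using h[OF lt] False by simp
        qed
        then show ?all by blast
      qed
      also have "\<dots> \<longleftrightarrow> trial \<omega> \<kappa> = Some xs"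
        by (rule trial_eq_Some_iff[OF True, symmetric])
      finally show ?thesis by simp
    qed
    then have vim: "(\<lambda>\<omega>. trial \<omega> \<kappa>) -` {Some xs} \<inter> set_pmf (bits_pmf ?B) = {h}"
      using hB by blast
    have "pmf ?p (Some xs) = measure (bits_pmf ?B) ((\<lambda>\<omega>. trial \<omega> \<kappa>) -` {Some xs})"
      by (rule pmf_map)
    also have "\<dots> = measure (bits_pmf ?B) ((\<lambda>\<omega>. trial \<omega> \<kappa>) -` {Some xs} \<inter> set_pmf (bits_pmf ?B))"
      by (rule measure_Int_set_pmf[symmetric])
    also have "\<dots> = pmf (bits_pmf ?B) h"
      unfolding vim by (rule measure_pmf_single)
    also have "\<dots> = (1 / 2) ^ (a + c * ?k)"
      by (simp add: pmf_bits_pmf[OF _ hB] card_trial_addresses)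
    finally show ?thesis
      using True by (simp add: rhs power_add power_one_over mult.commute)
  qed
qed

text \<open>Cutting the table down to a finite \<open>K\<close> makes the integrand depend on
  finitely many bits, as \<open>integral_random_tape_finite\<close> demands.\<close>

lemma integral_trials:
  assumes "finite K"
  shows "(LINT \<omega>|random_tape. f (\<lambda>\<kappa>. if \<kappa> \<in> K then trial \<omega> \<kappa> else None)) =
    measure_pmf.expectation (Pi_pmf K None (\<lambda>\<kappa>. trial_pmf a c (L - fst \<kappa>))) (f :: _ \<Rightarrow> real)"
proof -
  let ?B = "\<Union>\<kappa>\<in>K. trial_addresses \<kappa>"
  let ?Y = "\<lambda>\<omega> \<kappa>. if \<kappa> \<in> K then trial \<omega> \<kappa> else None"
  have "(LINT \<omega>|random_tape. f (?Y \<omega>)) = measure_pmf.expectation (bits_pmf ?B) (\<lambda>\<omega>. f (?Y \<omega>))"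
  proof (rule integral_random_tape_finite)
    fix \<omega> \<omega>' :: tape assume "\<And>x. x \<in> ?B \<Longrightarrow> \<omega> x = \<omega>' x"
    then have "?Y \<omega> \<kappa> = ?Y \<omega>' \<kappa>" for \<kappa>
      using trial_cong[of \<kappa> \<omega> \<omega>'] by auto
    then show "f (?Y \<omega>) = f (?Y \<omega>')" by presburger
  qed (use assms in simp)
  also have "\<dots> = measure_pmf.expectation (map_pmf ?Y (bits_pmf ?B)) f" by simp
  also have "map_pmf ?Y (bits_pmf ?B) = Pi_pmf K None (\<lambda>\<kappa>. map_pmf (\<lambda>\<omega>. trial \<omega> \<kappa>) (bits_pmf (trial_addresses \<kappa>)))"
    by (rule map_bits_pmf_group[OF assms])
      (auto simp: disjoint_family_on_def trial_addresses_def address_eq_iff intro!: trial_cong)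
  finally show ?thesis by (simp only: map_trial_bits_pmf)
qed

end

section \<open>Composition of the phases\<close>

definition put :: "(nat \<times> nat \<times> nat \<times> nat \<Rightarrow> 'a) \<Rightarrow> nat \<Rightarrow> (nat \<times> nat \<times> nat \<Rightarrow> 'a) \<Rightarrow>
    nat \<times> nat \<times> nat \<times> nat \<Rightarrow> 'a" where
  "put Y p z \<kappa> = (if fst \<kappa> = p then z (snd \<kappa>) else Y \<kappa>)"

lemma slice_put_same: "slice (put Y p z) p = z"
  by (rule ext) (simp add: slice_def put_def)

lemma slice_put_other: "p' \<noteq> p \<Longrightarrow> slice (put Y p z) p' = slice Y p'"
  by (rule ext) (simp add: slice_def put_def)

text \<open>These bounds depend on the parameters alone, because the budget has to be fixed before
  the instance is known.\<close>

locale cost_bound =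
  fixes s t d R L :: nat and lam :: real
begin

definition B\<^sub>0 :: real where
  "B\<^sub>0 = 2 ^ R * (2 + real t) * (1 + real (Suc d) * lam) ^ R"

definition X\<^sub>0 :: real where
  "X\<^sub>0 = real R * (real t + 2 ^ L * B\<^sub>0)"

text \<open>One factor with two purposes: its first four summands bound the growth of the testing
  cost over a phase, its last two the queries of all sets running their own trials and cleanup in a
  phase.\<close>

definition G :: real where
  "G = 1 + real t + real s * real s * real t + (1 + real s * real t) * X\<^sub>0 * (real s * real t) +
     (real R * B\<^sub>0 + 1) * (real s * real t)"

end

text \<open>The choice of \<open>Suc d\<close> in \<open>d_eq\<close> ensures \<open>R_le\<close>.
  By \<open>st_le\<close>, a cleanup has probability at most \<open>1 / (s * t)\<close>, which
  \<open>L_le\<close> compares with \<open>2 ^ (L - p)\<close>. The assumption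
  \<open>lam_large\<close> is that of \<open>random_phase_cost\<close>, with residual costs as large
  as they may get over all \<open>L\<close> phases.\<close>

locale lca_analysis = lca_instance s t a "Suc d" R L I + cost_bound s t d R L lam
  for s t a d R L I lam +
  fixes b :: nat
  assumes d_eq: "Suc d = 2 * (a + b) + 6"
    and R_def: "R = a + Suc d + 1 + b"
    and t_le: "t \<le> 2 ^ a"
    and s_less: "s < 2 ^ L" and L_le: "2 ^ L \<le> 2 * s"
    and st_le: "s * t \<le> 2 ^ 2 ^ b"
    and s_ge_1: "1 \<le> s" and t_ge_1: "1 \<le> t"
    and lam_ge_1: "1 \<le> lam"
    and lam_large: "2 ^ R * ((1 + s * (1 + t + t * s + 2 * s * (1 + t * s) * (1 + Suc d * t * 2 ^ R) ^ R) ^ L) *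
       (1 + Suc d * t * 2 ^ R) ^ R) * exp (1 - lam / 8) \<le> 1"
begin

definition H :: real where
  "H = 1 + Suc d * t * 2 ^ R"

definition G\<^sub>0 :: real where
  "G\<^sub>0 = 1 + t + t * s + 2 * s * (1 + t * s) * H ^ R"

lemma H_ge_1: "1 \<le> H"
  by (simp add: H_def)

lemma G\<^sub>0_ge_1: "1 \<le> G\<^sub>0"
  using H_ge_1 by (simp add: G\<^sub>0_def)

lemma lam_large': "2 ^ R * ((1 + s * G\<^sub>0 ^ L) * H ^ R) * exp (1 - lam / 8) \<le> 1"
  using lam_large by (simp add: G\<^sub>0_def H_def algebra_simps)

text \<open>With \<open>z = a + b\<close> the right-hand side is \<open>2 ^ (4 * z + 12)\<close> and
  \<open>R = 3 * z + 7\<close>, which leaves \<open>2 ^ (z + 5)\<close> for the factor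
  \<open>R\<close>.\<close>

lemma R_le: "2 ^ R * R \<le> 4 ^ Suc d"
proof -
  define z where "z = a + b"
  have c: "Suc d = 2 * z + 6" and R: "R = 3 * z + 7"
    using d_eq R_def by (simp_all add: z_def)
  have "z < 2 ^ z" by (rule less_exp)
  then have "3 * z + 7 \<le> 2 ^ z * 32" by linarith
  then have "R \<le> 2 ^ (z + 5)" by (simp add: R power_add)
  then have "2 ^ R * R \<le> 2 ^ R * 2 ^ (z + 5)" by (rule mult_left_mono) simp
  also have "\<dots> = 2 ^ (2 * Suc d)" by (simp add: c R flip: power_add)
  also have "\<dots> = (4::nat) ^ Suc d" by (simp add: power_mult)
  finally show ?thesis .
qed

section \<open>Independence of the phases\<close>

definition phase_keys :: "(nat \<times> nat \<times> nat) set" where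
  "phase_keys = (SIGMA j:{..<R}. F \<times> {..<2 ^ j})"

abbreviation Q :: "outcome pmf" where
  "Q \<equiv> Pi_pmf ({..<L} \<times> phase_keys) None (\<lambda>\<kappa>. trial_pmf a (Suc d) (L - fst \<kappa>))"

abbreviation phase_pmf :: "nat \<Rightarrow> phase_outcome pmf" where
  "phase_pmf p \<equiv> Pi_pmf phase_keys None (\<lambda>_. trial_pmf a (Suc d) (L - p))"

lemma finite_phase_keys [simp]: "finite phase_keys"
  by (simp add: phase_keys_def)

lemma finite_Q [simp]: "finite (set_pmf Q)"
  by (intro finite_set_Pi_pmf) simp_all

lemma integrable_Q [simp]: "integrable (measure_pmf Q) (f :: _ \<Rightarrow> real)"
  by (rule integrable_measure_pmf_finite) simp

lemma finite_P [simp]: "finite (set_pmf (phase_pmf p))"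
  by (intro finite_set_Pi_pmf) simp_all

lemma integrable_P [simp]: "integrable (measure_pmf (phase_pmf p)) (f :: _ \<Rightarrow> real)"
  by (rule integrable_measure_pmf_finite) simp

lemma Pi_pmf_phase:
  "Pi_pmf ({p} \<times> phase_keys) None (\<lambda>\<kappa>. trial_pmf a (Suc d) (L - fst \<kappa>)) =
     map_pmf (\<lambda>z \<kappa>. if fst \<kappa> = p then z (snd \<kappa>) else None) (phase_pmf p)"
proof -
  \<comment> \<open>The key \<open>(R, 0, 0)\<close> has too high a level to lie in
    \<open>phase_keys\<close>; a table takes its default value \<open>None\<close> there.\<close>
  let ?h = "\<lambda>\<kappa>. if fst \<kappa> = p then snd \<kappa> else (R, 0, 0)"
  have out: "(R, 0, 0) \<notin> phase_keys" by (simp add: phase_keys_def)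
  have "Pi_pmf ({p} \<times> phase_keys) None (\<lambda>\<kappa>. trial_pmf a (Suc d) (L - fst \<kappa>)) =
      Pi_pmf ({p} \<times> phase_keys) None (\<lambda>_. trial_pmf a (Suc d) (L - p))"
    by (rule Pi_pmf_cong) auto
  also have "\<dots> = map_pmf (\<lambda>z. z \<circ> ?h) (phase_pmf p)"
  proof (rule Pi_pmf_bij_betw)
    show "bij_betw ?h ({p} \<times> phase_keys) phase_keys"
      by (rule bij_betw_byWitness[where f' = "Pair p"]) auto
  qed (use out in \<open>auto split: if_splits\<close>)
  also have "\<dots> = map_pmf (\<lambda>z \<kappa>. if fst \<kappa> = p then z (snd \<kappa>) else None) (phase_pmf p)"
  proof (intro map_pmf_cong refl ext)
    fix z \<kappa> assume "z \<in> set_pmf (phase_pmf p)"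
    then have "z (R, 0, 0) = None"
      using set_Pi_pmf_subset[of phase_keys None "\<lambda>_. trial_pmf a (Suc d) (L - p)"] out by auto
    then show "(z \<circ> ?h) \<kappa> = (if fst \<kappa> = p then z (snd \<kappa>) else None)" by simp
  qed
  finally show ?thesis .
qed

lemma resample_phase:
  assumes p: "p < L"
  shows "measure_pmf.expectation Q f =
    measure_pmf.expectation Q (\<lambda>Y. measure_pmf.expectation (phase_pmf p) (\<lambda>z. f (put Y p z) :: real))"
proof -
  let ?A = "{p} \<times> phase_keys"
  have "measure_pmf.expectation Q f =
    measure_pmf.expectation Q (\<lambda>Y. measure_pmf.expectation
      (Pi_pmf ?A None (\<lambda>\<kappa>. trial_pmf a (Suc d) (L - fst \<kappa>))) (\<lambda>z. f (override_on Y z ?A)))"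
    by (rule expectation_Pi_pmf_resample) (use p in auto)
  also have "\<dots> = measure_pmf.expectation Q (\<lambda>Y. measure_pmf.expectation (phase_pmf p)
      (\<lambda>z. f (override_on Y (\<lambda>\<kappa>. if fst \<kappa> = p then z (snd \<kappa>) else None) ?A)))"
    by (simp add: Pi_pmf_phase)
  also have "\<dots> = measure_pmf.expectation Q (\<lambda>Y. measure_pmf.expectation (phase_pmf p) (\<lambda>z. f (put Y p z)))"
  proof (intro integral_cong_AE AE_pmfI)
    fix Y z assume Y: "Y \<in> set_pmf Q" and z: "z \<in> set_pmf (phase_pmf p)"
    \<comment> \<open>\<open>put\<close> replaces every key of phase \<open>p\<close>,
      \<open>override_on\<close> only those in \<open>?A\<close>. They agree since on the remaining
      keys both tables are \<open>None\<close>.\<close>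
    have Yout: "Y \<kappa> = None" if "fst \<kappa> = p" "snd \<kappa> \<notin> phase_keys" for \<kappa>
      using Y set_Pi_pmf_subset[of "{..<L} \<times> phase_keys" None "\<lambda>\<kappa>. trial_pmf a (Suc d) (L - fst \<kappa>)"] that
      by (cases \<kappa>) auto
    have zout: "z \<kappa> = None" if "\<kappa> \<notin> phase_keys" for \<kappa>
      using z set_Pi_pmf_subset[of phase_keys None "\<lambda>_. trial_pmf a (Suc d) (L - p)"] that
      by (cases \<kappa>) auto
    have "override_on Y (\<lambda>\<kappa>. if fst \<kappa> = p then z (snd \<kappa>) else None) ?A = put Y p z"
    proof
      fix \<kappa> show "override_on Y (\<lambda>\<kappa>. if fst \<kappa> = p then z (snd \<kappa>) else None) ?A \<kappa> = put Y p z \<kappa>"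
        using Yout[of \<kappa>] zout[of "snd \<kappa>"] by (cases \<kappa>) (auto simp: override_on_def put_def)
    qed
    then show "f (override_on Y (\<lambda>\<kappa>. if fst \<kappa> = p then z (snd \<kappa>) else None) ?A) = f (put Y p z)"
      by simp
  qed simp_all
  finally show ?thesis .
qed

lemma slice_Q:
  assumes "Y \<in> set_pmf Q" "p < L" shows "slice Y p \<in> set_pmf (phase_pmf p)"
proof -
  have Y: "(\<kappa> \<in> {..<L} \<times> phase_keys \<longrightarrow> Y \<kappa> \<in> set_pmf (trial_pmf a (Suc d) (L - fst \<kappa>))) \<and>
     (\<kappa> \<notin> {..<L} \<times> phase_keys \<longrightarrow> Y \<kappa> = None)" for \<kappa>
    using assms(1) set_Pi_pmf[of "{..<L} \<times> phase_keys" None "\<lambda>\<kappa>. trial_pmf a (Suc d) (L - fst \<kappa>)"]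
    unfolding PiE_dflt_def by (cases \<kappa>) auto
  have "(\<kappa> \<in> phase_keys \<longrightarrow> slice Y p \<kappa> \<in> set_pmf (trial_pmf a (Suc d) (L - p))) \<and>
     (\<kappa> \<notin> phase_keys \<longrightarrow> slice Y p \<kappa> = None)" for \<kappa>
    using Y[of "(p, \<kappa>)"] assms(2) by (simp add: slice_def)
  then show ?thesis
    by (simp add: set_Pi_pmf PiE_dflt_def)
qed

lemma uncovered_cong:
  assumes "\<And>p'. p' < p \<Longrightarrow> slice Y p' = slice Y' p'"
  shows "uncovered Y p = uncovered Y' p"
  using assms by (induction p) simp_all

lemma cost_cong:
  assumes "\<And>p'. p' < p \<Longrightarrow> slice Y p' = slice Y' p'"
  shows "cost Y p = cost Y' p"
  using assms
proof (induction p)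
  case 0
  then show ?case by (simp add: fun_eq_iff)
next
  case (Suc p)
  have 1: "cost Y p = cost Y' p" using Suc by simp
  have 2: "uncovered Y p = uncovered Y' p" using Suc.prems by (intro uncovered_cong) simp
  have 3: "slice Y p = slice Y' p" using Suc.prems by simp
  show ?case by (rule ext) (simp only: cost.simps 1 2 3)
qed

lemma uncovered_put [simp]: "uncovered (put Y p z) p = uncovered Y p"
  by (rule uncovered_cong) (simp add: slice_put_other)

lemma cost_put [simp]: "cost (put Y p z) p = cost Y p"
  by (rule cost_cong) (simp add: slice_put_other)

text \<open>This holds for every \<open>Y\<close>: the earlier phases influence the levels of phase
  \<open>p\<close> only through the set \<open>uncovered Y p\<close>, so the analysis of a phase
  applies to each history.\<close>

lemma random_phase:
  assumes "p < L"
  shows "random_phase el st (uncovered Y p) F t a d b (L - p) R"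
proof
  have sub: "e \<in> E" if "e \<in> uncovered Y p" for e
    using uncovered_subset that by blast
  show "finite (uncovered Y p)"
    using uncovered_subset by (rule finite_subset) simp
  show "distinct (el T)" if "T \<in> F" for T
    using that F_el distinct_el by blast
  show "card (set (el T) \<inter> uncovered Y p) \<le> 2 ^ (L - p)" if "T \<in> F" for T
    using card_uncovered_less[OF s_less that, of p Y] assms by simp
  show "set (st e) = {T \<in> F. e \<in> set (el T)}" if "e \<in> uncovered Y p" for e
    by (rule set_st[OF sub[OF that]])
  show "card (set (st e)) \<le> t" if "e \<in> uncovered Y p" for e
    using length_st[OF sub[OF that]] card_length le_trans by blast
  show "t \<le> 2 ^ a" by (rule t_le)
  show "R = a + Suc d + 1 + b" by (rule R_def)
  show "2 ^ R * R \<le> 4 ^ Suc d" by (rule R_le)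
  show "0 < L - p" using assms by simp
qed simp_all

lemma random_phase_cost:
  assumes p: "p < L" and u: "\<And>e. e \<in> E \<Longrightarrow> cost Y p e + 1 \<le> G\<^sub>0 ^ p"
  shows "random_phase_cost el st (uncovered Y p) F t a d b (L - p) R (set_cost (cost Y p)) (s * G\<^sub>0 ^ p) lam"
proof -
  interpret c: random_phase el st "uncovered Y p" F t a d b "L - p" R
    by (rule random_phase[OF p])
  show ?thesis
  proof
    show "real (set_cost (cost Y p) T) \<le> s * G\<^sub>0 ^ p" if T: "T \<in> F" for T
    proof -
      have "real (set_cost (cost Y p) T) \<le> s + (\<Sum>e\<in>set (el T). G\<^sub>0 ^ p - 1)"
        unfolding set_cost_def of_nat_add of_nat_sum
      proof (intro add_left_mono sum_mono)
        fix e assume "e \<in> set (el T)"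
        then have "e \<in> E" by (rule subsetD[OF el_subset[OF F_el[OF T]]])
        from u[OF this] show "real (cost Y p e) \<le> G\<^sub>0 ^ p - 1" by simp
      qed
      also have "\<dots> \<le> s + s * (G\<^sub>0 ^ p - 1)"
        using length_el[OF F_el[OF T]] card_length[of "el T"] one_le_power[OF G\<^sub>0_ge_1, of p]
        by (simp add: mult_right_mono)
      finally show ?thesis by (simp add: algebra_simps)
    qed
    have "uncovered Y p \<subseteq> (\<Union>T\<in>F. set (el T))"
    proof
      fix e assume "e \<in> uncovered Y p"
      then have "e \<in> E" using uncovered_subset by blast
      then show "e \<in> (\<Union>T\<in>F. set (el T))" using st_nonempty[of e] set_st[of e] by auto
    qed
    then have "card (uncovered Y p) \<le> card (\<Union>T\<in>F. set (el T))"
      by (intro card_mono) auto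
    also have "\<dots> \<le> (\<Sum>T\<in>F. card (set (el T)))"
      by (intro card_UN_le) simp
    also have "\<dots> \<le> (\<Sum>T\<in>F. set_cost (cost Y p) T)"
    proof (rule sum_mono)
      fix T assume "T \<in> F"
      then have "length (el T) \<le> s" by (intro length_el F_el)
      then show "card (set (el T)) \<le> set_cost (cost Y p) T"
        using card_length[of "el T"] by (simp add: set_cost_def)
    qed
    finally show "card (uncovered Y p) \<le> (\<Sum>T\<in>F. set_cost (cost Y p) T)" .
    show "1 \<le> lam" by (rule lam_ge_1)
    show "0 \<le> s * G\<^sub>0 ^ p" using G\<^sub>0_ge_1 by simp
    have "2 ^ R * ((1 + s * G\<^sub>0 ^ p) * H ^ R) * exp (1 - lam / 8) \<le>
        2 ^ R * ((1 + s * G\<^sub>0 ^ L) * H ^ R) * exp (1 - lam / 8)"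
      using p G\<^sub>0_ge_1 H_ge_1
      by (intro mult_right_mono mult_left_mono add_left_mono power_increasing) auto
    also have "\<dots> \<le> 1" by (rule lam_large')
    finally show "2 ^ R * ((1 + s * G\<^sub>0 ^ p) * (1 + Suc d * t * 2 ^ R) ^ R) * exp (1 - lam / 8) \<le> 1"
      unfolding H_def by simp
  qed
qed

text \<open>A worst-case bound over the support, by a factor \<open>G\<^sub>0\<close> per phase. It
  supplies the bound \<open>M\<close> on residual costs, which affects the final estimates only
  through the size of \<open>lam\<close>.\<close>

lemma cost_le:
  assumes Y: "Y \<in> set_pmf Q"
  shows "p \<le> L \<Longrightarrow> e \<in> E \<Longrightarrow> cost Y p e + 1 \<le> G\<^sub>0 ^ p"
proof (induction p arbitrary: e)
  case 0
  then show ?case by simp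
next
  case (Suc p)
  then have p: "p < L" by simp
  interpret c: random_phase_cost el st "uncovered Y p" F t a d b "L - p" R "set_cost (cost Y p)" "s * G\<^sub>0 ^ p" lam
    by (rule random_phase_cost[OF p]) (use Suc in simp)
  let ?v = "G\<^sub>0 ^ p"
  have v1: "1 \<le> ?v" using G\<^sub>0_ge_1 by (rule one_le_power)
  have HR: "1 \<le> H ^ R" using H_ge_1 by (rule one_le_power)
  have P: "c.P = phase_pmf p"
    by (simp add: c.keys_def phase_keys_def)
  have HH: "c.H = H" by (simp add: c.H_def H_def)
  let ?B = "2 * s * ?v * H ^ R"
  have block: "real (the_block_cost Y p R [e]) \<le> ?B" if "e \<in> uncovered Y p" for e
  proof -
    have "real (the_block_cost Y p R [e]) + 1 + s * ?v \<le> (1 + s * ?v) * H ^ R"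
      using c.block_cost_le[of "slice Y p" R "[e]"] slice_Q[OF Y p] that unfolding P HH by simp
    also have "\<dots> \<le> (s * ?v + s * ?v) * H ^ R"
    proof (intro mult_right_mono add_right_mono)
      have "1 * 1 \<le> s * ?v" using s_ge_1 v1 by (intro mult_mono) auto
      then show "1 \<le> s * ?v" by simp
    qed (use HR in simp)
    moreover have "0 \<le> s * ?v" using v1 by simp
    ultimately show ?thesis by simp
  qed
  have cleanup: "real (the_cleanup_cost Y p T) \<le> s * ?v + s * ?B" if T: "T \<in> F" for T
  proof -
    have sub: "set (phase.res el (uncovered Y p) T) \<subseteq> uncovered Y p"
      by (auto simp: phase.res_def)
    have "card (set (phase.res el (uncovered Y p) T)) \<le> card (set (el T))"
      by (rule card_mono) (auto simp: phase.res_def)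
    also have "\<dots> \<le> s"
      using length_el[OF F_el[OF T]] card_length le_trans by blast
    finally have card: "card (set (phase.res el (uncovered Y p) T)) \<le> s" .
    have "real (the_cleanup_cost Y p T) \<le> s * ?v + (\<Sum>e\<in>set (phase.res el (uncovered Y p) T). ?B)"
      unfolding phase.cleanup_cost_def of_nat_add of_nat_sum
      using sub by (intro add_mono c.w_le[OF T] sum_mono block) auto
    also have "\<dots> \<le> s * ?v + s * ?B"
      using card v1 HR by (auto intro!: mult_right_mono)
    finally show ?thesis .
  qed
  have "real (cost Y (Suc p) e) + 1 \<le> ?v + ?B + t + t * (s * ?v + s * ?B)"
  proof (cases "e \<in> uncovered Y p")
    case False
    then show ?thesis
      using Suc.IH[of e] Suc.prems v1 HR by (simp add: add_increasing2)
  next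
    case True
    have "real (\<Sum>T\<in>set (st e). the_cleanup_cost Y p T) \<le> (\<Sum>T\<in>set (st e). s * ?v + s * ?B)"
      unfolding of_nat_sum using set_st[OF Suc.prems(2)] by (intro sum_mono cleanup) auto
    also have "\<dots> = card (set (st e)) * (s * ?v + s * ?B)" by simp
    also have "\<dots> \<le> t * (s * ?v + s * ?B)"
    proof (rule mult_right_mono)
      show "real (card (set (st e))) \<le> real t"
        using length_st[OF Suc.prems(2)] card_length[of "st e"] by simp
      show "0 \<le> s * ?v + s * ?B" using v1 HR by simp
    qed
    finally have sum: "real (\<Sum>T\<in>set (st e). the_cleanup_cost Y p T) \<le> t * (s * ?v + s * ?B)" .
    have nn: "0 \<le> t * (s * ?v + s * ?B)" using v1 HR by simp
    have "real (cost Y (Suc p) e) + 1 \<le> real (cost Y p e) + 1 + real (the_block_cost Y p R [e]) +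
        (t + t * (s * ?v + s * ?B))"
      using True sum nn by simp
    also have "\<dots> \<le> ?v + ?B + (t + t * (s * ?v + s * ?B))"
      using Suc.IH[of e] Suc.prems block[OF True] by (intro add_mono) auto
    finally show ?thesis by simp
  qed
  also have "\<dots> \<le> ?v + ?B + t * ?v + t * (s * ?v + s * ?B)"
    using v1 by (intro add_mono order_refl) (simp add: mult_le_cancel_left1)
  also have "\<dots> = G\<^sub>0 ^ Suc p"
    by (simp add: G\<^sub>0_def algebra_simps)
  finally show ?case by simp
qed

end

section \<open>Expected costs and selections in one phase, given the earlier ones\<close>

context lca_analysis begin

text \<open>The summand \<open>num_elements I\<close> allows additive terms, such as
  \<open>t\<close> queries per element, to be bounded by multiples of \<open>C\<close>, and it is
  the value for \<open>p = 0\<close>.\<close>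

definition C :: "outcome \<Rightarrow> nat \<Rightarrow> real" where
  "C Y p = real (num_elements I) + (\<Sum>e\<in>E. real (cost Y p e))"

lemma L_pos: "0 < L"
  using s_less s_ge_1 by (cases L) auto

lemma B\<^sub>0_nonneg: "0 \<le> B\<^sub>0"
  using lam_ge_1 by (simp add: B\<^sub>0_def)

lemma X\<^sub>0_nonneg: "0 \<le> X\<^sub>0"
  using B\<^sub>0_nonneg by (simp add: X\<^sub>0_def)

lemma G_ge_1: "1 \<le> G"
  using B\<^sub>0_nonneg X\<^sub>0_nonneg by (simp add: G_def)

lemma C_nonneg: "0 \<le> C Y p"
  by (simp add: C_def sum_nonneg)

lemma double_count_E:
  fixes f :: "nat \<Rightarrow> nat \<Rightarrow> real"
  shows "(\<Sum>T\<in>F. \<Sum>e\<in>set (el T). f T e) = (\<Sum>e\<in>E. \<Sum>T\<in>set (st e). f T e)"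
proof -
  interpret c: random_phase el st "uncovered Y 0" F t a d b "L - 0" R for Y
    by (rule random_phase[OF L_pos])
  have "set (el T) \<inter> E = set (el T)" if "T \<in> F" for T
    using el_subset[OF F_el[OF that]] by blast
  then show ?thesis
    using c.double_count[of E _ f] by simp
qed

lemma card_F: "card F \<le> num_elements I * t"
proof -
  have "real (card F) = (\<Sum>T\<in>F. 1)" by simp
  also have "\<dots> \<le> (\<Sum>T\<in>F. \<Sum>e\<in>set (el T). 1)"
  proof (rule sum_mono)
    fix T assume "T \<in> F"
    then have "0 < card (set (el T))" by (simp add: F_def card_gt_0_iff)
    then show "(1::real) \<le> (\<Sum>e\<in>set (el T). 1)" by simp
  qed
  also have "\<dots> = (\<Sum>e\<in>E. \<Sum>T\<in>set (st e). 1)" by (rule double_count_E)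
  also have "\<dots> \<le> (\<Sum>e\<in>E. real t)"
  proof (rule sum_mono)
    fix e assume "e \<in> E"
    then show "(\<Sum>T\<in>set (st e). 1) \<le> real t"
      using length_st[of e] card_length[of "st e"] by simp
  qed
  finally show ?thesis by (simp flip: of_nat_mult)
qed

lemma sum_set_cost: "(\<Sum>T\<in>F. real (set_cost (cost Y p) T)) \<le> real s * real t * C Y p"
proof -
  have "(\<Sum>T\<in>F. real (set_cost (cost Y p) T)) =
      real s * real (card F) + (\<Sum>T\<in>F. \<Sum>e\<in>set (el T). real (cost Y p e))"
    by (simp add: set_cost_def sum.distrib mult.commute)
  also have "(\<Sum>T\<in>F. \<Sum>e\<in>set (el T). real (cost Y p e)) = (\<Sum>e\<in>E. card (set (st e)) * real (cost Y p e))"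
    unfolding double_count_E by simp
  also have "\<dots> \<le> (\<Sum>e\<in>E. real t * real (cost Y p e))"
  proof (intro sum_mono mult_right_mono)
    fix e assume "e \<in> E"
    then show "real (card (set (st e))) \<le> real t"
      using length_st[of e] card_length[of "st e"] by simp
  qed simp
  also have "\<dots> = 1 * (real t * (\<Sum>e\<in>E. real (cost Y p e)))" by (simp add: sum_distrib_left)
  also have "\<dots> \<le> real s * (real t * (\<Sum>e\<in>E. real (cost Y p e)))"
    using s_ge_1 by (intro mult_right_mono) (auto intro!: mult_nonneg_nonneg sum_nonneg)
  also have "real s * real (card F) \<le> real s * (real (num_elements I) * real t)"
    using card_F by (intro mult_left_mono) (simp_all flip: of_nat_mult)
  finally show ?thesis by (simp add: C_def algebra_simps)
qed

context
  fixes Y p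
  assumes Y: "Y \<in> set_pmf Q" and p: "p < L"
begin

interpretation c: random_phase_cost el st "uncovered Y p" F t a d b "L - p" R
    "set_cost (cost Y p)" "s * G\<^sub>0 ^ p" lam
  by (rule random_phase_cost[OF p]) (use cost_le[OF Y] p in simp)

definition block_total :: "phase_outcome \<Rightarrow> real" where
  "block_total z = (\<Sum>e\<in>uncovered Y p. real (c.block_cost t (set_cost (cost Y p)) z R [e]))"

lemma c_P: "c.P = phase_pmf p"
  by (simp add: c.keys_def phase_keys_def)

lemma c_A: "c.A \<le> real s * real t * C Y p"
  using sum_set_cost[of Y p] by (simp add: c.A_def)

lemma B\<^sub>0_eq: "2 ^ R * (2 + t) * (1 + Suc d * lam) ^ R = B\<^sub>0"
  by (simp only: B\<^sub>0_def of_nat_mult of_nat_add of_nat_power of_nat_numeral)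

lemma expected_block_total:
  "measure_pmf.expectation (phase_pmf p) block_total \<le> X\<^sub>0 * c.A"
proof -
  have "measure_pmf.expectation (phase_pmf p) block_total \<le>
      R * (t + 2 ^ (L - p) * (2 ^ R * (2 + t) * (1 + Suc d * lam) ^ R)) * c.A"
    unfolding block_total_def using c.expected_block_cost unfolding c_P .
  also have "\<dots> = R * (t + 2 ^ (L - p) * B\<^sub>0) * c.A"
    by (simp only: B\<^sub>0_eq)
  also have "\<dots> \<le> X\<^sub>0 * c.A"
    unfolding X\<^sub>0_def using B\<^sub>0_nonneg c.A_nonneg
    by (intro mult_right_mono mult_left_mono add_left_mono power_increasing) auto
  finally show ?thesis .
qed

text \<open>The block test of an element is part of the cleanup of every set containing it, hence
  occurs at most \<open>t\<close> times.\<close>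

lemma sum_cleanup_cost:
  "(\<Sum>T\<in>F. real (c.cleanup_cost t (set_cost (cost Y p)) z R T)) \<le> c.A + t * block_total z"
proof -
  let ?bc = "\<lambda>e. real (c.block_cost t (set_cost (cost Y p)) z R [e])"
  have set: "set (c.res T) = set (el T) \<inter> uncovered Y p" for T
    by (auto simp: c.res_def)
  have "(\<Sum>T\<in>F. \<Sum>e\<in>set (el T) \<inter> uncovered Y p. ?bc e) = (\<Sum>e\<in>uncovered Y p. \<Sum>T\<in>set (st e). ?bc e)"
    by (rule c.double_count[OF order_refl])
  also have "\<dots> \<le> (\<Sum>e\<in>uncovered Y p. real t * ?bc e)"
  proof (rule sum_mono)
    fix e assume "e \<in> uncovered Y p"
    then have "real (card (set (st e))) \<le> real t" using c.card_st by simp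
    then show "(\<Sum>T\<in>set (st e). ?bc e) \<le> real t * ?bc e"
      unfolding sum_constant by (rule mult_right_mono) simp
  qed
  also have "\<dots> = real t * block_total z"
    unfolding block_total_def by (rule sum_distrib_left[symmetric])
  finally have "(\<Sum>T\<in>F. \<Sum>e\<in>set (el T) \<inter> uncovered Y p. ?bc e) \<le> real t * block_total z" .
  moreover have "(\<Sum>T\<in>F. real (c.cleanup_cost t (set_cost (cost Y p)) z R T)) =
      c.A + (\<Sum>T\<in>F. \<Sum>e\<in>set (el T) \<inter> uncovered Y p. ?bc e)"
    by (simp add: c.cleanup_cost_def sum.distrib c.A_def set)
  ultimately show ?thesis by linarith
qed

text \<open>Each uncovered element pays for its own block test; the cleanup of a set is evaluated
  for each of its at most \<open>s\<close> elements.\<close>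

lemma C_put_Suc:
  "C (put Y p z) (Suc p) \<le>
    C Y p + block_total z + real t * real (num_elements I) + real s * (c.A + real t * block_total z)"
proof -
  let ?w = "set_cost (cost Y p)" and ?U = "uncovered Y p"
  let ?bc = "\<lambda>e. real (c.block_cost t ?w z R [e])" and ?cc = "\<lambda>T. real (c.cleanup_cost t ?w z R T)"
  let ?x = "\<lambda>e. ?bc e + real t + (\<Sum>T\<in>set (st e). ?cc T)"
  have sub: "?U \<subseteq> E" by (rule uncovered_subset)
  have x0: "0 \<le> ?x e" for e by (simp add: sum_nonneg)
  have "(\<Sum>e\<in>E. real (cost (put Y p z) (Suc p) e)) \<le> (\<Sum>e\<in>E. real (cost Y p e) + of_bool (e \<in> ?U) * ?x e)"
  proof (rule sum_mono)
    fix e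
    have "real (cost (put Y p z) (Suc p) e) = real (cost Y p e) + (if e \<in> ?U then ?bc e +
        (if e \<in> c.lev z R then real t + (\<Sum>T\<in>set (st e). ?cc T) else 0) else 0)"
      by (simp only: cost.simps uncovered_put cost_put slice_put_same of_nat_add of_nat_sum if_distrib[of real] of_nat_0)
    also have "\<dots> \<le> real (cost Y p e) + of_bool (e \<in> ?U) * ?x e"
      using sum_nonneg[of "set (st e)" ?cc] by (cases "e \<in> ?U"; cases "e \<in> c.lev z R") simp_all
    finally show "real (cost (put Y p z) (Suc p) e) \<le> real (cost Y p e) + of_bool (e \<in> ?U) * ?x e" .
  qed
  also have "\<dots> = (\<Sum>e\<in>E. real (cost Y p e)) + (\<Sum>e\<in>?U. ?x e)"
  proof -
    have "(\<Sum>e\<in>E. of_bool (e \<in> ?U) * ?x e) = (\<Sum>e\<in>?U. ?x e)"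
      using sub by (intro sum.mono_neutral_cong_right) auto
    then show ?thesis by (simp only: sum.distrib)
  qed
  also have "(\<Sum>e\<in>?U. ?x e) = block_total z + t * real (card ?U) + (\<Sum>e\<in>?U. \<Sum>T\<in>set (st e). ?cc T)"
    by (simp add: sum.distrib block_total_def)
  also have "(\<Sum>e\<in>?U. \<Sum>T\<in>set (st e). ?cc T) = (\<Sum>T\<in>F. \<Sum>e\<in>set (el T) \<inter> ?U. ?cc T)"
    by (rule c.double_count[OF order_refl, symmetric])
  also have "\<dots> = (\<Sum>T\<in>F. real (card (set (el T) \<inter> ?U)) * ?cc T)" by simp
  also have "\<dots> \<le> (\<Sum>T\<in>F. real s * ?cc T)"
  proof (intro sum_mono mult_right_mono)
    fix T assume "T \<in> F"
    then have "length (el T) \<le> s" by (intro length_el F_el)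
    moreover have "card (set (el T) \<inter> ?U) \<le> card (set (el T))" by (intro card_mono) auto
    ultimately show "real (card (set (el T) \<inter> ?U)) \<le> real s"
      using card_length[of "el T"] by simp
  qed simp
  also have "\<dots> = s * (\<Sum>T\<in>F. ?cc T)" by (simp add: sum_distrib_left)
  also have "\<dots> \<le> s * (c.A + t * block_total z)"
    by (intro mult_left_mono sum_cleanup_cost) simp
  also have "real t * real (card ?U) \<le> t * real (num_elements I)"
    using card_mono[OF _ sub] by (intro mult_left_mono) simp_all
  finally show ?thesis by (simp add: C_def)
qed

lemma expected_C_step:
  "measure_pmf.expectation (phase_pmf p) (\<lambda>z. C (put Y p z) (Suc p)) \<le> G * C Y p"
proof -
  let ?E = "measure_pmf.expectation (phase_pmf p)"
  have n: "real (num_elements I) \<le> C Y p" by (simp add: C_def sum_nonneg)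
  have "?E (\<lambda>z. C (put Y p z) (Suc p)) \<le>
      ?E (\<lambda>z. C Y p + t * real (num_elements I) + s * c.A + (1 + s * t) * block_total z)"
    by (intro integral_mono) (use C_put_Suc in \<open>simp_all add: algebra_simps\<close>)
  also have "\<dots> = C Y p + t * real (num_elements I) + s * c.A + (1 + s * t) * ?E block_total"
    by simp
  also have "\<dots> \<le> C Y p + t * C Y p + s * (real s * real t * C Y p) + (1 + s * t) * (X\<^sub>0 * (real s * real t * C Y p))"
    using n c_A X\<^sub>0_nonneg
    by (intro add_mono mult_left_mono order_refl order_trans[OF expected_block_total]) auto
  also have "\<dots> \<le> G * C Y p"
  proof -
    have "0 \<le> (real R * B\<^sub>0 + 1) * (real s * real t) * C Y p"
      using B\<^sub>0_nonneg C_nonneg by simp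
    then show ?thesis by (simp add: G_def algebra_simps)
  qed
  finally show ?thesis .
qed

lemma expected_phase_cost:
  "measure_pmf.expectation (phase_pmf p) (\<lambda>z. \<Sum>T\<in>F. real (phase_cost (put Y p z) p T)) \<le> G * C Y p"
proof -
  let ?E = "measure_pmf.expectation (phase_pmf p)"
  have eq: "(\<Sum>T\<in>F. real (phase_cost (put Y p z) p T)) =
      (\<Sum>j<R. \<Sum>T\<in>F. \<Sum>n<2 ^ j. c.tc z j T n) + (\<Sum>T\<in>F. real (c.cleanup_cost t (set_cost (cost Y p)) z R T))" for z
  proof -
    have "real (phase_cost (put Y p z) p T) =
       (\<Sum>j<R. \<Sum>n<2 ^ j. c.tc z j T n) + real (c.cleanup_cost t (set_cost (cost Y p)) z R T)" for T
      by (simp add: phase_cost_def c.tc_def slice_put_same put_def)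
    then show ?thesis
      by (simp add: sum.distrib sum.swap[of _ "{..<R}" F])
  qed
  have "?E (\<lambda>z. \<Sum>T\<in>F. real (phase_cost (put Y p z) p T)) \<le>
      ?E (\<lambda>z. (\<Sum>j<R. \<Sum>T\<in>F. \<Sum>n<2 ^ j. c.tc z j T n) + (c.A + t * block_total z))"
    unfolding eq by (intro integral_mono add_left_mono sum_cleanup_cost) simp_all
  also have "\<dots> = (\<Sum>j<R. c.\<Phi> j) + (c.A + t * ?E block_total)"
    unfolding c.\<Phi>_def c_P
    by (subst Bochner_Integration.integral_add, simp, simp, subst Bochner_Integration.integral_sum, simp) simp
  also have "\<dots> \<le> (\<Sum>j<R. B\<^sub>0 * c.A) + (c.A + t * (X\<^sub>0 * c.A))"
    using c.\<Phi>_bound unfolding B\<^sub>0_eq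
    by (intro add_mono sum_mono mult_left_mono expected_block_total order_refl) auto
  also have "\<dots> = (R * B\<^sub>0 + 1 + t * X\<^sub>0) * c.A" by (simp add: algebra_simps)
  also have "\<dots> \<le> (R * B\<^sub>0 + 1 + t * X\<^sub>0) * (real s * real t * C Y p)"
    using B\<^sub>0_nonneg X\<^sub>0_nonneg by (intro mult_left_mono c_A) simp
  also have "\<dots> \<le> (R * B\<^sub>0 + 1 + (1 + real s * real t) * X\<^sub>0) * (real s * real t * C Y p)"
  proof (intro mult_right_mono add_left_mono)
    have "1 * real t \<le> real s * real t" using s_ge_1 by (intro mult_right_mono) auto
    then show "real t \<le> 1 + real s * real t" by simp
  qed (use X\<^sub>0_nonneg C_nonneg in auto)
  also have "\<dots> \<le> G * C Y p"
  proof -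
    have "0 \<le> (1 + real t + real s * real s * real t) * C Y p" using C_nonneg by simp
    then show ?thesis by (simp add: G_def algebra_simps)
  qed
  finally show ?thesis .
qed

text \<open>The trials give 17 and the cleanups 2. At most \<open>t\<close> sets per uncovered
  element can need cleanup, each with probability at most
  \<open>exp (- (2 ^ b)) \<le> 1 / (s * t)\<close>, and
  \<open>2 ^ (L - p) \<le> 2 * s\<close>.\<close>

lemma expected_chosen_phase:
  "measure_pmf.expectation (phase_pmf p) (\<lambda>z. \<Sum>T\<in>F. of_bool (chosen (put Y p z) p T)) \<le>
     19 * card (uncovered Y p) / 2 ^ (L - p)"
proof -
  let ?E = "measure_pmf.expectation (phase_pmf p)" and ?U = "uncovered Y p" and ?k = "L - p"
  let ?F = "{T \<in> F. set (el T) \<inter> ?U \<noteq> {}}"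
  let ?cl = "\<lambda>z T. 2 ^ (?k - 1) \<le> card (set (el T) \<inter> c.lev z R)"
  have pointwise: "(\<Sum>T\<in>F. of_bool (chosen (put Y p z) p T)) \<le>
     (\<Sum>j<R. \<Sum>T\<in>F. \<Sum>n<2 ^ j. of_bool (c.succeeds (c.lev z j) (z (j, T, n)) T)) + (\<Sum>T\<in>?F. (of_bool (?cl z T) :: real))" for z
  proof -
    let ?s = "\<lambda>j T n. of_bool (c.succeeds (c.lev z j) (z (j, T, n)) T) :: real"
    have "of_bool (chosen (put Y p z) p T) \<le> (\<Sum>j<R. \<Sum>n<2 ^ j. ?s j T n) + of_bool (T \<in> ?F \<and> ?cl z T)"
      if T: "T \<in> F" for T
    proof (cases "\<exists>j<R. \<exists>n<2 ^ j. c.succeeds (c.lev z j) (z (j, T, n)) T")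
      case True
      then obtain j n where jn: "j < R" "n < 2 ^ j" "c.succeeds (c.lev z j) (z (j, T, n)) T" by blast
      have "1 = ?s j T n" using jn by simp
      also have "\<dots> \<le> (\<Sum>n<2 ^ j. ?s j T n)" using jn by (intro member_le_sum) auto
      also have "\<dots> \<le> (\<Sum>j<R. \<Sum>n<2 ^ j. ?s j T n)"
        using jn by (intro member_le_sum[of j "{..<R}" "\<lambda>j. \<Sum>n<2 ^ j. ?s j T n"] sum_nonneg) auto
      finally show ?thesis by (simp add: add_increasing2 of_bool_def del: sum_of_bool_eq)
    next
      case False
      have "?cl z T \<Longrightarrow> set (el T) \<inter> ?U \<noteq> {}"
        using c.lev_subset[of z R] by (metis Int_empty_right Int_mono card.empty le_zero_eq order_refl power_eq_0_iff subset_empty zero_neq_numeral)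
      then show ?thesis
        using False T
        by (auto simp: chosen_def wins_def needs_cleanup_def slice_put_same put_def sum_nonneg simp del: sum_of_bool_eq)
    qed
    then have "(\<Sum>T\<in>F. of_bool (chosen (put Y p z) p T)) \<le>
      (\<Sum>T\<in>F. (\<Sum>j<R. \<Sum>n<2 ^ j. ?s j T n) + of_bool (T \<in> ?F \<and> ?cl z T))"
      by (rule sum_mono)
    also have "\<dots> = (\<Sum>j<R. \<Sum>T\<in>F. \<Sum>n<2 ^ j. ?s j T n) + (\<Sum>T\<in>F. of_bool (T \<in> ?F \<and> ?cl z T))"
      unfolding sum.distrib by (subst sum.swap) (rule refl)
    also have "(\<Sum>T\<in>F. of_bool (T \<in> ?F \<and> ?cl z T)) = (\<Sum>T\<in>?F. (of_bool (?cl z T) :: real))"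
      by (rule sum.mono_neutral_cong_right) auto
    finally show ?thesis .
  qed
  have "?E (\<lambda>z. \<Sum>T\<in>F. of_bool (chosen (put Y p z) p T)) \<le>
     ?E (\<lambda>z. (\<Sum>j<R. \<Sum>T\<in>F. \<Sum>n<2 ^ j. of_bool (c.succeeds (c.lev z j) (z (j, T, n)) T)) + (\<Sum>T\<in>?F. (of_bool (?cl z T) :: real)))"
    by (rule integral_mono[OF integrable_P integrable_P pointwise])
  also have "\<dots> = ?E (\<lambda>z. \<Sum>j<R. \<Sum>T\<in>F. \<Sum>n<2 ^ j. of_bool (c.succeeds (c.lev z j) (z (j, T, n)) T)) +
      (\<Sum>T\<in>?F. ?E (\<lambda>z. of_bool (?cl z T)))"
    by (simp only: Bochner_Integration.integral_add Bochner_Integration.integral_sum integrable_P)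
  also have "\<dots> \<le> 17 * card ?U / 2 ^ ?k + (\<Sum>T\<in>?F. exp (- (2 ^ b)))"
    using c.expected_successes c.expected_cleanup unfolding c_P by (intro add_mono sum_mono) auto
  also have "(\<Sum>T\<in>?F. exp (- (2 ^ b))) \<le> 2 * card ?U / 2 ^ ?k"
  proof -
    have "real (card ?F) = (\<Sum>T\<in>?F. 1)" by simp
    also have "\<dots> \<le> (\<Sum>T\<in>?F. \<Sum>e\<in>set (el T) \<inter> ?U. 1)"
    proof (rule sum_mono)
      fix T assume "T \<in> ?F"
      then have "0 < card (set (el T) \<inter> ?U)" by (simp add: card_gt_0_iff)
      then show "(1::real) \<le> (\<Sum>e\<in>set (el T) \<inter> ?U. 1)" by simp
    qed
    also have "\<dots> \<le> (\<Sum>T\<in>F. \<Sum>e\<in>set (el T) \<inter> ?U. 1)"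
      by (rule sum_mono2) auto
    also have "\<dots> = (\<Sum>e\<in>?U. \<Sum>T\<in>set (st e). 1)"
      by (rule c.double_count[OF order_refl])
    also have "\<dots> \<le> (\<Sum>e\<in>?U. real t)"
      proof (rule sum_mono)
      fix e assume "e \<in> ?U"
      then show "(\<Sum>T\<in>set (st e). 1) \<le> real t" using c.card_st[of e] by simp
    qed
    finally have F: "real (card ?F) \<le> card ?U * real t" by simp
    have "real s * real t \<le> 2 ^ 2 ^ b"
      using st_le by (metis of_nat_le_iff of_nat_mult of_nat_numeral of_nat_power)
    also have "\<dots> \<le> exp 1 ^ 2 ^ b"
      using exp_ge_add_one_self[of 1] by (intro power_mono) auto
    also have "\<dots> = exp (2 ^ b)" by (simp flip: exp_of_nat_mult)
    finally have "exp (- (2 ^ b)) \<le> 1 / (real s * real t)"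
      using s_ge_1 t_ge_1 by (simp add: exp_minus field_simps)
    then have "real (card ?F) * exp (- (2 ^ b)) \<le> (card ?U * real t) * (1 / (real s * real t))"
      using F by (intro mult_mono) auto
    also have "\<dots> = card ?U / real s" using t_ge_1 by simp
    also have "\<dots> \<le> card ?U / (2 ^ ?k / 2)"
    proof (intro divide_left_mono)
      have "(2::real) ^ ?k \<le> 2 ^ L" by (intro power_increasing) simp_all
      also have "\<dots> \<le> 2 * real s"
        using L_le by (metis of_nat_le_iff of_nat_mult of_nat_numeral of_nat_power)
      finally show "2 ^ ?k / 2 \<le> real s" by simp
    qed (use s_ge_1 in auto)
    finally show ?thesis by (simp add: mult.commute)
  qed
  finally show ?thesis by (simp add: field_simps)
qed

end

end

section \<open>Restriction to finitely many trials\<close>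

context phase begin

text \<open>Only trials of levels below \<open>r\<close>, of sets in \<open>S\<close> and with
  number below \<open>2 ^ j\<close> are consulted. This justifies replacing the outcome of the whole
  tape by a finite table.\<close>

lemma lev_agree:
  assumes "\<And>e. e \<in> U \<Longrightarrow> set (st e) \<subseteq> S"
    and "\<And>j T n. j < r \<Longrightarrow> T \<in> S \<Longrightarrow> n < 2 ^ j \<Longrightarrow> y (j, T, n) = y' (j, T, n)"
  shows "j \<le> r \<Longrightarrow> lev y j = lev y' j"
proof (induction j)
  case 0
  then show ?case by simp
next
  case (Suc j)
  then have IH: "lev y j = lev y' j" by simp
  have "y (j, T, n) = y' (j, T, n)" if "e \<in> lev y' j" "T \<in> set (st e)" "n < 2 ^ j" for e T n
    using that assms(1)[of e] lev_subset[of y' j] Suc.prems by (intro assms(2)) auto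
  then have "succeeds (lev y' j) (y (j, T, n)) T = succeeds (lev y' j) (y' (j, T, n)) T"
    if "e \<in> lev y' j" "T \<in> set (st e)" "n < 2 ^ j" for e T n
    using that by metis
  then show ?case unfolding lev.simps IH by blast
qed

lemma block_cost_agree:
  assumes "\<And>e. e \<in> U \<Longrightarrow> set (st e) \<subseteq> S"
    and "\<And>j T n. j < r \<Longrightarrow> T \<in> S \<Longrightarrow> n < 2 ^ j \<Longrightarrow> y (j, T, n) = y' (j, T, n)"
  shows "j \<le> r \<Longrightarrow> block_cost t w y j = block_cost t w y' j"
proof (induction j)
  case 0
  then show ?case by (simp add: fun_eq_iff)
next
  case (Suc j)
  then have IH: "block_cost t w y j = block_cost t w y' j" by simp
  have lev: "lev y j = lev y' j"
    by (rule lev_agree[where r = r and S = S]) (use assms Suc.prems in auto)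
  show ?case
  proof (rule ext)
    fix es
    have "(\<Sum>T\<in>set (st e). \<Sum>n<2 ^ j. trial_cost w (block_cost t w y' j) (y (j, T, n)) T) =
        (\<Sum>T\<in>set (st e). \<Sum>n<2 ^ j. trial_cost w (block_cost t w y' j) (y' (j, T, n)) T)"
      if "e \<in> lev y' j" for e
    proof (intro sum.cong refl)
      fix T n assume "T \<in> set (st e)" "n \<in> {..<(2::nat) ^ j}"
      then have "y (j, T, n) = y' (j, T, n)"
        using that assms(1)[of e] lev_subset[of y' j] Suc.prems by (intro assms(2)) auto
      then show "trial_cost w (block_cost t w y' j) (y (j, T, n)) T =
          trial_cost w (block_cost t w y' j) (y' (j, T, n)) T" by simp
    qed
    then have sums: "map (\<lambda>e. t + (\<Sum>T\<in>set (st e). \<Sum>n<2 ^ j. trial_cost w (block_cost t w y' j) (y (j, T, n)) T)) es =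
        map (\<lambda>e. t + (\<Sum>T\<in>set (st e). \<Sum>n<2 ^ j. trial_cost w (block_cost t w y' j) (y' (j, T, n)) T)) es"
      if "set es \<subseteq> lev y' j"
      using that by (intro map_cong refl arg_cong2[of _ _ _ _ "(+)"]) auto
    then show "block_cost t w y (Suc j) es = block_cost t w y' (Suc j) es"
      unfolding block_cost.simps IH lev by (cases "set es \<subseteq> lev y' j") (simp_all only: sums if_True if_False)
  qed
qed

end

context lca_analysis begin

lemma agree:
  assumes "\<And>\<kappa>. \<kappa> \<in> {..<L} \<times> phase_keys \<Longrightarrow> Y \<kappa> = Y' \<kappa>"
  shows uncovered_agree: "p \<le> L \<Longrightarrow> uncovered Y p = uncovered Y' p"
    and cost_agree: "p \<le> L \<Longrightarrow> cost Y p = cost Y' p"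
proof -
  have st: "set (st e) \<subseteq> F" if "e \<in> uncovered Y' p" for e p
    using set_st[of e] subsetD[OF uncovered_subset that] by blast
  have slice: "slice Y p (j, T, n) = slice Y' p (j, T, n)"
    if "p < L" "j < R" "T \<in> F" "n < 2 ^ j" for p j T n
    using that by (simp add: slice_def assms phase_keys_def)
  have lev: "phase.lev el st (uncovered Y' p) (slice Y p) R = phase.lev el st (uncovered Y' p) (slice Y' p) R"
    if "p < L" for p
    by (rule phase.lev_agree[where r = R and S = F]) (use st slice that in auto)
  show unc: "p \<le> L \<Longrightarrow> uncovered Y p = uncovered Y' p" for p
  proof (induction p)
    case (Suc p)
    then have "uncovered Y p = uncovered Y' p" "p < L" by auto
    then show ?case by (simp only: uncovered.simps lev)
  qed simp
  show "p \<le> L \<Longrightarrow> cost Y p = cost Y' p"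
  proof (induction p)
    case 0
    then show ?case by (simp add: fun_eq_iff)
  next
    case (Suc p)
    then have p: "p < L" and 1: "cost Y p = cost Y' p" by auto
    have 2: "uncovered Y p = uncovered Y' p" using p by (intro unc) simp
    have 3: "phase.block_cost el st (uncovered Y' p) t w (slice Y p) R =
        phase.block_cost el st (uncovered Y' p) t w (slice Y' p) R" for w
      by (rule phase.block_cost_agree[where r = R and S = F]) (use st slice p in auto)
    show ?case
      by (rule ext) (simp only: cost.simps phase.cleanup_cost_def 1 2 3 lev[OF p])
  qed
qed

lemma chosen_agree:
  assumes Y: "\<And>\<kappa>. \<kappa> \<in> {..<L} \<times> phase_keys \<Longrightarrow> Y \<kappa> = Y' \<kappa>" and p: "p < L" and T: "T \<in> F"
  shows "chosen Y p T = chosen Y' p T" and "phase_cost Y p T = phase_cost Y' p T"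
proof -
  have unc: "uncovered Y p = uncovered Y' p" and cost: "cost Y p = cost Y' p"
    using agree[OF Y] p by auto
  have st: "set (st e) \<subseteq> F" if "e \<in> uncovered Y' p" for e
    using set_st[of e] subsetD[OF uncovered_subset that] by blast
  have key: "Y (p, j, T, n) = Y' (p, j, T, n)" if "j < R" "T \<in> F" "n < 2 ^ j" for j T n
    using that p by (simp add: Y phase_keys_def)
  then have slice: "slice Y p (j, T, n) = slice Y' p (j, T, n)" if "j < R" "T \<in> F" "n < 2 ^ j" for j T n
    using that by (simp add: slice_def)
  have lev: "phase.lev el st (uncovered Y' p) (slice Y p) j = phase.lev el st (uncovered Y' p) (slice Y' p) j"
    if "j \<le> R" for j
    by (rule phase.lev_agree[where r = R and S = F]) (use st slice that in auto)
  have bc: "phase.block_cost el st (uncovered Y' p) t w (slice Y p) j =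
      phase.block_cost el st (uncovered Y' p) t w (slice Y' p) j" if "j \<le> R" for w j
    by (rule phase.block_cost_agree[where r = R and S = F]) (use st slice that in auto)
  have "wins Y p j T n = wins Y' p j T n" if "j < R" "n < 2 ^ j" for j n
    using that lev[of j] key[of j T n] T by (simp add: wins_def unc)
  then show "chosen Y p T = chosen Y' p T"
    using lev[OF order_refl] by (auto simp: chosen_def unc)
  have "the_trial_cost Y p j T n = the_trial_cost Y' p j T n" if "j < R" "n < 2 ^ j" for j n
    using that bc[of j] key[of j T n] T by (simp add: unc cost)
  then show "phase_cost Y p T = phase_cost Y' p T"
    using bc[OF order_refl] unfolding phase_cost_def phase.cleanup_cost_def unc cost
    by (intro arg_cong2[of _ _ _ _ "(+)"] sum.cong refl) auto
qed

section \<open>Expected query cost and cover size over all phases\<close>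

lemma expect_mono_Q:
  "(\<And>Y. Y \<in> set_pmf Q \<Longrightarrow> f Y \<le> (f' Y :: real)) \<Longrightarrow> measure_pmf.expectation Q f \<le> measure_pmf.expectation Q f'"
  by (intro integral_mono_AE AE_pmfI) simp_all

text \<open>Redrawing phase \<open>p\<close> leaves the history before it intact, so
  \<open>expected_C_step\<close> applies to each history and the factors multiply.\<close>

lemma expected_C: "p \<le> L \<Longrightarrow> measure_pmf.expectation Q (\<lambda>Y. C Y p) \<le> G ^ p * num_elements I"
proof (induction p)
  case 0
  then show ?case by (simp add: C_def)
next
  case (Suc p)
  then have p: "p < L" by simp
  have "measure_pmf.expectation Q (\<lambda>Y. C Y (Suc p)) =
      measure_pmf.expectation Q (\<lambda>Y. measure_pmf.expectation (phase_pmf p) (\<lambda>z. C (put Y p z) (Suc p)))"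
    by (rule resample_phase[OF p])
  also have "\<dots> \<le> measure_pmf.expectation Q (\<lambda>Y. G * C Y p)"
    by (intro expect_mono_Q expected_C_step p)
  also have "\<dots> = G * measure_pmf.expectation Q (\<lambda>Y. C Y p)" by simp
  also have "\<dots> \<le> G * (G ^ p * num_elements I)"
    using Suc G_ge_1 by (intro mult_left_mono) auto
  finally show ?case by (simp add: mult.assoc)
qed

definition total_cost :: "outcome \<Rightarrow> nat \<Rightarrow> nat" where
  "total_cost Y T = s + (\<Sum>p<L. phase_cost Y p T)"

lemma expected_total_cost:
  "measure_pmf.expectation Q (\<lambda>Y. \<Sum>T\<in>F. real (total_cost Y T)) \<le> real (Suc L) * G ^ L * num_elements I"
proof -
  let ?E = "measure_pmf.expectation Q"
  have phase: "?E (\<lambda>Y. \<Sum>T\<in>F. real (phase_cost Y p T)) \<le> G ^ L * num_elements I" if p: "p < L" for p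
  proof -
    have "?E (\<lambda>Y. \<Sum>T\<in>F. real (phase_cost Y p T)) =
        ?E (\<lambda>Y. measure_pmf.expectation (phase_pmf p) (\<lambda>z. \<Sum>T\<in>F. real (phase_cost (put Y p z) p T)))"
      by (rule resample_phase[OF p])
    also have "\<dots> \<le> ?E (\<lambda>Y. G * C Y p)"
      by (intro expect_mono_Q expected_phase_cost p)
    also have "\<dots> = G * ?E (\<lambda>Y. C Y p)" by simp
    also have "\<dots> \<le> G * (G ^ p * num_elements I)"
      using expected_C[of p] p G_ge_1 by (intro mult_left_mono) auto
    also have "\<dots> = G ^ Suc p * num_elements I" by simp
    also have "\<dots> \<le> G ^ L * num_elements I"
      using p G_ge_1 by (intro mult_right_mono power_increasing) auto
    finally show ?thesis .
  qed
  have "?E (\<lambda>Y. \<Sum>T\<in>F. real (total_cost Y T)) =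
      ?E (\<lambda>Y. real s * real (card F) + (\<Sum>p<L. \<Sum>T\<in>F. real (phase_cost Y p T)))"
    by (simp add: total_cost_def sum.distrib mult.commute sum.swap[of _ "{..<L}" F])
  also have "\<dots> = real s * real (card F) + (\<Sum>p<L. ?E (\<lambda>Y. \<Sum>T\<in>F. real (phase_cost Y p T)))"
    by simp
  also have "\<dots> \<le> G ^ L * num_elements I + (\<Sum>p<L. G ^ L * num_elements I)"
  proof (intro add_mono sum_mono phase)
    have "real s * real (card F) \<le> real s * (num_elements I * real t)"
      using card_F by (intro mult_left_mono) (simp_all flip: of_nat_mult)
    also have "\<dots> = (real s * real t) * num_elements I" by simp
    also have "\<dots> \<le> G * num_elements I"
    proof (intro mult_right_mono)
      have "0 \<le> real R * B\<^sub>0 * (real s * real t)" "0 \<le> (1 + real s * real t) * X\<^sub>0 * (real s * real t)"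
        using B\<^sub>0_nonneg X\<^sub>0_nonneg by simp_all
      then show "real s * real t \<le> G" by (simp add: G_def distrib_right)
    qed simp
    also have "\<dots> \<le> G ^ L * num_elements I"
      using self_le_power[OF G_ge_1 L_pos] by (intro mult_right_mono) simp_all
    finally show "real s * real (card F) \<le> G ^ L * num_elements I" .
  qed simp
  finally show ?thesis by (simp add: algebra_simps)
qed

text \<open>Weak duality: adding up the covering constraints of the elements of \<open>V\<close>
  counts each \<open>x T\<close> at most \<open>m\<close> times.\<close>

lemma card_le_fractional:
  assumes x: "is_fractional_cover (sc_universe I) (sc_family I) x" and V: "V \<subseteq> E"
    and m: "\<And>T. T \<in> F \<Longrightarrow> card (set (el T) \<inter> V) \<le> m"
  shows "card V \<le> real m * (\<Sum>T\<in>sc_family I. x T)"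
proof -
  have fin: "finite (sc_family I)" by (simp add: sc_family_def)
  have finV: "finite V" using V by (rule finite_subset) simp
  have "real (card V) = (\<Sum>e\<in>V. 1)" by simp
  also have "\<dots> \<le> (\<Sum>e\<in>V. \<Sum>T\<in>{T \<in> sc_family I. e \<in> T}. x T)"
    using x V by (intro sum_mono) (auto simp: is_fractional_cover_def sc_universe_def)
  also have "\<dots> = (\<Sum>e\<in>V. \<Sum>T\<in>sc_family I. if e \<in> T then x T else 0)"
    using fin by (simp add: sum.inter_filter)
  also have "\<dots> = (\<Sum>T\<in>sc_family I. \<Sum>e\<in>V. if e \<in> T then x T else 0)"
    by (rule sum.swap)
  also have "\<dots> = (\<Sum>T\<in>sc_family I. real (card (T \<inter> V)) * x T)"
    using finV by (simp add: sum.inter_filter[symmetric] Int_def conj_commute)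
  also have "\<dots> \<le> (\<Sum>T\<in>sc_family I. real m * x T)"
  proof (intro sum_mono mult_right_mono)
    fix T assume "T \<in> sc_family I"
    then obtain i where i: "i < num_sets I" "T = set (el i)"
      by (auto simp: sc_family_def sc_set_eq)
    show "real (card (T \<inter> V)) \<le> real m"
      using m[of i] i by (cases "el i = []") (auto simp: F_def)
    show "0 \<le> x T" using x \<open>T \<in> sc_family I\<close> by (simp add: is_fractional_cover_def)
  qed
  finally show ?thesis by (simp add: sum_distrib_left)
qed

text \<open>In phase \<open>p\<close> no set has more than \<open>2 ^ (L - p)\<close> uncovered
  elements, so by \<open>card_le_fractional\<close> the bound of
  \<open>expected_chosen_phase\<close> is at most 19 times the value of the fractional
  cover.\<close>

lemma expected_chosen:
  assumes x: "is_fractional_cover (sc_universe I) (sc_family I) x"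
  shows "measure_pmf.expectation Q (\<lambda>Y. \<Sum>T\<in>F. of_bool (\<exists>p<L. chosen Y p T)) \<le>
    19 * real L * (\<Sum>T\<in>sc_family I. x T)"
proof -
  let ?E = "measure_pmf.expectation Q" and ?x = "\<Sum>T\<in>sc_family I. x T"
  have phase: "?E (\<lambda>Y. \<Sum>T\<in>F. of_bool (chosen Y p T)) \<le> 19 * ?x" if p: "p < L" for p
  proof -
    have "?E (\<lambda>Y. \<Sum>T\<in>F. of_bool (chosen Y p T) :: real) =
        ?E (\<lambda>Y. measure_pmf.expectation (phase_pmf p) (\<lambda>z. \<Sum>T\<in>F. of_bool (chosen (put Y p z) p T)))"
      by (rule resample_phase[OF p])
    also have "\<dots> \<le> ?E (\<lambda>Y. 19 * ?x)"
    proof (rule expect_mono_Q)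
      fix Y assume Y: "Y \<in> set_pmf Q"
      have "real (card (uncovered Y p)) \<le> real (2 ^ (L - p)) * ?x"
      proof (rule card_le_fractional[OF x uncovered_subset])
        fix T assume "T \<in> F"
        then show "card (set (el T) \<inter> uncovered Y p) \<le> 2 ^ (L - p)"
          using card_uncovered_less[OF s_less, of T p Y] p by simp
      qed
      then have "19 * card (uncovered Y p) / 2 ^ (L - p) \<le> 19 * ?x"
        by (simp add: field_simps)
      then show "measure_pmf.expectation (phase_pmf p) (\<lambda>z. \<Sum>T\<in>F. of_bool (chosen (put Y p z) p T)) \<le> 19 * ?x"
        using expected_chosen_phase[OF Y p] by linarith
    qed
    also have "\<dots> = 19 * ?x" by simp
    finally show ?thesis .
  qed
  have "?E (\<lambda>Y. \<Sum>T\<in>F. of_bool (\<exists>p<L. chosen Y p T)) \<le> ?E (\<lambda>Y. \<Sum>p<L. \<Sum>T\<in>F. of_bool (chosen Y p T) :: real)"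
  proof (rule expect_mono_Q)
    fix Y
    have "of_bool (\<exists>p<L. chosen Y p T) \<le> (\<Sum>p<L. (of_bool (chosen Y p T) :: real))" for T
    proof (cases "\<exists>p<L. chosen Y p T")
      case True
      then obtain p where "p < L" "chosen Y p T" by blast
      then have "of_bool (chosen Y p T) \<le> (\<Sum>p<L. (of_bool (chosen Y p T) :: real))"
        by (intro member_le_sum) auto
      then show ?thesis using True \<open>chosen Y p T\<close> by (simp del: sum_of_bool_eq)
    qed (simp add: sum_nonneg del: sum_of_bool_eq)
    then have "(\<Sum>T\<in>F. of_bool (\<exists>p<L. chosen Y p T)) \<le> (\<Sum>T\<in>F. \<Sum>p<L. (of_bool (chosen Y p T) :: real))"
      by (rule sum_mono)
    then show "(\<Sum>T\<in>F. of_bool (\<exists>p<L. chosen Y p T)) \<le> (\<Sum>p<L. \<Sum>T\<in>F. (of_bool (chosen Y p T) :: real))"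
      by (simp only: sum.swap[of _ "{..<L}" F])
  qed
  also have "\<dots> = (\<Sum>p<L. ?E (\<lambda>Y. \<Sum>T\<in>F. of_bool (chosen Y p T)))"
    by (rule Bochner_Integration.integral_sum) simp
  also have "\<dots> \<le> (\<Sum>p<L. 19 * ?x)"
    by (intro sum_mono phase) simp
  finally show ?thesis by simp
qed

text \<open>The hypothesis \<open>s \<le> B\<close> prevents the empty set, whose program makes
  \<open>s\<close> queries, from being selected for exceeding the budget.\<close>

lemma answer_truncated:
  assumes "T < num_sets I" "s \<le> B"
  shows "answer I \<omega> (truncate (run_set T Answer) B) \<longleftrightarrow>
    T \<in> F \<and> ((\<exists>p<L. chosen (trial \<omega>) p T) \<or> B < total_cost (trial \<omega>) T)"
  using runs_run_set[OF assms(1), of \<omega>] assms(2)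
  by (auto simp: runs_def answer_truncate total_cost_def)

lemma cover:
  assumes "s \<le> B"
  shows "is_set_cover (sc_universe I) (sc_family I) (lca_output (\<lambda>T. truncate (run_set T Answer) B) I \<omega>)"
proof -
  let ?O = "lca_output (\<lambda>T. truncate (run_set T Answer) B) I \<omega>"
  have sub: "?O \<subseteq> sc_family I" by (auto simp: lca_output_def sc_family_def)
  have "e \<in> \<Union>?O" if e: "e \<in> E" for e
  proof -
    obtain p T where T: "p < L" "T \<in> F" "e \<in> set (el T)" "chosen (trial \<omega>) p T"
      using chosen_covers[OF s_less e] by blast
    then have "answer I \<omega> (truncate (run_set T Answer) B)"
      using answer_truncated[OF F_el[OF T(2)] assms] by blast
    then show ?thesis
      using T F_el[OF T(2)] by (auto simp: lca_output_def sc_set_eq)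
  qed
  moreover have "\<Union>?O \<subseteq> E" using sub Union_family by blast
  ultimately show ?thesis
    using sub by (auto simp: is_set_cover_def sc_universe_def)
qed

text \<open>Markov's inequality in the form
  \<open>of_bool (B < total_cost Y T) \<le> total_cost Y T / B\<close>. The expected total cost is
  at most \<open>B / s\<close> per element, and there are at most \<open>s\<close> times as many
  elements as the value of any fractional cover.\<close>

lemma expected_size_le:
  assumes x: "is_fractional_cover (sc_universe I) (sc_family I) x"
    and B: "s \<le> B" "real s * (real (Suc L) * G ^ L) \<le> B"
  shows "expected_size (\<lambda>T. truncate (run_set T Answer) B) I \<le> (19 * real L + 1) * (\<Sum>T\<in>sc_family I. x T)"
proof -
  let ?K = "{..<L} \<times> phase_keys" and ?E = "measure_pmf.expectation Q"
  let ?sel = "\<lambda>Y. {T \<in> F. (\<exists>p<L. chosen Y p T) \<or> B < total_cost Y T}"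
  let ?f = "\<lambda>Y. real (card (sc_set I ` ?sel Y))"
  have B0: "0 < real B" using B(1) s_ge_1 by simp
  have "lca_output (\<lambda>T. truncate (run_set T Answer) B) I \<omega> =
      sc_set I ` ?sel (\<lambda>\<kappa>. if \<kappa> \<in> ?K then trial \<omega> \<kappa> else None)" for \<omega>
  proof -
    let ?Y = "\<lambda>\<kappa>. if \<kappa> \<in> ?K then trial \<omega> \<kappa> else None"
    have "chosen (trial \<omega>) p T = chosen ?Y p T" "phase_cost (trial \<omega>) p T = phase_cost ?Y p T"
      if "p < L" "T \<in> F" for p T
      using that by (intro chosen_agree; simp)+
    then have "?sel (trial \<omega>) = ?sel ?Y"
      by (auto simp: total_cost_def)
    moreover have "{T. T < num_sets I \<and> answer I \<omega> (truncate (run_set T Answer) B)} = ?sel (trial \<omega>)"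
      using answer_truncated[OF _ B(1)] F_el by blast
    ultimately show ?thesis by (simp only: lca_output_def)
  qed
  then have "expected_size (\<lambda>T. truncate (run_set T Answer) B) I = ?E ?f"
    unfolding expected_size_def by (simp only:) (rule integral_trials, simp)
  also have "\<dots> \<le> ?E (\<lambda>Y. (\<Sum>T\<in>F. of_bool (\<exists>p<L. chosen Y p T)) + (\<Sum>T\<in>F. real (total_cost Y T)) / B)"
  proof (rule expect_mono_Q)
    fix Y
    have "?f Y \<le> real (card (?sel Y))"
      by (simp add: card_image_le)
    also have "\<dots> = (\<Sum>T\<in>F. of_bool ((\<exists>p<L. chosen Y p T) \<or> B < total_cost Y T))"
      by (subst sum_of_bool_eq) (simp_all add: Int_def)
    also have "\<dots> \<le> (\<Sum>T\<in>F. of_bool (\<exists>p<L. chosen Y p T) + real (total_cost Y T) / B)"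
      using B0 by (intro sum_mono) (auto simp: of_bool_def field_simps)
    finally show "?f Y \<le> (\<Sum>T\<in>F. of_bool (\<exists>p<L. chosen Y p T)) + (\<Sum>T\<in>F. real (total_cost Y T)) / B"
      by (simp only: sum.distrib sum_divide_distrib)
  qed
  also have "\<dots> = ?E (\<lambda>Y. \<Sum>T\<in>F. of_bool (\<exists>p<L. chosen Y p T)) + ?E (\<lambda>Y. \<Sum>T\<in>F. real (total_cost Y T)) / B"
    by (simp only: Bochner_Integration.integral_add integrable_Q Bochner_Integration.integral_divide_zero)
  also have "?E (\<lambda>Y. \<Sum>T\<in>F. real (total_cost Y T)) / B \<le> (\<Sum>T\<in>sc_family I. x T)"
  proof -
    have n: "real (num_elements I) \<le> real s * (\<Sum>T\<in>sc_family I. x T)"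
    proof -
      have "real (card E) \<le> real s * (\<Sum>T\<in>sc_family I. x T)"
      proof (rule card_le_fractional[OF x order_refl])
        fix T assume "T \<in> F"
        then have "length (el T) \<le> s" by (intro length_el F_el)
        moreover have "card (set (el T) \<inter> E) \<le> card (set (el T))" by (intro card_mono) auto
        ultimately show "card (set (el T) \<inter> E) \<le> s" using card_length[of "el T"] by linarith
      qed
      then show ?thesis by simp
    qed
    have x0: "0 \<le> (\<Sum>T\<in>sc_family I. x T)"
      using x by (intro sum_nonneg) (simp add: is_fractional_cover_def)
    have "?E (\<lambda>Y. \<Sum>T\<in>F. real (total_cost Y T)) \<le> real (Suc L) * G ^ L * num_elements I"
      by (rule expected_total_cost)
    also have "\<dots> \<le> real (Suc L) * G ^ L * (real s * (\<Sum>T\<in>sc_family I. x T))"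
      using G_ge_1 by (intro mult_left_mono n) auto
    also have "\<dots> = (real s * (real (Suc L) * G ^ L)) * (\<Sum>T\<in>sc_family I. x T)" by simp
    also have "\<dots> \<le> B * (\<Sum>T\<in>sc_family I. x T)"
      using B(2) x0 by (intro mult_right_mono)
    finally show ?thesis using B0 by (simp add: divide_le_eq mult.commute)
  qed
  also have "?E (\<lambda>Y. \<Sum>T\<in>F. of_bool (\<exists>p<L. chosen Y p T)) \<le> 19 * real L * (\<Sum>T\<in>sc_family I. x T)"
    by (rule expected_chosen[OF x])
  finally show ?thesis by (simp add: algebra_simps)
qed

end

section \<open>Choice of the parameters\<close>

text \<open>The binary logarithm rounded up, with value 0 at 0 and at 1.\<close>

definition clog :: "nat \<Rightarrow> nat" where
  "clog n = (LEAST k. n \<le> 2 ^ k)"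

lemma le_two_power_clog: "n \<le> 2 ^ clog n"
  unfolding clog_def by (rule LeastI[of _ n]) (simp add: less_imp_le)

lemma two_power_less_clog: "k < clog n \<Longrightarrow> 2 ^ k < n"
  unfolding clog_def using not_less_Least[of k "\<lambda>k. n \<le> 2 ^ k"] by simp

lemma clog_le:
  assumes "1 \<le> n" shows "real (clog n) \<le> log 2 n + 1"
proof (cases "clog n")
  case 0
  then show ?thesis using assms by simp
next
  case (Suc k)
  then have "(2::nat) ^ k < n" by (intro two_power_less_clog) simp
  then have "(2::real) ^ k \<le> n"
    by (metis less_imp_le of_nat_le_iff of_nat_numeral of_nat_power)
  then have "log 2 (2 ^ k) \<le> log 2 n" using assms by (intro log_mono) simp_all
  then show ?thesis using Suc by (simp add: log_nat_power)
qed

lemma le_two_power: "real n \<le> 2 ^ n"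
  by (metis less_exp less_imp_le of_nat_le_iff of_nat_numeral of_nat_power)

lemma power_le_two_powerI:
  fixes x :: real
  assumes "0 \<le> x" "x \<le> 2 ^ m" shows "x ^ n \<le> 2 ^ (m * n)"
  using power_mono[OF assms(2,1), of n] by (simp add: power_mult)

text \<open>Follows from the tangent of \<open>ln\<close> at 2 and
  \<open>ln 2 \<ge> 2 / 3\<close>.\<close>

lemma log2_le_self:
  fixes y :: real
  assumes "1 \<le> y" shows "log 2 y \<le> y"
proof -
  have "ln (y / 2) \<le> y / 2 - 1" using assms by (intro ln_le_minus_one) simp
  then have "ln y \<le> ln 2 + (y / 2 - 1)" using assms by (simp add: ln_div)
  moreover have "(y - 1) * (2 / 3) \<le> (y - 1) * ln 2"
    using ln2_ge_two_thirds assms by (intro mult_left_mono) simp_all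
  ultimately have "ln y \<le> y * ln 2" using assms unfolding left_diff_distrib by linarith
  then show ?thesis by (simp add: log_def divide_le_eq)
qed

section \<open>Parameters for given degree bounds\<close>

locale lca_parameters =
  fixes s t :: nat
  assumes s: "2 \<le> s" and t: "2 \<le> t"
begin

definition a :: nat where "a = clog t"
definition b :: nat where "b = clog (clog (s * t))"
definition L :: nat where "L = clog (Suc s)"
definition d :: nat where "d = 2 * (a + b) + 5"
definition R :: nat where "R = a + Suc d + 1 + b"
text \<open>A common scale for \<open>a\<close>, \<open>b\<close>, \<open>d\<close> and
  \<open>R\<close>, of order \<open>log t + log log s\<close>.\<close>

definition v :: nat where "v = a + b + 1"
text \<open>Chosen to make \<open>exp (1 - lam / 8)\<close> equal to
  \<open>exp (- (225 * v ^ 2 * L ^ 2))\<close>, which beats the worst-case costs of at most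
  \<open>2 ^ (225 * v ^ 2 * L ^ 2)\<close>.\<close>

definition lam :: real where "lam = 8 * (225 * real v ^ 2 * real L ^ 2 + 1)"

lemma v_ge_1: "1 \<le> v" by (simp add: v_def)

lemma s_less: "s < 2 ^ L"
  using le_two_power_clog[of "Suc s"] by (simp add: L_def)

lemma L_ge_1: "1 \<le> L"
  using s_less s by (cases L) auto

lemma L_le: "2 ^ L \<le> 2 * s"
proof -
  have "2 ^ (L - 1) < Suc s"
    using L_ge_1 by (intro two_power_less_clog) (simp add: L_def)
  then show ?thesis using L_ge_1 by (cases L) auto
qed

lemma t_le: "t \<le> 2 ^ a"
  unfolding a_def by (rule le_two_power_clog)

lemma st_le: "s * t \<le> 2 ^ 2 ^ b"
proof -
  have "s * t \<le> 2 ^ clog (s * t)" by (rule le_two_power_clog)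
  also have "\<dots> \<le> 2 ^ 2 ^ b"
    unfolding b_def by (intro power_increasing le_two_power_clog) simp
  finally show ?thesis .
qed

lemma c_le: "Suc d \<le> 6 * v" and R_le: "R \<le> 7 * v"
  by (simp_all add: d_def R_def v_def)

lemma t_le_v: "real t \<le> 2 ^ v"
proof -
  have "real t \<le> 2 ^ a" using t_le by (metis of_nat_le_iff of_nat_numeral of_nat_power)
  also have "\<dots> \<le> 2 ^ v" by (intro power_increasing) (simp_all add: v_def)
  finally show ?thesis .
qed

lemma s_le_L: "real s \<le> 2 ^ L"
  using s_less by (metis less_imp_le of_nat_le_iff of_nat_numeral of_nat_power)

lemma H_le: "1 + real (Suc d) * real t * 2 ^ R \<le> 2 ^ (15 * v)"
proof -
  have c: "real (Suc d) \<le> 2 ^ (6 * v)"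
    using le_two_power[of "Suc d"] power_increasing[OF c_le, of "2::real"] by linarith
  have R2: "(2::real) ^ R \<le> 2 ^ (7 * v)" by (intro power_increasing R_le) simp
  have "real (Suc d) * real t * 2 ^ R \<le> 2 ^ (6 * v) * 2 ^ v * 2 ^ (7 * v)"
    by (intro mult_mono c t_le_v R2) auto
  also have "\<dots> = 2 ^ (14 * v)" by (simp flip: power_add)
  finally have "1 + real (Suc d) * real t * 2 ^ R \<le> 1 + 2 ^ (14 * v)" by simp
  also have "\<dots> \<le> 2 * 2 ^ (14 * v)" by simp
  also have "\<dots> = 2 ^ (14 * v + 1)" by simp
  also have "\<dots> \<le> 2 ^ (15 * v)" using v_ge_1 by (intro power_increasing) auto
  finally show ?thesis .
qed

text \<open>Exponents of 2 are collected: \<open>15 * 7 = 105\<close> times \<open>v ^ 2\<close> for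
  \<open>H ^ R\<close>, then \<open>3 + 1 + 1 + 1 + 105 = 111\<close> times \<open>v ^ 2 * L\<close>
  for \<open>K\<close>, and \<open>7 + 1 + 1 + 111 + 105 = 225\<close> times
  \<open>v ^ 2 * L ^ 2\<close> for the whole product.\<close>

lemma lam_large:
  "2 ^ R * ((1 + s * (1 + t + t * s + 2 * s * (1 + t * s) * (1 + Suc d * t * 2 ^ R) ^ R) ^ L) *
       (1 + Suc d * t * 2 ^ R) ^ R) * exp (1 - lam / 8) \<le> 1"
proof -
  define H where "H = 1 + real (Suc d) * real t * 2 ^ R"
  define K where "K = 1 + real t + real t * real s + 2 * real s * (1 + real t * real s) * H ^ R"
  have H1: "1 \<le> H" by (simp add: H_def)
  have HR1: "1 \<le> H ^ R" using H1 by (rule one_le_power)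
  have HR: "H ^ R \<le> 2 ^ (105 * v ^ 2)"
  proof -
    have "H ^ R \<le> 2 ^ (15 * v * R)"
      using H_le H1 by (intro power_le_two_powerI) (simp_all add: H_def)
    also have "\<dots> \<le> 2 ^ (105 * v ^ 2)"
      using mult_left_mono[OF R_le, of "15 * v"] by (intro power_increasing) (simp_all add: power2_eq_square)
    finally show ?thesis .
  qed
  have vL: "v \<le> v ^ 2 * L" "L \<le> v ^ 2 * L" "1 \<le> v ^ 2 * L" "v ^ 2 \<le> v ^ 2 * L"
    using v_ge_1 L_ge_1 by (auto simp: power2_eq_square)
  have K: "K \<le> 2 ^ (111 * v ^ 2 * L)"
  proof -
    \<comment> \<open>The summands of \<open>K\<close> are bounded by \<open>3 * N * H ^ R\<close>
      and \<open>4 * N * H ^ R\<close>, and \<open>3 + 4 \<le> 2 ^ 3\<close>.\<close>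
    define N where "N = real t * real s * real s"
    have "1 * 1 \<le> real t * real s" by (intro mult_mono) (use s t in simp_all)
    then have ts: "1 \<le> real t * real s" by (simp only: mult_1)
    have tts: "real t * 1 \<le> real t * real s" using s by (intro mult_left_mono) auto
    have ss: "real t * real s * 1 \<le> N"
      unfolding N_def using s by (intro mult_left_mono) auto
    have N0: "0 \<le> N" by (simp add: N_def)
    have "1 + real t + real t * real s \<le> (3 * N) * 1" using ts tts ss by linarith
    also have "\<dots> \<le> (3 * N) * H ^ R" using N0 by (intro mult_left_mono HR1) simp
    finally have 1: "1 + real t + real t * real s \<le> (3 * N) * H ^ R" .
    have "real s * 1 \<le> real s * (real t * real s)" using ts by (intro mult_left_mono) simp_all
    then have "2 * real s * (1 + real t * real s) \<le> 4 * N"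
      by (simp add: N_def algebra_simps)
    then have "2 * real s * (1 + real t * real s) * H ^ R \<le> (4 * N) * H ^ R"
      by (rule mult_right_mono) (use HR1 in linarith)
    with 1 have "K \<le> (3 * N) * H ^ R + (4 * N) * H ^ R"
      unfolding K_def by (rule add_mono)
    also have "\<dots> = 7 * (real t * real s * real s) * H ^ R" by (simp add: N_def)
    also have "\<dots> \<le> 2 ^ 3 * (2 ^ v * 2 ^ L * 2 ^ L) * 2 ^ (105 * v ^ 2)"
      using HR1 by (intro mult_mono HR t_le_v s_le_L) auto
    also have "\<dots> = 2 ^ (3 + v + L + L + 105 * v ^ 2)"
      by (simp only: power_add mult.assoc)
    also have "\<dots> \<le> 2 ^ (111 * v ^ 2 * L)"
    proof (rule power_increasing)
      have "3 + v + L + L + 105 * v ^ 2 \<le> 111 * (v ^ 2 * L)" using vL by linarith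
      then show "3 + v + L + L + 105 * v ^ 2 \<le> 111 * v ^ 2 * L" by (simp only: mult.assoc)
    qed simp
    finally show ?thesis .
  qed
  have K1: "0 \<le> K" using HR1 by (simp add: K_def)
  have "K ^ L \<le> 2 ^ (111 * v ^ 2 * L * L)"
    by (rule power_le_two_powerI[OF K1 K])
  then have "1 + real s * K ^ L \<le> 1 + 2 ^ L * 2 ^ (111 * v ^ 2 * L * L)"
    using K1 by (intro add_left_mono mult_mono s_le_L) auto
  also have "\<dots> \<le> 2 * 2 ^ (L + 111 * v ^ 2 * L * L)"
    by (simp add: power_add one_le_power mult_ge1_I)
  finally have M: "1 + real s * K ^ L \<le> 2 ^ (1 + L + 111 * v ^ 2 * L * L)" by simp
  have "2 ^ R * ((1 + real s * K ^ L) * H ^ R) \<le> 2 ^ (7 * v) * (2 ^ (1 + L + 111 * v ^ 2 * L * L) * 2 ^ (105 * v ^ 2))"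
    using K1 H1 HR M by (intro mult_mono power_increasing R_le) auto
  also have "\<dots> = 2 ^ (7 * v + (1 + L + 111 * v ^ 2 * L * L + 105 * v ^ 2))"
    by (simp only: power_add)
  also have "\<dots> \<le> 2 ^ (225 * v ^ 2 * L ^ 2)"
  proof (intro power_increasing)
    have "v ^ 2 * L * 1 \<le> v ^ 2 * L * L" using L_ge_1 by (intro mult_left_mono) auto
    then show "7 * v + (1 + L + 111 * v ^ 2 * L * L + 105 * v ^ 2) \<le> 225 * v ^ 2 * L ^ 2"
      using vL unfolding power2_eq_square[of L] by linarith
  qed simp
  also have "\<dots> \<le> exp (real (225 * v ^ 2 * L ^ 2))"
  proof -
    have "(2::real) ^ n \<le> exp (real n)" for n
      using power_mono[of 2 "exp (1::real)" n] exp_ge_add_one_self[of 1] by (simp flip: exp_of_nat_mult)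
    then show ?thesis .
  qed
  finally have "2 ^ R * ((1 + real s * K ^ L) * H ^ R) * exp (1 - lam / 8) \<le>
      exp (real (225 * v ^ 2 * L ^ 2)) * exp (1 - lam / 8)"
    by (intro mult_right_mono) auto
  also have "\<dots> = 1"
  proof -
    have e: "1 - lam / 8 = - real (225 * v ^ 2 * L ^ 2)"
      by (simp add: lam_def add_divide_distrib)
    show ?thesis
      by (simp only: e exp_minus right_inverse exp_not_eq_zero not_False_eq_True)
  qed
  finally show ?thesis
    unfolding K_def H_def by (simp only: of_nat_add of_nat_mult of_nat_1 of_nat_power of_nat_numeral)
qed

lemma analysis: "bounded_instance s t I \<Longrightarrow> lca_analysis s t a d R L I lam b"
  using s t s_less L_le t_le st_le lam_large
  by unfold_locales (simp_all add: d_def R_def lam_def)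

section \<open>Size of the query budget\<close>

sublocale cost_bound s t d R L lam .

text \<open>The bound of \<open>expected_total_cost\<close> per element, times \<open>s\<close>,
  rounded up: what \<open>expected_size_le\<close> asks for.\<close>

definition budget :: nat where
  "budget = nat \<lceil>real s * (real (Suc L) * G ^ L)\<rceil>"

lemma lam_nonneg: "0 \<le> lam"
  by (simp add: lam_def)

text \<open>From \<open>lam \<le> 1808 * (v ^ 2 * L ^ 2)\<close> and
  \<open>Suc d \<le> 6 * v\<close> the coefficient is at most
  \<open>10848 + 1 \<le> 2 ^ 14\<close>.\<close>

lemma q_le: "1 + real (Suc d) * lam \<le> 2 ^ 14 * real v ^ 3 * real L ^ 2"
proof -
  have v: "1 \<le> real v" using v_ge_1 by simp
  have L: "1 \<le> real L" using L_ge_1 by simp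
  have vL: "1 \<le> real v ^ 2 * real L ^ 2"
  proof -
    have "1 * 1 \<le> real v ^ 2 * real L ^ 2"
      by (intro mult_mono one_le_power v L) simp_all
    then show ?thesis by (simp only: mult_1)
  qed
  moreover have "lam = 1800 * (real v ^ 2 * real L ^ 2) + 8" by (simp add: lam_def)
  ultimately have "lam \<le> 1808 * (real v ^ 2 * real L ^ 2)" by linarith
  then have "real (Suc d) * lam \<le> (6 * real v) * (1808 * (real v ^ 2 * real L ^ 2))"
    using c_le lam_nonneg by (intro mult_mono) auto
  moreover have "1 \<le> real v * (real v ^ 2 * real L ^ 2)"
    using mult_mono[OF v vL] by (simp only: mult_1 of_nat_0_le_iff zero_le_one)
  ultimately show ?thesis by (simp add: power2_eq_square power3_eq_cube)
qed

text \<open>The decisive factor is the polylogarithm \<open>1 + Suc d * lam\<close> to the power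
  \<open>R \<le> 7 * v\<close>; the remaining power of 2 is polynomial in \<open>s\<close> and
  \<open>t\<close>. Three groups of summands of \<open>G\<close> each take at most a third of the
  bound.\<close>

lemma G_le: "G \<le> 2 ^ (23 * v + 3 * L) * (2 ^ 14 * real v ^ 3 * real L ^ 2) ^ (7 * v)"
proof -
  define y where "y = (2 ^ 14 * real v ^ 3 * real L ^ 2) ^ (7 * v)"
  have q1: "1 \<le> 1 + real (Suc d) * lam" using lam_nonneg by simp
  have "(1 + real (Suc d) * lam) ^ R \<le> (1 + real (Suc d) * lam) ^ (7 * v)"
    by (intro power_increasing R_le q1)
  also have "\<dots> \<le> y"
    unfolding y_def using q1 by (intro power_mono q_le) simp
  finally have y: "(1 + real (Suc d) * lam) ^ R \<le> y" .
  have y1: "1 \<le> y" using y one_le_power[OF q1, of R] by linarith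
  have R2: "(2::real) ^ R \<le> 2 ^ (7 * v)" by (intro power_increasing R_le) simp
  have R': "real R \<le> 2 ^ (7 * v)" using le_two_power[of R] R2 by linarith
  have v2: "(2::real) \<le> 2 ^ v" using power_increasing[of 1 v "2::real"] v_ge_1 by simp
  have "2 + real t \<le> 2 * 2 ^ v" using t_le_v v2 by linarith
  also have "\<dots> \<le> 2 ^ v * 2 ^ v" using v2 by (intro mult_right_mono) auto
  finally have t2: "2 + real t \<le> 2 ^ (2 * v)" by (simp add: mult_2 power_add)
  have B: "B\<^sub>0 \<le> 2 ^ (9 * v) * y"
  proof -
    have "B\<^sub>0 \<le> 2 ^ (7 * v) * 2 ^ (2 * v) * y"
      unfolding B\<^sub>0_def using q1 by (intro mult_mono R2 t2 y) auto
    also have "\<dots> = 2 ^ (9 * v) * y" by (simp flip: power_add)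
    finally show ?thesis .
  qed
  have B0: "0 \<le> B\<^sub>0" using q1 by (simp add: B\<^sub>0_def)
  have one: "(1::real) \<le> 2 ^ m * y" for m using mult_mono[of 1 "2 ^ m" 1 y] y1 by simp
  have X: "X\<^sub>0 \<le> 2 ^ (17 * v + L) * y"
  proof -
    have "real t \<le> 2 ^ L * (2 ^ (9 * v) * y)"
    proof -
      have "real t * 1 \<le> 2 ^ v * (2 ^ (L + 8 * v) * y)"
        by (intro mult_mono t_le_v one) auto
      moreover have "(2::real) ^ v * (2 ^ (L + 8 * v) * y) = 2 ^ L * (2 ^ (9 * v) * y)"
      proof -
        have "v + (L + 8 * v) = L + 9 * v" by simp
        then show ?thesis by (simp only: mult.assoc[symmetric] power_add[symmetric])
      qed
      ultimately show ?thesis by (simp only: mult_1_right)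
    qed
    moreover have "2 ^ L * B\<^sub>0 \<le> 2 ^ L * (2 ^ (9 * v) * y)" by (intro mult_left_mono B) simp
    ultimately have "real t + 2 ^ L * B\<^sub>0 \<le> 2 * (2 ^ L * (2 ^ (9 * v) * y))" by linarith
    also have "\<dots> \<le> 2 ^ v * (2 ^ L * (2 ^ (9 * v) * y))" using v2 y1 by (intro mult_right_mono) auto
    finally have "X\<^sub>0 \<le> 2 ^ (7 * v) * (2 ^ v * (2 ^ L * (2 ^ (9 * v) * y)))"
      unfolding X\<^sub>0_def using B0 by (intro mult_mono R') auto
    also have "\<dots> = 2 ^ (7 * v + v + L + 9 * v) * y" by (simp only: power_add mult.assoc)
    also have "7 * v + v + L + 9 * v = 17 * v + L" by simp
    finally show ?thesis .
  qed
  have X0: "0 \<le> X\<^sub>0" using B0 by (simp add: X\<^sub>0_def)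
  have st: "real s * real t \<le> 2 ^ (L + v)"
    unfolding power_add by (intro mult_mono s_le_L t_le_v) auto
  have one': "(1::real) \<le> 2 ^ m" for m by simp
  have p1: "1 + real t + real s * real s * real t \<le> 2 ^ (23 * v + 3 * L) * y / 3"
  proof -
    have "1 + real t + real s * real s * real t \<le> 1 + 2 ^ v + 2 ^ L * 2 ^ L * 2 ^ v"
      by (intro add_mono mult_mono s_le_L t_le_v) auto
    also have "\<dots> \<le> 3 * (2 ^ L * 2 ^ L * 2 ^ v)"
    proof -
      have "1 * 1 * 2 ^ v \<le> 2 ^ L * 2 ^ L * (2::real) ^ v" by (intro mult_mono) auto
      then show ?thesis using one'[of v] by linarith
    qed
    also have "\<dots> \<le> (2 ^ (4 * v) / 3) * (2 ^ L * 2 ^ L * 2 ^ v)"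
    proof (intro mult_right_mono)
      have "(16::real) \<le> 2 ^ (4 * v)" using power_increasing[of 4 "4 * v" "2::real"] v_ge_1 by simp
      then show "(3::real) \<le> 2 ^ (4 * v) / 3" by simp
    qed simp
    also have "\<dots> = 2 ^ (4 * v + (L + L + v)) / 3" by (simp only: power_add times_divide_eq_left)
    also have "4 * v + (L + L + v) = 5 * v + 2 * L" by simp
    also have "2 ^ (5 * v + 2 * L) / 3 \<le> 2 ^ (23 * v + 3 * L) * y / 3"
    proof -
      have "2 ^ (5 * v + 2 * L) * 1 \<le> 2 ^ (23 * v + 3 * L) * y"
        using y1 by (intro mult_mono power_increasing) auto
      then show ?thesis by simp
    qed
    finally show ?thesis .
  qed
  have three: "2 ^ m * (2 * z) \<le> 2 ^ (3 * v + m) * z / 3" if "0 \<le> z" for z :: real and m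
  proof -
    have "(8::real) \<le> 2 ^ (3 * v)" using power_increasing[of 3 "3 * v" "2::real"] v_ge_1 by simp
    then have "6 * (2 ^ m * z) \<le> 2 ^ (3 * v) * (2 ^ m * z)" using that by (intro mult_right_mono) auto
    then show ?thesis by (simp add: power_add)
  qed
  have p2: "(1 + real s * real t) * X\<^sub>0 * (real s * real t) \<le> 2 ^ (23 * v + 3 * L) * y / 3"
  proof -
    have "(1 + real s * real t) * X\<^sub>0 * (real s * real t) \<le> (2 * 2 ^ (L + v)) * (2 ^ (17 * v + L) * y) * 2 ^ (L + v)"
    proof (intro mult_mono)
      show "1 + real s * real t \<le> 2 * 2 ^ (L + v)" using st one'[of "L + v"] by linarith
    qed (use X0 st X y1 in auto)
    also have "\<dots> = 2 ^ ((L + v) + (17 * v + L) + (L + v)) * (2 * y)"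
      unfolding power_add by (simp only: ac_simps)
    also have "(L + v) + (17 * v + L) + (L + v) = 19 * v + 3 * L" by simp
    also have "2 ^ (19 * v + 3 * L) * (2 * y) \<le> 2 ^ (3 * v + (19 * v + 3 * L)) * y / 3" using y1 by (intro three) simp
    also have "\<dots> \<le> 2 ^ (23 * v + 3 * L) * y / 3"
      using y1 by (intro divide_right_mono mult_right_mono power_increasing) auto
    finally show ?thesis .
  qed
  have p3: "(real R * B\<^sub>0 + 1) * (real s * real t) \<le> 2 ^ (23 * v + 3 * L) * y / 3"
  proof -
    have "real R * B\<^sub>0 \<le> 2 ^ (7 * v) * (2 ^ (9 * v) * y)" using B0 by (intro mult_mono R' B) auto
    also have "\<dots> = 2 ^ (16 * v) * y" by (simp flip: power_add mult.assoc)
    finally have "real R * B\<^sub>0 + 1 \<le> 2 * (2 ^ (16 * v) * y)" using one[of "16 * v"] by linarith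
    then have "(real R * B\<^sub>0 + 1) * (real s * real t) \<le> (2 * (2 ^ (16 * v) * y)) * 2 ^ (L + v)"
      using st B0 y1 by (intro mult_mono) auto
    also have "\<dots> = 2 ^ (16 * v + (L + v)) * (2 * y)"
      unfolding power_add by (simp only: ac_simps)
    also have "16 * v + (L + v) = 17 * v + L" by simp
    also have "2 ^ (17 * v + L) * (2 * y) \<le> 2 ^ (3 * v + (17 * v + L)) * y / 3" using y1 by (intro three) simp
    also have "\<dots> \<le> 2 ^ (23 * v + 3 * L) * y / 3"
      using y1 by (intro divide_right_mono mult_right_mono power_increasing) auto
    finally show ?thesis .
  qed
  show ?thesis
    using p1 p2 p3 unfolding G_def y_def[symmetric] by linarith
qed

lemma G_ge_1: "1 \<le> G"
proof -
  have "0 \<le> B\<^sub>0" using lam_nonneg by (simp add: B\<^sub>0_def)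
  moreover from this have "0 \<le> X\<^sub>0" by (simp add: X\<^sub>0_def)
  ultimately show ?thesis by (simp add: G_def)
qed

lemma s_le_budget_arg: "real s \<le> real s * (real (Suc L) * G ^ L)"
proof -
  have "1 * 1 \<le> real (Suc L) * G ^ L"
    using one_le_power[OF G_ge_1, of L] by (intro mult_mono) auto
  then show ?thesis using mult_left_mono[of 1 "real (Suc L) * G ^ L" "real s"] by simp
qed

lemma le_budget: "real s * (real (Suc L) * G ^ L) \<le> budget"
  unfolding budget_def by (rule real_nat_ceiling_ge)

lemma s_le_budget: "s \<le> budget"
  using s_le_budget_arg le_budget by linarith

text \<open>The main term is \<open>L * 7 * v * log 2 q\<close>: there are \<open>L = O(x)\<close>
  phases, \<open>v\<close> is of order \<open>z + log x\<close>, and \<open>log 2 q\<close> is of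
  order \<open>1 + log x + log z\<close>.\<close>

lemma log_budget:
  defines "x \<equiv> log 2 s" and "z \<equiv> log 2 t"
  shows "log 2 budget \<le> 6244 * (x * x) + 3304 * (z * (x * (log 2 x + log 2 z)))"
proof -
  define q where "q = 2 ^ 14 * real v ^ 3 * real L ^ 2"
  have v1: "1 \<le> real v" and L1: "1 \<le> real L" using v_ge_1 L_ge_1 by simp_all
  have q1: "1 \<le> q"
    unfolding q_def
    using mult_mono[OF mult_mono[of 1 "2 ^ 14", OF _ one_le_power[OF v1, of 3]] one_le_power[OF L1, of 2]] by simp
  have "real budget \<le> real s * (real (Suc L) * G ^ L) + 1"
    using s_le_budget_arg unfolding budget_def by linarith
  also have "\<dots> \<le> 2 * (real s * (real (Suc L) * G ^ L))"
    using s_le_budget_arg s by linarith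
  also have "\<dots> \<le> 2 * (2 ^ L * (2 ^ L * (2 ^ (23 * v + 3 * L) * q ^ (7 * v)) ^ L))"
  proof -
    have "Suc L \<le> 2 ^ L" using less_exp[of L] by linarith
    then have "real (Suc L) \<le> 2 ^ L" by (metis of_nat_le_iff of_nat_numeral of_nat_power)
    moreover have "G ^ L \<le> (2 ^ (23 * v + 3 * L) * q ^ (7 * v)) ^ L"
      using G_le G_ge_1 unfolding q_def by (intro power_mono) auto
    ultimately show ?thesis
      using s_le_L G_ge_1 by (intro mult_left_mono mult_mono) auto
  qed
  finally have "log 2 budget \<le> log 2 (2 * (2 ^ L * (2 ^ L * (2 ^ (23 * v + 3 * L) * q ^ (7 * v)) ^ L)))"
    using s_le_budget s q1 by (intro log_mono) auto
  also have "\<dots> = 1 + (real L + (real L + real L * (real (23 * v + 3 * L) + real (7 * v) * log 2 q)))"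
    using q1 by (simp add: log_mult log_nat_power)
  also have "log 2 q = 14 + 3 * log 2 v + 2 * log 2 L"
  proof -
    have pow: "log 2 ((2::real) ^ n) = n" for n by (simp add: log_nat_power)
    have "log 2 q = log 2 (2 ^ 14) + log 2 (real v ^ 3) + log 2 (real L ^ 2)"
      unfolding q_def using v1 L1 by (simp only: log_mult) (auto simp: log_mult)
    then show ?thesis
      using v1 L1 by (simp only: pow) (simp add: log_nat_power)
  qed
  finally have main: "log 2 budget \<le> 1 + 2 * real L + real L * (23 * v + 3 * L + 7 * real v * (14 + 3 * log 2 v + 2 * log 2 L))"
    by (simp add: algebra_simps)

  have x1: "1 \<le> x" and z1: "1 \<le> z"
    using log_mono[of 2 2 "real s"] log_mono[of 2 2 "real t"] s t by (simp_all add: x_def z_def)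
  define lx where "lx = log 2 x"
  define lz where "lz = log 2 z"
  have lx0: "0 \<le> lx" and lz0: "0 \<le> lz" using x1 z1 by (simp_all add: lx_def lz_def)
  have lx_x: "lx \<le> x" and lz_z: "lz \<le> z"
    using log2_le_self x1 z1 by (simp_all add: lx_def lz_def)
  \<comment> \<open>Taking the logarithm of \<open>sqrt x\<close> improves \<open>lx \<le> x\<close>
    to \<open>lx \<le> 2 * sqrt x\<close>, so that even \<open>x * (lx * lx)\<close> is absorbed by
    \<open>x * x\<close>.\<close>
  have lx2: "lx * lx \<le> 4 * x"
  proof -
    have "lx = 2 * log 2 (sqrt x)" using x1 by (simp add: lx_def log_def ln_sqrt)
    also have "\<dots> \<le> 2 * sqrt x" using log2_le_self[of "sqrt x"] x1 by simp
    finally have "lx * lx \<le> (2 * sqrt x) * (2 * sqrt x)"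
      using lx0 x1 by (intro mult_mono) auto
    then show ?thesis using x1 by simp
  qed
  have xz: "x \<le> x * z" "z \<le> x * z"
    using mult_left_mono[OF z1, of x] mult_right_mono[OF x1, of z] x1 z1 by simp_all
  then have "1 \<le> x * z" using x1 by linarith
  note xz = xz this
  have L_x: "real L \<le> 2 * x"
  proof -
    have "(2::real) ^ L \<le> 2 * s"
      using L_le by (metis of_nat_le_iff of_nat_mult of_nat_numeral of_nat_power)
    then have "log 2 (2 ^ L) \<le> log 2 (2 * real s)" using s by (intro log_mono) simp_all
    then have "real L \<le> 1 + x" using s by (simp add: log_nat_power log_mult x_def)
    then show ?thesis using x1 by simp
  qed
  have "real a \<le> z + 1" using clog_le[of t] t by (simp add: a_def z_def)
  moreover have "real b \<le> 3 + lx + lz"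
  proof -
    have "2 * 2 \<le> s * t" by (intro mult_le_mono s t)
    then have st1: "1 < s * t" by linarith
    then have pos: "1 \<le> clog (s * t)"
      using le_two_power_clog[of "s * t"] by (cases "clog (s * t)") auto
    have "real (clog (s * t)) \<le> log 2 (real (s * t)) + 1" by (rule clog_le) (use st1 in linarith)
    also have "\<dots> = x + z + 1" using s t by (simp add: log_mult x_def z_def)
    also have "\<dots> \<le> 4 * (x * z)" using xz by linarith
    finally have "log 2 (clog (s * t)) \<le> log 2 (4 * (x * z))" using pos by (intro log_mono) auto
    also have "\<dots> = log 2 (2 ^ 2) + (lx + lz)" using x1 z1 by (simp add: log_mult lx_def lz_def)
    also have "\<dots> = 2 + (lx + lz)" by (simp only: log_pow_cancel)
    finally show ?thesis using clog_le[OF pos] by (simp add: b_def)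
  qed
  ultimately have v_z: "real v \<le> 7 * z + lx"
    using z1 lz_z by (simp add: v_def)
  have log_v: "log 2 v \<le> 3 + lx + lz"
  proof -
    have "real v \<le> 8 * (x * z)" using v_z lx_x xz by linarith
    then have "log 2 v \<le> log 2 (2 ^ 3 * (x * z))" using v1 by (intro log_mono) auto
    also have "\<dots> = log 2 (2 ^ 3) + (lx + lz)"
      using x1 z1 by (simp add: log_mult lx_def lz_def)
    also have "\<dots> = 3 + (lx + lz)"
      by (simp only: log_pow_cancel)
    finally show ?thesis by simp
  qed
  have log_L: "log 2 L \<le> 1 + lx"
  proof -
    have "log 2 L \<le> log 2 (2 * x)" using L_x L1 by (intro log_mono) auto
    then show ?thesis using x1 by (simp add: log_mult lx_def)
  qed
  \<comment> \<open>This is \<open>23 + 7 * (14 + 3 * (3 + lx + lz) + 2 * (1 + lx))\<close>, after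
    inserting \<open>log_v\<close> and \<open>log_L\<close>.\<close>
  define W where "W = 198 + 21 * lz + 35 * lx"
  have W0: "0 \<le> W" using lx0 lz0 by (simp add: W_def)
  have "23 * real v + 7 * real v * (14 + 3 * log 2 v + 2 * log 2 L) \<le> real v * W"
  proof -
    have "real v * (23 + 7 * (14 + 3 * log 2 v + 2 * log 2 L)) \<le> real v * W"
      unfolding W_def using log_v log_L by (intro mult_left_mono) auto
    then show ?thesis by (simp add: algebra_simps)
  qed
  also have "\<dots> \<le> (7 * z + lx) * W" using v_z W0 by (rule mult_right_mono)
  finally have "real L * (23 * real v + 7 * real v * (14 + 3 * log 2 v + 2 * log 2 L)) \<le> (2 * x) * ((7 * z + lx) * W)"
    using L_x W0 z1 lx0 x1
    by (intro order_trans[OF mult_left_mono mult_right_mono]) (auto intro!: mult_nonneg_nonneg add_nonneg_nonneg)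
  moreover have "1 + 2 * real L + 3 * (real L * real L) \<le> 24 * (x * x)"
  proof -
    have "real L * 1 \<le> real L * real L" using L1 by (intro mult_left_mono) auto
    moreover have "real L * real L \<le> (2 * x) * (2 * x)" using L_x x1 by (intro mult_mono) auto
    ultimately show ?thesis using L1 by linarith
  qed
  ultimately have "log 2 budget \<le> 24 * (x * x) + (2 * x) * ((7 * z + lx) * W)"
    using main by (simp add: algebra_simps)
  also have "(2 * x) * ((7 * z + lx) * W) = 2772 * (x * z) + 294 * (x * z * lz) + 490 * (x * z * lx) +
      396 * (x * lx) + 42 * (x * lx * lz) + 70 * (x * (lx * lx))"
    by (simp add: W_def algebra_simps)
  finally have "log 2 budget \<le> 24 * (x * x) + (2772 * (x * z) + 294 * (x * z * lz) + 490 * (x * z * lx) +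
      396 * (x * lx) + 42 * (x * lx * lz) + 70 * (x * (lx * lx)))" .
  \<comment> \<open>The iterated logarithms vanish at \<open>s = t = 2\<close>, so
    \<open>x * z\<close> is not always bounded by \<open>x * z * (lx + lz)\<close>. For
    \<open>z \<le> 2\<close> it is moved into \<open>x * x\<close>, the exponent belonging to
    \<open>s\<close>; for larger \<open>z\<close> one has \<open>lz \<ge> 1\<close>.\<close>
  moreover have "x * z \<le> 2 * (x * x) + x * z * lz"
  proof (cases "z \<le> 2")
    case True
    have "x * z \<le> x * (2 * x)" using True x1 by (intro mult_left_mono) auto
    moreover have "0 \<le> x * z * lz" using x1 z1 lz0 by simp
    ultimately show ?thesis by simp
  next
    case False
    then have "log 2 2 \<le> lz" unfolding lz_def by (intro log_mono) auto
    then have "x * z * 1 \<le> x * z * lz" using x1 z1 by (intro mult_left_mono) auto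
    moreover have "0 \<le> x * x" by simp
    ultimately show ?thesis by linarith
  qed
  moreover have "x * lx \<le> x * x" using lx_x x1 by (intro mult_left_mono) auto
  moreover have "x * lx * lz \<le> x * z * lx"
    using mult_left_mono[OF lz_z, of "x * lx"] x1 lx0 by (simp add: mult_ac)
  moreover have "x * (lx * lx) \<le> 4 * (x * x)"
    using mult_left_mono[OF lx2, of x] x1 by simp
  \<comment> \<open>The coefficients are \<open>24 + 2 * 2772 + 396 + 4 * 70 = 6244\<close>,
    \<open>294 + 2772 = 3066\<close> and \<open>490 + 42 = 532\<close>.\<close>
  ultimately have "log 2 budget \<le> 6244 * (x * x) + (3066 * (x * z * lz) + 532 * (x * z * lx))"
    by linarith
  moreover have "0 \<le> x * z * lz" "0 \<le> x * z * lx" using x1 z1 lx0 lz0 by simp_all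
  ultimately show ?thesis
    unfolding lx_def[symmetric] lz_def[symmetric] by (simp add: algebra_simps)
qed

lemma budget_le:
  "real budget \<le> real s powr (6244 * log 2 s) *
     real t powr (3304 * (log 2 s * (log 2 (log 2 s) + log 2 (log 2 t))))"
proof -
  have "real budget = 2 powr (log 2 budget)"
    using s_le_budget s by (intro powr_log_cancel[symmetric]) auto
  also have "\<dots> \<le> 2 powr (6244 * (log 2 s * log 2 s) +
      3304 * (log 2 t * (log 2 s * (log 2 (log 2 s) + log 2 (log 2 t)))))"
    using log_budget by (intro powr_mono) auto
  also have "\<dots> = (2 powr log 2 s) powr (6244 * log 2 s) *
      (2 powr log 2 t) powr (3304 * (log 2 s * (log 2 (log 2 s) + log 2 (log 2 t))))"
    by (simp only: powr_powr powr_add) (simp add: mult_ac)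
  finally show ?thesis using s t by simp
qed

text \<open>From \<open>L \<le> 1 + log 2 s\<close> and \<open>1 \<le> log 2 s\<close>, with
  \<open>39 = 19 + 19 + 1\<close>.\<close>

lemma nineteen_L: "19 * real L + 1 \<le> 39 * log 2 s"
proof -
  have "(2::real) ^ L \<le> 2 * s"
    using L_le by (metis of_nat_le_iff of_nat_mult of_nat_numeral of_nat_power)
  then have "log 2 (2 ^ L) \<le> log 2 (2 * real s)" using s by (intro log_mono) simp_all
  then have "real L \<le> 1 + log 2 s" using s by (simp add: log_nat_power log_mult)
  moreover have "log 2 2 \<le> log 2 (real s)" using s by (intro log_mono) auto
  ultimately show ?thesis by simp
qed

section \<open>The resulting algorithm and its guarantees\<close>

definition algorithm :: lca where
  "algorithm T = truncate (lca_scheme.run_set s t a (Suc d) R L T Answer) budget"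

lemma set_cover_algorithm: "set_cover_lca s t algorithm"
  unfolding set_cover_lca_def algorithm_def[abs_def]
  using lca_analysis.cover[OF analysis s_le_budget] by blast

lemma query_complexity_algorithm:
  "query_complexity_le s t algorithm (real s powr (6244 * log 2 s) *
     real t powr (3304 * (log 2 s * (log 2 (log 2 s) + log 2 (log 2 t)))))"
  unfolding query_complexity_le_def algorithm_def
  using num_queries_truncate budget_le by (meson of_nat_mono order_trans)

lemma expected_size_algorithm:
  assumes "bounded_instance s t I"
  shows "expected_size algorithm I \<le> 39 * log 2 s * fractional_opt (sc_universe I) (sc_family I)"
proof -
  interpret an: lca_analysis s t a d R L I lam b
    by (rule analysis[OF assms])
  let ?S = "{(\<Sum>T\<in>sc_family I. x T) | x. is_fractional_cover (sc_universe I) (sc_family I) x}"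
  have c: "0 < 39 * log 2 s" using s by simp
  \<comment> \<open>\<open>fractional_opt\<close> is an infimum, so the bound is shown against every
    fractional cover instead of an optimal one.\<close>
  have le: "expected_size algorithm I / (39 * log 2 s) \<le> y" if y: "y \<in> ?S" for y
  proof -
    obtain x where x: "is_fractional_cover (sc_universe I) (sc_family I) x" "y = (\<Sum>T\<in>sc_family I. x T)"
      using y by blast
    have "real s * (real (Suc L) * G ^ L) \<le> budget" by (rule le_budget)
    then have "expected_size algorithm I \<le> (19 * real L + 1) * y"
      unfolding x(2) algorithm_def[abs_def]
      by (intro an.expected_size_le[OF x(1) s_le_budget])
    also have "\<dots> \<le> 39 * log 2 s * y"
    proof (rule mult_right_mono[OF nineteen_L])
      show "0 \<le> y" unfolding x(2) using x(1) by (intro sum_nonneg) (simp add: is_fractional_cover_def)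
    qed
    finally show ?thesis using c by (simp add: divide_le_eq mult.commute)
  qed
  \<comment> \<open>The constant 1 is a fractional cover because the family covers the universe; the
    infimum is thus taken over a nonempty set.\<close>
  have "is_fractional_cover (sc_universe I) (sc_family I) (\<lambda>_. 1)"
    unfolding is_fractional_cover_def
  proof (intro conjI ballI)
    fix e assume "e \<in> sc_universe I"
    then have "e \<in> \<Union>(sc_family I)" by (simp add: an.Union_family sc_universe_def)
    then have "{T \<in> sc_family I. e \<in> T} \<noteq> {}" by blast
    moreover have "finite {T \<in> sc_family I. e \<in> T}" by (simp add: sc_family_def)
    ultimately have "0 < card {T \<in> sc_family I. e \<in> T}" by (simp add: card_gt_0_iff)
    then show "1 \<le> (\<Sum>T\<in>{T \<in> sc_family I. e \<in> T}. 1::real)" by simp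
  qed simp
  then have "?S \<noteq> {}" by blast
  then have "expected_size algorithm I / (39 * log 2 s) \<le> fractional_opt (sc_universe I) (sc_family I)"
    unfolding fractional_opt_def using le by (intro cInf_greatest) auto
  then show ?thesis using c by (simp add: divide_le_eq mult.commute)
qed

end

theorem theorem1p1:
  "\<exists>(A :: nat \<Rightarrow> nat \<Rightarrow> lca) (c\<^sub>1 :: real) (c\<^sub>2 :: real) (c\<^sub>3 :: real).
     c\<^sub>1 > 0 \<and> c\<^sub>2 > 0 \<and> c\<^sub>3 > 0 \<and>
     (\<forall>(s :: nat) (t :: nat). s \<ge> 2 \<longrightarrow> t \<ge> 2 \<longrightarrow>
        set_cover_lca s t (A s t) \<and>
        query_complexity_le s t (A s t)
          (real s powr (c\<^sub>1 * log 2 s) *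
           real t powr (c\<^sub>2 * (log 2 s * (log 2 (log 2 s) + log 2 (log 2 t))))) \<and>
        (\<forall>I. bounded_instance s t I \<longrightarrow>
           expected_size (A s t) I \<le> c\<^sub>3 * log 2 s * fractional_opt (sc_universe I) (sc_family I)))"
\<comment> \<open>The witnesses stay schematic until the following \<open>show\<close> commands fix
  them as \<open>lca_parameters.algorithm\<close>, 6244, 3304 and 39.\<close>
proof (intro exI conjI allI impI)
  fix s t :: nat assume "2 \<le> s" "2 \<le> t"
  then interpret lca_parameters s t by unfold_locales
  show "set_cover_lca s t (lca_parameters.algorithm s t)"
    by (rule set_cover_algorithm)
  show "query_complexity_le s t (lca_parameters.algorithm s t) (real s powr (6244 * log 2 s) *
     real t powr (3304 * (log 2 s * (log 2 (log 2 s) + log 2 (log 2 t)))))"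
    by (rule query_complexity_algorithm)
  show "expected_size (lca_parameters.algorithm s t) I \<le> 39 * log 2 s * fractional_opt (sc_universe I) (sc_family I)"
    if "bounded_instance s t I" for I
    by (rule expected_size_algorithm[OF that])
qed simp_all

end
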